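(* Let $j$ be an isometric almost paracomplex structure on a pseudo-Riemannian 4-manifold $(M,g)$. Then $j$ is parallel if and only if the eigenplane distributions of $j$ are tangent to a pair of mutually orthogonal foliations of $M$ by totally geodesic surfaces.
   Context: An almost paracomplex structure on a smooth 4-manifold $M$ is an endomorphism field $j$ of $TM$ with $j^2=\mathrm{Id}$, $j\neq\mathrm{Id}$, whose $+1$ and $-1$ eigenspaces are both 2-dimensional at each point; these two rank 2 subbundles are the eigenplane distributions. It is isometric with respect to $g$ if $g(j\cdot,j\cdot)=g(\cdot,\cdot)$. It is parallel if $\nabla j=0$ for the Levi-Civita connection $\nabla$ of $g$. *)

theory Defs
  imports "HOL-Analysis.Analysis"
begin

section \<open>Smooth maps between Euclidean spaces\<close>

text \<open>All uses of the following two notions are on open sets.\<close>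

primrec Ck_on :: "nat \<Rightarrow> 'b::euclidean_space set \<Rightarrow> ('b \<Rightarrow> 'c::euclidean_space) \<Rightarrow> bool" where
  "Ck_on 0 S f \<longleftrightarrow> continuous_on S f"
| "Ck_on (Suc k) S f \<longleftrightarrow>
     (\<forall>x\<in>S. f differentiable (at x)) \<and> (\<forall>v. Ck_on k S (\<lambda>x. frechet_derivative f (at x) v))"

definition smooth_on :: "'b::euclidean_space set \<Rightarrow> ('b \<Rightarrow> 'c::euclidean_space) \<Rightarrow> bool" where
  "smooth_on S f \<longleftrightarrow> (\<forall>k. Ck_on k S f)"


section \<open>Smooth 4-manifolds\<close>

text \<open>A chart is a domain together with a coordinate map; the values of the map outside the
  domain are irrelevant.\<close>

type_synonym 'a chart = "'a set \<times> ('a \<Rightarrow> real^4)"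

abbreviation chart_dom :: "'a chart \<Rightarrow> 'a set" where "chart_dom \<equiv> fst"
abbreviation coord :: "'a chart \<Rightarrow> 'a \<Rightarrow> real^4" where "coord \<equiv> snd"

definition chart_image :: "'a chart \<Rightarrow> (real^4) set" where
  "chart_image c = coord c ` chart_dom c"

definition chart_inv :: "'a chart \<Rightarrow> real^4 \<Rightarrow> 'a" where
  "chart_inv c = inv_into (chart_dom c) (coord c)"

definition is_chart :: "'a::topological_space set \<Rightarrow> 'a chart \<Rightarrow> bool" where
  "is_chart M c \<longleftrightarrow> open (chart_dom c) \<and> chart_dom c \<subseteq> M \<and> open (chart_image c) \<and>
     homeomorphism (chart_dom c) (chart_image c) (coord c) (chart_inv c)"

definition transition :: "'a chart \<Rightarrow> 'a chart \<Rightarrow> real^4 \<Rightarrow> real^4" where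
  "transition c d = coord d \<circ> chart_inv c"

definition overlap :: "'a chart \<Rightarrow> 'a chart \<Rightarrow> (real^4) set" where
  "overlap c d = coord c ` (chart_dom c \<inter> chart_dom d)"

definition smoothly_compatible :: "'a chart \<Rightarrow> 'a chart \<Rightarrow> bool" where
  "smoothly_compatible c d \<longleftrightarrow>
     smooth_on (overlap c d) (transition c d) \<and> smooth_on (overlap d c) (transition d c)"

text \<open>A smooth structure is a maximal smooth atlas. \<open>M\<close> is an open subset of the
  ambient space, whose type carries the Hausdorff and second countability axioms.\<close>

definition smooth_4_manifold ::
  "'a::{t2_space,second_countable_topology} set \<Rightarrow> 'a chart set \<Rightarrow> bool" where
  "smooth_4_manifold M A \<longleftrightarrow>
     (\<forall>c\<in>A. is_chart M c) \<and>
     (\<Union>c\<in>A. chart_dom c) = M \<and>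
     (\<forall>c\<in>A. \<forall>d\<in>A. smoothly_compatible c d) \<and>
     (\<forall>c. is_chart M c \<and> (\<forall>d\<in>A. smoothly_compatible c d) \<longrightarrow> c \<in> A)"


section \<open>Tensor fields and connections\<close>

text \<open>Tangent vectors at \<open>p\<close> are represented in each chart around \<open>p\<close> by their component vector,
  and the representatives in two charts correspond under the Jacobian of the transition map.
  Tensor fields and connections are accordingly given, for every chart of the maximal atlas,
  by their local expressions on the chart image, subject to the transformation law.\<close>

definition jacobian :: "'a chart \<Rightarrow> 'a chart \<Rightarrow> real^4 \<Rightarrow> real^4 \<Rightarrow> real^4" where
  "jacobian c d x = frechet_derivative (transition c d) (at x)"

type_synonym 'a endo_field = "'a chart \<Rightarrow> real^4 \<Rightarrow> real^4 \<Rightarrow> real^4"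
type_synonym 'a form_field = "'a chart \<Rightarrow> real^4 \<Rightarrow> real^4 \<Rightarrow> real^4 \<Rightarrow> real"
type_synonym 'a connection = "'a chart \<Rightarrow> real^4 \<Rightarrow> real^4 \<Rightarrow> real^4 \<Rightarrow> real^4"

definition smooth_endo_field :: "'a chart set \<Rightarrow> 'a endo_field \<Rightarrow> bool" where
  "smooth_endo_field A j \<longleftrightarrow>
     (\<forall>c\<in>A. (\<forall>x\<in>chart_image c. linear (j c x)) \<and> (\<forall>v. smooth_on (chart_image c) (\<lambda>x. j c x v))) \<and>
     (\<forall>c\<in>A. \<forall>d\<in>A. \<forall>x\<in>overlap c d. \<forall>v.
        jacobian c d x (j c x v) = j d (transition c d x) (jacobian c d x v))"

definition smooth_form_field :: "'a chart set \<Rightarrow> 'a form_field \<Rightarrow> bool" where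
  "smooth_form_field A g \<longleftrightarrow>
     (\<forall>c\<in>A. (\<forall>x\<in>chart_image c. bilinear (g c x)) \<and>
            (\<forall>u v. smooth_on (chart_image c) (\<lambda>x. g c x u v))) \<and>
     (\<forall>c\<in>A. \<forall>d\<in>A. \<forall>x\<in>overlap c d. \<forall>u v.
        g c x u v = g d (transition c d x) (jacobian c d x u) (jacobian c d x v))"

definition pseudo_riemannian_metric :: "'a chart set \<Rightarrow> 'a form_field \<Rightarrow> bool" where
  "pseudo_riemannian_metric A g \<longleftrightarrow> smooth_form_field A g \<and>
     (\<forall>c\<in>A. \<forall>x\<in>chart_image c.
        (\<forall>u v. g c x u v = g c x v u) \<and> (\<forall>u. (\<forall>v. g c x u v = 0) \<longrightarrow> u = 0))"

text \<open>\<open>\<Gamma> c x u v\<close> is the vector with components \<open>\<Gamma>\<^sup>k\<^sub>i\<^sub>j u\<^sup>i v\<^sup>j\<close>, so that a vector field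
  with local expression \<open>Y\<close> has covariant derivative \<open>D Y(x) u + \<Gamma> c x u (Y x)\<close> in the
  direction \<open>u\<close>. The transformation law says that this is again a tangent vector.\<close>

definition affine_connection :: "'a chart set \<Rightarrow> 'a connection \<Rightarrow> bool" where
  "affine_connection A \<Gamma> \<longleftrightarrow>
     (\<forall>c\<in>A. (\<forall>x\<in>chart_image c. bilinear (\<Gamma> c x)) \<and>
            (\<forall>u v. smooth_on (chart_image c) (\<lambda>x. \<Gamma> c x u v))) \<and>
     (\<forall>c\<in>A. \<forall>d\<in>A. \<forall>x\<in>overlap c d. \<forall>u v.
        jacobian c d x (\<Gamma> c x u v) =
          frechet_derivative (\<lambda>z. jacobian c d z v) (at x) u +
          \<Gamma> d (transition c d x) (jacobian c d x u) (jacobian c d x v))"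

text \<open>Torsion-freeness and compatibility with the metric, tested on coordinate fields.\<close>

definition levi_civita :: "'a chart set \<Rightarrow> 'a form_field \<Rightarrow> 'a connection \<Rightarrow> bool" where
  "levi_civita A g \<Gamma> \<longleftrightarrow> affine_connection A \<Gamma> \<and>
     (\<forall>c\<in>A. \<forall>x\<in>chart_image c. \<forall>u v. \<Gamma> c x u v = \<Gamma> c x v u) \<and>
     (\<forall>c\<in>A. \<forall>x\<in>chart_image c. \<forall>u v w.
        frechet_derivative (\<lambda>z. g c z v w) (at x) u = g c x (\<Gamma> c x u v) w + g c x v (\<Gamma> c x u w))"


section \<open>Almost paracomplex structures\<close>

text \<open>The eigenspace at the point \<open>p\<close>, in components with respect to the chart \<open>d\<close>.\<close>

definition eigenplane :: "'a endo_field \<Rightarrow> real \<Rightarrow> 'a chart \<Rightarrow> 'a \<Rightarrow> (real^4) set" where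
  "eigenplane j \<epsilon> d p = {v. j d (coord d p) v = \<epsilon> *\<^sub>R v}"

definition almost_paracomplex :: "'a chart set \<Rightarrow> 'a endo_field \<Rightarrow> bool" where
  "almost_paracomplex A j \<longleftrightarrow> smooth_endo_field A j \<and>
     (\<forall>d\<in>A. \<forall>p\<in>chart_dom d.
        j d (coord d p) \<circ> j d (coord d p) = id \<and> j d (coord d p) \<noteq> id \<and>
        dim (eigenplane j 1 d p) = 2 \<and> dim (eigenplane j (-1) d p) = 2)"

definition isometric :: "'a chart set \<Rightarrow> 'a form_field \<Rightarrow> 'a endo_field \<Rightarrow> bool" where
  "isometric A g j \<longleftrightarrow>
     (\<forall>c\<in>A. \<forall>x\<in>chart_image c. \<forall>u v. g c x (j c x u) (j c x v) = g c x u v)"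

text \<open>\<open>(\<nabla>\<^sub>u j) v = \<nabla>\<^sub>u (j v) - j (\<nabla>\<^sub>u v)\<close>, with \<open>v\<close> extended by constant components.\<close>

definition nabla_endo :: "'a connection \<Rightarrow> 'a endo_field \<Rightarrow> 'a chart \<Rightarrow> real^4 \<Rightarrow> real^4 \<Rightarrow> real^4 \<Rightarrow> real^4"
  where
  "nabla_endo \<Gamma> j c x u v =
     (frechet_derivative (\<lambda>z. j c z v) (at x) u + \<Gamma> c x u (j c x v)) - j c x (\<Gamma> c x u v)"

definition parallel :: "'a chart set \<Rightarrow> 'a connection \<Rightarrow> 'a endo_field \<Rightarrow> bool" where
  "parallel A \<Gamma> j \<longleftrightarrow> (\<forall>c\<in>A. \<forall>x\<in>chart_image c. \<forall>u v. nabla_endo \<Gamma> j c x u v = 0)"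


section \<open>Parametrized surfaces\<close>

text \<open>The tangent plane of a parametrized surface \<open>f\<close> at \<open>f s\<close>, in components with respect to \<open>d\<close>.\<close>

definition tangent_plane :: "'a chart \<Rightarrow> (real^2 \<Rightarrow> 'a) \<Rightarrow> real^2 \<Rightarrow> (real^4) set" where
  "tangent_plane d f s = range (frechet_derivative (coord d \<circ> f) (at s))"

text \<open>The ambient covariant derivative, in the direction \<open>a\<close>, of the field \<open>Df b\<close> along \<open>f\<close>.\<close>

definition nabla_along ::
  "'a connection \<Rightarrow> 'a chart \<Rightarrow> (real^2 \<Rightarrow> 'a) \<Rightarrow> real^2 \<Rightarrow> real^2 \<Rightarrow> real^2 \<Rightarrow> real^4" where
  "nabla_along \<Gamma> d f s a b =
     (let F = coord d \<circ> f in
       frechet_derivative (\<lambda>t. frechet_derivative F (at t) b) (at s) a +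
       \<Gamma> d (F s) (frechet_derivative F (at s) a) (frechet_derivative F (at s) b))"

text \<open>Vanishing second fundamental form: ambient covariant derivatives of tangential fields in
  tangential directions are tangential. By the Leibniz rule it suffices to test the fields
  \<open>Df b\<close> with \<open>b\<close> constant, as these span the tangent planes.\<close>

definition totally_geodesic_patch ::
  "'a chart set \<Rightarrow> 'a connection \<Rightarrow> (real^2) set \<Rightarrow> (real^2 \<Rightarrow> 'a) \<Rightarrow> bool" where
  "totally_geodesic_patch A \<Gamma> W f \<longleftrightarrow>
     (\<forall>s\<in>W. \<forall>d\<in>A. f s \<in> chart_dom d \<longrightarrow> (\<forall>a b. nabla_along \<Gamma> d f s a b \<in> tangent_plane d f s))"


section \<open>Foliations by surfaces\<close>

text \<open>In a foliated chart the first two coordinates run along the leaves and the last two are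
  transverse.\<close>

definition transverse :: "real^4 \<Rightarrow> real^2" where
  "transverse x = vector [x $ 3, x $ 4]"

definition join :: "real^2 \<Rightarrow> real^2 \<Rightarrow> real^4" where
  "join s y = vector [s $ 1, s $ 2, y $ 1, y $ 2]"

text \<open>On overlaps, the transverse coordinates of one foliated chart are locally functions of the
  transverse coordinates of the other.\<close>

definition coherent :: "'a::topological_space chart \<Rightarrow> 'a chart \<Rightarrow> bool" where
  "coherent c d \<longleftrightarrow>
     (\<forall>p \<in> chart_dom c \<inter> chart_dom d. \<exists>N. open N \<and> p \<in> N \<and> N \<subseteq> chart_dom c \<inter> chart_dom d \<and>
        (\<forall>q\<in>N. \<forall>r\<in>N. transverse (coord c q) = transverse (coord c r) \<longrightarrow>
                       transverse (coord d q) = transverse (coord d r)))"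

text \<open>A two-dimensional foliation is given by a foliated atlas.\<close>

definition foliation :: "'a::topological_space set \<Rightarrow> 'a chart set \<Rightarrow> 'a chart set \<Rightarrow> bool" where
  "foliation M A F \<longleftrightarrow> F \<subseteq> A \<and> (\<Union>c\<in>F. chart_dom c) = M \<and>
     (\<forall>c\<in>F. \<exists>a b. chart_image c = box a b) \<and>
     (\<forall>c\<in>F. \<forall>d\<in>F. coherent c d)"

text \<open>A plaque is a level set of the transverse coordinates in a foliated chart; it is connected
  because the chart image is a box. It is parametrized by the remaining two coordinates.\<close>

definition plaque :: "'a chart \<Rightarrow> real^2 \<Rightarrow> 'a set" where
  "plaque c y = {p \<in> chart_dom c. transverse (coord c p) = y}"

definition plaque_dom :: "'a chart \<Rightarrow> real^2 \<Rightarrow> (real^2) set" where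
  "plaque_dom c y = {s. join s y \<in> chart_image c}"

definition plaque_map :: "'a chart \<Rightarrow> real^2 \<Rightarrow> real^2 \<Rightarrow> 'a" where
  "plaque_map c y s = chart_inv c (join s y)"

text \<open>Leaves are the classes of points that can be joined by a finite chain of overlapping
  plaques.\<close>

definition same_plaque :: "'a chart set \<Rightarrow> ('a \<times> 'a) set" where
  "same_plaque F = {(p, q). \<exists>c\<in>F. \<exists>y. p \<in> plaque c y \<and> q \<in> plaque c y}"

definition leaves :: "'a set \<Rightarrow> 'a chart set \<Rightarrow> 'a set set" where
  "leaves M F = M // (same_plaque F)\<^sup>+"

text \<open>The local parametrizations of a leaf by its plaques. The leaf is an immersed surface in
  the topology generated by its plaques, and these parametrizations are inverse to charts of it.\<close>

definition leaf_patches :: "'a chart set \<Rightarrow> 'a set \<Rightarrow> ((real^2) set \<times> (real^2 \<Rightarrow> 'a)) set" where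
  "leaf_patches F L = {(plaque_dom c y, plaque_map c y) | c y. c \<in> F \<and> plaque c y \<subseteq> L}"

definition leaf_tangent :: "'a chart set \<Rightarrow> 'a set \<Rightarrow> 'a chart \<Rightarrow> 'a \<Rightarrow> (real^4) set" where
  "leaf_tangent F L d p = (\<Union>(W, f)\<in>leaf_patches F L. \<Union>s\<in>{s\<in>W. f s = p}. tangent_plane d f s)"

definition totally_geodesic_leaf ::
  "'a chart set \<Rightarrow> 'a connection \<Rightarrow> 'a chart set \<Rightarrow> 'a set \<Rightarrow> bool" where
  "totally_geodesic_leaf A \<Gamma> F L \<longleftrightarrow>
     (\<forall>(W, f)\<in>leaf_patches F L. totally_geodesic_patch A \<Gamma> W f)"

definition tangent_to_foliation ::
  "'a set \<Rightarrow> 'a chart set \<Rightarrow> ('a chart \<Rightarrow> 'a \<Rightarrow> (real^4) set) \<Rightarrow> 'a chart set \<Rightarrow> bool" where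
  "tangent_to_foliation M A E F \<longleftrightarrow>
     (\<forall>L\<in>leaves M F. \<forall>d\<in>A. \<forall>p\<in>L \<inter> chart_dom d. E d p = leaf_tangent F L d p)"

definition orthogonal_foliations ::
  "'a set \<Rightarrow> 'a chart set \<Rightarrow> 'a form_field \<Rightarrow> 'a chart set \<Rightarrow> 'a chart set \<Rightarrow> bool" where
  "orthogonal_foliations M A g F G \<longleftrightarrow>
     (\<forall>L\<in>leaves M F. \<forall>K\<in>leaves M G. \<forall>d\<in>A. \<forall>p\<in>L \<inter> K \<inter> chart_dom d.
        \<forall>u\<in>leaf_tangent F L d p. \<forall>v\<in>leaf_tangent G K d p. g d (coord d p) u v = 0)"

end

theory Submission
  imports Defs
begin

text \<open>Let \<open>P = (id + j) / 2\<close> be the projection onto an eigenplane distribution; replacing \<open>j\<close> by \<open>-j\<close>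
  exchanges the two distributions.

  If \<open>j\<close> is parallel, the leaf through a point is swept out by the solutions of
  \<open>u' = P(u) \<sigma>\<close> with \<open>\<sigma>\<close> constant in a chart: for a variation \<open>V\<close> of such a solution the component
  \<open>V - P V\<close> is parallel along \<open>u\<close> and starts at zero. Smooth dependence of the solutions on initial
  values and on \<open>\<sigma>\<close>, together with the inverse function theorem, turns these solutions into a foliated
  chart of the maximal atlas, and the family of all adapted charts is a foliated atlas.

  For a field \<open>Df b\<close> tangent to an eigenplane, differentiating \<open>j (Df b) = Df b\<close> gives
  \<open>(\<nabla>\<^sub>a j) b = (1 - j) \<nabla>\<^sub>a (Df b)\<close>, so a leaf is totally geodesic exactly if \<open>\<nabla>j\<close> vanishes on pairs of
  vectors tangent to it. The mixed components of \<open>\<nabla>j\<close> follow from the pure ones, because \<open>\<nabla>j\<close> is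
  self-adjoint and exchanges the two orthogonal eigenplanes.\<close>

section \<open>Differentiability with a continuous parameter\<close>

text \<open>Differentiating an integral equation in its parameters gives a linear equation of the
  same kind whose coefficients involve the solution itself. Smoothness of the flow is therefore won
  one order at a time, in classes that are differentiable in the parameters but only continuous in
  time. The predicate below is such a class; joint continuity makes its estimates uniform over a
  compact time interval. Every equation lives on the fixed interval [0,1] with Lipschitz constant
  1/2. This is arranged by making the vector \<sigma> small instead of the time short, so plain sup
  norms give both the contraction and the Gronwall estimates. A whole family of leaves, and not just
  one, must come out of the flow. So the initial point is moved as well, by a second linear map
  \<kappa> transverse to the leaf, and only variations in the kernel of \<kappa> stay tangent to the
  distribution. No Lie bracket enters: parallelism with respect to a torsion-free connection takes
  the place of the integrability condition.\<close>

primrec Ck_param ::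
  "nat \<Rightarrow> 'b::euclidean_space set \<Rightarrow> real set \<Rightarrow> ('b \<Rightarrow> real \<Rightarrow> 'c::euclidean_space) \<Rightarrow> bool" where
  "Ck_param 0 S I F \<longleftrightarrow> continuous_on (S \<times> I) (\<lambda>(x, t). F x t)"
| "Ck_param (Suc k) S I F \<longleftrightarrow> continuous_on (S \<times> I) (\<lambda>(x, t). F x t) \<and>
     (\<forall>t\<in>I. \<forall>x\<in>S. (\<lambda>y. F y t) differentiable (at x)) \<and>
     (\<forall>v. Ck_param k S I (\<lambda>x t. frechet_derivative (\<lambda>y. F y t) (at x) v))"

lemma Ck_param_continuous: "Ck_param k S I F \<Longrightarrow> continuous_on (S \<times> I) (\<lambda>(x, t). F x t)"
  by (cases k) auto

lemma frechet_derivative_cong_open: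
  fixes f :: "'b::euclidean_space \<Rightarrow> 'c::euclidean_space"
  assumes "open S" "x \<in> S" "\<And>y. y \<in> S \<Longrightarrow> f y = g y"
  shows "frechet_derivative f (at x) = frechet_derivative g (at x)"
proof -
  have "(f has_derivative f') (at x) \<longleftrightarrow> (g has_derivative f') (at x)" for f'
    using assms has_derivative_transform_within_open by metis
  then show ?thesis unfolding frechet_derivative_def by simp
qed

text \<open>Since \<open>S\<close> is open, a derivative at a point of \<open>S\<close> depends only
  on values in \<open>S\<close>, so agreement on \<open>S\<close> passes through every step of the
  recursion. This permits replacing a map by a convenient formula for it.\<close>

lemma Ck_param_cong:
  assumes "open S" "\<And>x t. x \<in> S \<Longrightarrow> t \<in> I \<Longrightarrow> F x t = G x t" "Ck_param k S I F"
  shows "Ck_param k S I G"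
  using assms(2,3)
proof (induction k arbitrary: F G)
  case 0
  have "continuous_on (S \<times> I) (\<lambda>(x, t). G x t)"
    using Ck_param_continuous[OF 0(2)] by (rule continuous_on_eq) (use 0 in auto)
  then show ?case by simp
next
  case (Suc k)
  have cont: "continuous_on (S \<times> I) (\<lambda>(x, t). G x t)"
    using Ck_param_continuous[OF Suc.prems(2)]
    by (rule continuous_on_eq) (use Suc.prems(1) in auto)
  have diff: "(\<lambda>y. G y t) differentiable (at x)" if "t \<in> I" "x \<in> S" for x t
  proof -
    have "((\<lambda>y. F y t) has_derivative frechet_derivative (\<lambda>y. F y t) (at x)) (at x)"
      using Suc.prems(2) that by (simp add: frechet_derivative_works)
    then have "((\<lambda>y. G y t) has_derivative frechet_derivative (\<lambda>y. F y t) (at x)) (at x)"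
      by (rule has_derivative_transform_within_open[OF _ \<open>open S\<close> that(2)])
        (use Suc.prems(1) that in auto)
    then show ?thesis unfolding differentiable_def by blast
  qed
  have "Ck_param k S I (\<lambda>x t. frechet_derivative (\<lambda>y. G y t) (at x) v)" for v
  proof (rule Suc.IH)
    show "Ck_param k S I (\<lambda>x t. frechet_derivative (\<lambda>y. F y t) (at x) v)"
      using Suc.prems(2) by simp
    show "frechet_derivative (\<lambda>y. F y t) (at x) v = frechet_derivative (\<lambda>y. G y t) (at x) v"
      if "x \<in> S" "t \<in> I" for x t
      using frechet_derivative_cong_open[OF \<open>open S\<close> that(1), of "\<lambda>y. F y t" "\<lambda>y. G y t"]
        Suc.prems(1) that by simp
  qed
  with cont diff show ?case by simp
qed

text \<open>The recursion speaks of \<open>frechet_derivative\<close>; this rule allows any explicit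
  derivative \<open>F'\<close> in its place, and most closure lemmas below rest on it.\<close>

lemma Ck_param_SucI:
  assumes "open S" "continuous_on (S \<times> I) (\<lambda>(x, t). F x t)"
    and "\<And>x t. x \<in> S \<Longrightarrow> t \<in> I \<Longrightarrow> ((\<lambda>y. F y t) has_derivative F' x t) (at x)"
    and "\<And>v. Ck_param k S I (\<lambda>x t. F' x t v)"
  shows "Ck_param (Suc k) S I F"
proof -
  have "Ck_param k S I (\<lambda>x t. frechet_derivative (\<lambda>y. F y t) (at x) v)" for v
    by (rule Ck_param_cong[OF assms(1) _ assms(4)[of v]])
      (simp add: frechet_derivative_at[OF assms(3), symmetric])
  moreover have "\<forall>t\<in>I. \<forall>x\<in>S. (\<lambda>y. F y t) differentiable (at x)"
    using assms(3) unfolding differentiable_def by blast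
  ultimately show ?thesis using assms(2) by simp
qed

lemma Ck_param_SucD:
  assumes "Ck_param (Suc k) S I F"
  shows "\<And>x t. x \<in> S \<Longrightarrow> t \<in> I \<Longrightarrow>
      ((\<lambda>y. F y t) has_derivative frechet_derivative (\<lambda>y. F y t) (at x)) (at x)"
    and "\<And>v. Ck_param k S I (\<lambda>x t. frechet_derivative (\<lambda>y. F y t) (at x) v)"
  using assms by (simp_all add: frechet_derivative_works[symmetric])

lemma Ck_param_Suc_imp: "Ck_param (Suc k) S I F \<Longrightarrow> Ck_param k S I F"
proof (induction k arbitrary: F)
  case (Suc k)
  have "Ck_param k S I (\<lambda>x t. frechet_derivative (\<lambda>y. F y t) (at x) v)" for v
    by (rule Suc.IH[OF Ck_param_SucD(2)[OF Suc.prems]])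
  then show ?case using Suc.prems by simp
qed simp

lemma Ck_param_const: "open S \<Longrightarrow> Ck_param k S I (\<lambda>x t. c)"
proof (induction k arbitrary: c)
  case (Suc k)
  show ?case
    by (rule Ck_param_SucI[where F' = "\<lambda>x t v. 0", OF Suc.prems])
      (auto intro!: Suc continuous_intros simp: split_def)
qed (simp add: split_def)

lemma Ck_param_add:
  assumes "open S" "Ck_param k S I F" "Ck_param k S I G"
  shows "Ck_param k S I (\<lambda>x t. F x t + G x t)"
  using assms(2,3)
proof (induction k arbitrary: F G)
  case 0
  then show ?case by (auto intro!: continuous_intros simp: split_def)
next
  case (Suc k)
  show ?case
    using Ck_param_continuous[OF Suc.prems(1)] Ck_param_continuous[OF Suc.prems(2)]
    by (intro Ck_param_SucI[OF \<open>open S\<close>, where F' = "\<lambda>x t v. frechet_derivative (\<lambda>y. F y t) (at x) v +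
            frechet_derivative (\<lambda>y. G y t) (at x) v"]
          Suc.IH Ck_param_SucD(2)[OF Suc.prems(1)] Ck_param_SucD(2)[OF Suc.prems(2)])
      (auto intro!: has_derivative_add continuous_intros Ck_param_SucD(1)[OF Suc.prems(1)]
          Ck_param_SucD(1)[OF Suc.prems(2)] simp: split_def)
qed

lemma Ck_param_sum:
  assumes "open S" "\<And>i. i \<in> B \<Longrightarrow> Ck_param k S I (F i)"
  shows "Ck_param k S I (\<lambda>x t. \<Sum>i\<in>B. F i x t)"
  using assms(2)
  by (induction B rule: infinite_finite_induct)
    (auto intro: Ck_param_add Ck_param_const assms(1))

lemma Ck_param_linear:
  assumes "open S" "bounded_linear L" "Ck_param k S I F"
  shows "Ck_param k S I (\<lambda>x t. L (F x t))"
  using assms(3)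
proof (induction k arbitrary: F)
  case 0
  then show ?case
    by (auto intro!: bounded_linear.continuous_on[OF assms(2)] simp: split_def)
next
  case (Suc k)
  show ?case
    using Ck_param_continuous[OF Suc.prems]
    by (intro Ck_param_SucI[OF \<open>open S\<close>, where F' = "\<lambda>x t v. L (frechet_derivative (\<lambda>y. F y t) (at x) v)"]
          Suc.IH Ck_param_SucD(2)[OF Suc.prems])
      (auto intro!: bounded_linear.has_derivative[OF assms(2)]
         bounded_linear.continuous_on[OF assms(2)] Ck_param_SucD(1)[OF Suc.prems] simp: split_def)
qed

text \<open>By the product rule each term of the derivative pairs one differentiated factor with an
  undifferentiated one, so both factors must also be known at the lower order;
  \<open>Ck_param_Suc_imp\<close> supplies this.\<close>

lemma Ck_param_bilinear:
  assumes "open S" "bounded_bilinear B" "Ck_param k S I F" "Ck_param k S I G"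
  shows "Ck_param k S I (\<lambda>x t. B (F x t) (G x t))"
  using assms(3,4)
proof (induction k arbitrary: F G)
  case 0
  then show ?case
    by (auto intro!: bounded_bilinear.continuous_on[OF assms(2)] simp: split_def)
next
  case (Suc k)
  show ?case
    using Ck_param_continuous[OF Suc.prems(1)] Ck_param_continuous[OF Suc.prems(2)]
    by (intro Ck_param_SucI[OF \<open>open S\<close>, where F' = "\<lambda>x t v. B (F x t) (frechet_derivative (\<lambda>y. G y t) (at x) v) +
            B (frechet_derivative (\<lambda>y. F y t) (at x) v) (G x t)"]
          Ck_param_add Suc.IH Ck_param_SucD(2)[OF Suc.prems(1)] Ck_param_SucD(2)[OF Suc.prems(2)]
          Ck_param_Suc_imp[OF Suc.prems(1)] Ck_param_Suc_imp[OF Suc.prems(2)])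
      (auto intro!: bounded_bilinear.FDERIV[OF assms(2)] bounded_bilinear.continuous_on[OF assms(2)]
          Ck_param_SucD(1)[OF Suc.prems(1)] Ck_param_SucD(1)[OF Suc.prems(2)]
          \<open>open S\<close> simp: split_def)
qed

lemmas Ck_param_scaleR = Ck_param_bilinear[OF _ bounded_bilinear_scaleR]
lemmas Ck_param_mult = Ck_param_bilinear[OF _ bounded_bilinear_mult]

lemma linear_euclidean_sum:
  fixes L :: "'b::euclidean_space \<Rightarrow> 'c::real_vector"
  assumes "linear L"
  shows "L v = (\<Sum>b\<in>Basis. (v \<bullet> b) *\<^sub>R L b)"
proof -
  have "L v = L (\<Sum>b\<in>Basis. (v \<bullet> b) *\<^sub>R b)" by (simp add: euclidean_representation)
  then show ?thesis by (simp add: linear_sum[OF assms] linear_scale[OF assms])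
qed

text \<open>Expanding the argument in the basis turns the application into a finite sum of products.
  Regularity of a field of linear maps can thus be assumed on fixed vectors only, without a norm on
  the space of maps.\<close>

lemma Ck_param_linear_apply:
  fixes V :: "'b::euclidean_space \<Rightarrow> real \<Rightarrow> 'c::euclidean_space"
  assumes "open S" "\<And>x t. x \<in> S \<Longrightarrow> t \<in> I \<Longrightarrow> linear (A x t)"
    and "\<And>b. b \<in> Basis \<Longrightarrow> Ck_param k S I (\<lambda>x t. A x t b)" "Ck_param k S I V"
  shows "Ck_param k S I (\<lambda>x t. A x t (V x t))"
proof (rule Ck_param_cong[OF assms(1)])
  show "Ck_param k S I (\<lambda>x t. \<Sum>b\<in>Basis. (V x t \<bullet> b) *\<^sub>R A x t b)"
    by (intro Ck_param_sum Ck_param_scaleR Ck_param_linear[OF _ bounded_linear_inner_left] assms)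
  show "(\<Sum>b\<in>Basis. (V x t \<bullet> b) *\<^sub>R A x t b) = A x t (V x t)" if "x \<in> S" "t \<in> I" for x t
    by (rule linear_euclidean_sum[OF assms(2)[OF that], symmetric])
qed

text \<open>The derivative is the linear field \<open>DG\<close> at \<open>V\<close>, applied to
  \<open>DV\<close>. The induction varies \<open>G\<close> only: the inner map stays
  \<open>V\<close>, while \<open>G\<close> is replaced by its partial derivatives.\<close>

lemma Ck_param_compose:
  fixes V :: "'b::euclidean_space \<Rightarrow> real \<Rightarrow> 'c::euclidean_space"
    and G :: "'c \<Rightarrow> real \<Rightarrow> 'd::euclidean_space"
  assumes "open S" "open U" and VU: "\<And>x t. x \<in> S \<Longrightarrow> t \<in> I \<Longrightarrow> V x t \<in> U"
    and "Ck_param k U I G" "Ck_param k S I V"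
  shows "Ck_param k S I (\<lambda>x t. G (V x t) t)"
proof -
  have cont: "continuous_on (S \<times> I) (\<lambda>(x, t). G (V x t) t)"
    if "Ck_param n U I G" "Ck_param n S I V" for n and G :: "'c \<Rightarrow> real \<Rightarrow> 'd"
  proof -
    have "continuous_on (S \<times> I) (\<lambda>p. (V (fst p) (snd p), snd p))"
      using Ck_param_continuous[OF that(2)] by (intro continuous_intros) (auto simp: split_def)
    then have "continuous_on (S \<times> I) (\<lambda>p. (\<lambda>(x, t). G x t) (V (fst p) (snd p), snd p))"
      by (rule continuous_on_compose2[OF Ck_param_continuous[OF that(1)]]) (use VU in auto)
    then show ?thesis by (simp add: split_def)
  qed
  from assms(4,5) show ?thesis
  proof (induction k arbitrary: G)
    case 0
    show ?case using cont[OF 0] by simp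
  next
    case (Suc k)
    show ?case
    proof (rule Ck_param_SucI[OF assms(1) cont[OF Suc.prems]])
      show "((\<lambda>y. G (V y t) t) has_derivative
          (\<lambda>v. frechet_derivative (\<lambda>y. G y t) (at (V x t)) (frechet_derivative (\<lambda>y. V y t) (at x) v))) (at x)"
        if "x \<in> S" "t \<in> I" for x t
        by (rule has_derivative_compose[OF Ck_param_SucD(1)[OF Suc.prems(2) that]
              Ck_param_SucD(1)[OF Suc.prems(1) VU[OF that] that(2)]])
      show "Ck_param k S I (\<lambda>x t. frechet_derivative (\<lambda>y. G y t) (at (V x t))
          (frechet_derivative (\<lambda>y. V y t) (at x) v))" for v
      proof (rule Ck_param_linear_apply[OF assms(1), where A = "\<lambda>x t. frechet_derivative (\<lambda>y. G y t) (at (V x t))"])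
        show "linear (frechet_derivative (\<lambda>y. G y t) (at (V x t)))" if "x \<in> S" "t \<in> I" for x t
          by (rule has_derivative_linear[OF Ck_param_SucD(1)[OF Suc.prems(1) VU[OF that] that(2)]])
        show "Ck_param k S I (\<lambda>x t. frechet_derivative (\<lambda>y. G y t) (at (V x t)) b)" for b
          by (rule Suc.IH[OF Ck_param_SucD(2)[OF Suc.prems(1)] Ck_param_Suc_imp[OF Suc.prems(2)]])
        show "Ck_param k S I (\<lambda>x t. frechet_derivative (\<lambda>y. V y t) (at x) v)"
          by (rule Ck_param_SucD(2)[OF Suc.prems(2)])
      qed
    qed
  qed
qed

text \<open>The derivative of the reciprocal is a polynomial in the reciprocal and the derivative of
  \<open>F\<close>, so the induction closes on the same \<open>F\<close>.\<close>

lemma Ck_param_inverse: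
  fixes F :: "'b::euclidean_space \<Rightarrow> real \<Rightarrow> real"
  assumes "open S" "\<And>x t. x \<in> S \<Longrightarrow> t \<in> I \<Longrightarrow> F x t \<noteq> 0" "Ck_param k S I F"
  shows "Ck_param k S I (\<lambda>x t. inverse (F x t))"
  using assms(3)
proof (induction k)
  case 0
  then show ?case using assms(2) by (auto intro!: continuous_intros simp: split_def)
next
  case (Suc k)
  have cont: "continuous_on (S \<times> I) (\<lambda>(x, t). inverse (F x t))"
    using Ck_param_continuous[OF Suc.prems] assms(2) by (auto intro!: continuous_intros simp: split_def)
  note IH = Suc.IH[OF Ck_param_Suc_imp[OF Suc.prems]]
  show ?case
  proof (rule Ck_param_SucI[OF assms(1) cont])
    show "((\<lambda>y. inverse (F y t)) has_derivative (\<lambda>v. - 1 *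
        (inverse (F x t) * (frechet_derivative (\<lambda>y. F y t) (at x) v * inverse (F x t))))) (at x)"
      if "x \<in> S" "t \<in> I" for x t
      using Deriv.has_derivative_inverse[OF assms(2)[OF that] Ck_param_SucD(1)[OF Suc.prems that]]
      by (simp add: mult.assoc)
    show "Ck_param k S I (\<lambda>x t. - 1 *
        (inverse (F x t) * (frechet_derivative (\<lambda>y. F y t) (at x) v * inverse (F x t))))" for v
      by (intro Ck_param_mult Ck_param_const assms(1) IH Ck_param_SucD(2)[OF Suc.prems])
  qed
qed

lemma Ck_on_imp_param: "open S \<Longrightarrow> Ck_on k S f \<Longrightarrow> Ck_param k S I (\<lambda>x t. f x)"
proof (induction k arbitrary: f)
  case 0
  have "continuous_on (S \<times> I) (\<lambda>p. f (fst p))"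
    by (rule continuous_on_compose2[of S f]) (use 0 in \<open>auto intro!: continuous_intros\<close>)
  then show ?case by (simp add: split_def)
next
  case (Suc k)
  have "continuous_on (S \<times> I) (\<lambda>p. f (fst p))"
  proof (rule continuous_on_compose2[of S f])
    show "continuous_on S f" using Suc.prems
      by (simp add: continuous_at_imp_continuous_on differentiable_imp_continuous_within)
  qed (auto intro!: continuous_intros)
  then show ?case using Suc by (auto simp: split_def)
qed

lemma Ck_param_imp_on: "Ck_param k S I F \<Longrightarrow> t \<in> I \<Longrightarrow> Ck_on k S (\<lambda>x. F x t)"
proof (induction k arbitrary: F)
  case 0
  have "continuous_on S (\<lambda>x. (\<lambda>(x, t). F x t) (x, t))"
    by (rule continuous_on_compose2[OF Ck_param_continuous[OF 0(1)]])
      (use 0 in \<open>auto intro!: continuous_intros\<close>)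
  then show ?case by simp
next
  case (Suc k)
  have "Ck_on k S (\<lambda>x. frechet_derivative (\<lambda>y. F y t) (at x) v)" for v
    by (rule Suc.IH[OF Ck_param_SucD(2)[OF Suc.prems(1)] Suc.prems(2)])
  then show ?case using Suc.prems by simp
qed

text \<open>A one-point time set turns the parametrised calculus into the ordinary one, so
  \<open>smooth_on\<close> inherits its closure properties without a second set of
  inductions.\<close>

lemma Ck_on_iff_param: "open S \<Longrightarrow> Ck_on k S f \<longleftrightarrow> Ck_param k S {0} (\<lambda>x t. f x)"
  using Ck_on_imp_param[of S k f] Ck_param_imp_on[of k S "{0}" "\<lambda>x t. f x" 0] by auto

lemma Ck_param_ident: "open S \<Longrightarrow> Ck_param k S I (\<lambda>x t. x)"
proof (cases k)
  case (Suc n)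
  assume "open S"
  then show ?thesis unfolding Suc
    by (intro Ck_param_SucI[where F' = "\<lambda>x t v. v"] Ck_param_const)
      (auto intro!: continuous_intros derivative_eq_intros simp: split_def)
qed (auto simp: split_def intro!: continuous_intros)

subsection \<open>Smooth maps\<close>

lemma smooth_on_iff_param: "open S \<Longrightarrow> smooth_on S f \<longleftrightarrow> (\<forall>k. Ck_param k S {0} (\<lambda>x t. f x))"
  by (simp add: smooth_on_def Ck_on_iff_param)

lemma smooth_on_cong:
  assumes "open S" "\<And>x. x \<in> S \<Longrightarrow> f x = g x" "smooth_on S f"
  shows "smooth_on S g"
  using assms Ck_param_cong[of S "{0}" "\<lambda>x t. f x" "\<lambda>x t. g x"] by (simp add: smooth_on_iff_param)

lemma Ck_on_subset: "Ck_on k S f \<Longrightarrow> T \<subseteq> S \<Longrightarrow> Ck_on k T f"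
  by (induction k arbitrary: f) (auto intro: continuous_on_subset)

lemma smooth_on_subset: "smooth_on S f \<Longrightarrow> T \<subseteq> S \<Longrightarrow> smooth_on T f"
  by (auto simp: smooth_on_def intro: Ck_on_subset)

lemma smooth_on_const: "open S \<Longrightarrow> smooth_on S (\<lambda>x. c)"
  by (simp add: smooth_on_iff_param Ck_param_const)

lemma smooth_on_ident: "open S \<Longrightarrow> smooth_on S (\<lambda>x. x)"
  by (simp add: smooth_on_iff_param Ck_param_ident)

lemma smooth_on_add: "open S \<Longrightarrow> smooth_on S f \<Longrightarrow> smooth_on S g \<Longrightarrow> smooth_on S (\<lambda>x. f x + g x)"
  by (simp add: smooth_on_iff_param Ck_param_add)

lemma smooth_on_linear:
  assumes "open S" "bounded_linear L" "smooth_on S f"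
  shows "smooth_on S (\<lambda>x. L (f x))"
  unfolding smooth_on_iff_param[OF assms(1)]
  by (intro allI Ck_param_linear[OF assms(1,2)])
    (use assms(3) smooth_on_iff_param[OF assms(1)] in blast)

lemma smooth_on_compose:
  assumes "open S" "open U" "f ` S \<subseteq> U" "smooth_on U g" "smooth_on S f"
  shows "smooth_on S (\<lambda>x. g (f x))"
proof -
  have "Ck_param k S {0} (\<lambda>x t. g (f x))" for k
    using Ck_param_compose[of S U "{0}" "\<lambda>x t. f x" k "\<lambda>x t. g x"] assms
    by (auto simp: smooth_on_iff_param)
  then show ?thesis by (simp add: smooth_on_iff_param[OF assms(1)])
qed

lemma smooth_on_has_derivative:
  assumes "smooth_on S f" "x \<in> S"
  shows "(f has_derivative frechet_derivative f (at x)) (at x)"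
proof -
  have "Ck_on (Suc 0) S f" using assms(1) unfolding smooth_on_def by blast
  then show ?thesis using assms(2) by (simp add: frechet_derivative_works)
qed

lemma smooth_on_frechet_derivative:
  assumes "smooth_on S f"
  shows "smooth_on S (\<lambda>x. frechet_derivative f (at x) v)"
  unfolding smooth_on_def
proof
  fix k
  have "Ck_on (Suc k) S f" using assms unfolding smooth_on_def by blast
  then show "Ck_on k S (\<lambda>x. frechet_derivative f (at x) v)" by simp
qed

lemma smooth_on_continuous:
  assumes "smooth_on S f"
  shows "continuous_on S f"
proof -
  have "Ck_on 0 S f" using assms unfolding smooth_on_def by blast
  then show ?thesis by simp
qed

section \<open>Volterra equations depending on parameters\<close>

lemma continuous_on_slice:
  assumes "continuous_on (S \<times> I) (\<lambda>(x, t). V x t)" "x \<in> S"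
  shows "continuous_on I (V x)"
proof -
  have "continuous_on I (\<lambda>t. (\<lambda>(x, t). V x t) (x, t))"
    by (rule continuous_on_compose2[OF assms(1)]) (use assms(2) in \<open>auto intro!: continuous_intros\<close>)
  then show ?thesis by simp
qed

text \<open>Take for \<open>m\<close> the maximum of the norm of \<open>r\<close>, attained by
  compactness, and absorb the term \<open>q * m\<close>. With \<open>q < 1\<close> this plays the
  role of Gronwall's inequality.\<close>

lemma sup_norm_estimate:
  fixes r :: "real \<Rightarrow> 'e::real_normed_vector"
  assumes "continuous_on {0..1} r" "q < 1"
    and step: "\<And>m. (\<And>t. t \<in> {0..1} \<Longrightarrow> norm (r t) \<le> m) \<Longrightarrow> (\<And>t. t \<in> {0..1} \<Longrightarrow> norm (r t) \<le> d + q * m)"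
    and "t \<in> {0..1}"
  shows "norm (r t) \<le> d / (1 - q)"
proof -
  have "\<exists>t0\<in>{0..1}. \<forall>t\<in>{0..1}. norm (r t) \<le> norm (r t0)"
    by (rule continuous_attains_sup) (auto intro!: continuous_intros assms(1))
  then obtain t0 where t0: "t0 \<in> {0..1}" "\<And>t. t \<in> {0..1} \<Longrightarrow> norm (r t) \<le> norm (r t0)" by blast
  have "norm (r t0) \<le> d + q * norm (r t0)" using step[OF t0(2) t0(1)] .
  then have "norm (r t0) \<le> d / (1 - q)" using \<open>q < 1\<close> by (simp add: field_simps)
  then show ?thesis using t0(2)[OF assms(4)] by linarith
qed

lemma norm_integral_le:
  fixes f :: "real \<Rightarrow> 'e::euclidean_space"
  assumes "continuous_on {0..1} f" "t \<in> {0..1}" "\<And>s. s \<in> {0..1} \<Longrightarrow> norm (f s) \<le> B"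
  shows "norm (integral {0..t} f) \<le> B"
proof -
  have "norm (integral {0..t} f) \<le> B * (t - 0)"
    by (rule integral_bound) (use assms in \<open>auto intro: continuous_on_subset\<close>)
  moreover have "0 \<le> B" using order_trans[OF norm_ge_zero assms(3)[of 0]] by simp
  then have "B * (t - 0) \<le> B" using assms(2) by (simp add: mult_left_le)
  ultimately show ?thesis by linarith
qed

lemma integrable_initial_segment:
  fixes f :: "real \<Rightarrow> 'e::euclidean_space"
  assumes "continuous_on {0..1} f" "t \<in> {0..1}"
  shows "f integrable_on {0..t}"
  by (rule integrable_continuous_real) (use assms in \<open>auto intro: continuous_on_subset\<close>)

text \<open>Picard iteration: over unit time the Lipschitz constant 1/2 makes the integral operator
  a contraction in the sup norm.\<close>

lemma volterra_solution:
  fixes G :: "real \<Rightarrow> 'e::euclidean_space \<Rightarrow> 'e"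
  assumes contG: "continuous_on ({0..1} \<times> UNIV) (\<lambda>(t, u). G t u)"
    and lipG: "\<And>t u v. t \<in> {0..1} \<Longrightarrow> norm (G t u - G t v) \<le> norm (u - v) / 2"
  shows "\<exists>u. continuous_on {0..1} u \<and> (\<forall>t\<in>{0..1}. u t = c + integral {0..t} (\<lambda>s. G s (u s)))"
proof -
  have contGu: "continuous_on {0..1} (\<lambda>s. G s (u s))" if "continuous_on {0..1} u" for u
  proof -
    have "continuous_on {0..1} (\<lambda>s. (\<lambda>(t, u). G t u) (s, u s))"
      by (rule continuous_on_compose2[OF contG]) (auto intro!: continuous_intros that)
    then show ?thesis by simp
  qed
  \<comment> \<open>The Banach space consists of bounded continuous functions on the whole line, so
    time is clamped to the unit interval and the image is extended by its end values.\<close>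
  define J where "J u t = c + integral {0..max 0 (min 1 t)} (\<lambda>s. G s (apply_bcontfun u s))"
    for u :: "real \<Rightarrow>\<^sub>C 'e" and t :: real
  have J: "J u \<in> bcontfun" for u
  proof -
    have "continuous_on {0..1} (\<lambda>t. c + integral {0..t} (\<lambda>s. G s (apply_bcontfun u s)))"
      by (intro continuous_intros indefinite_integral_continuous_1 integrable_continuous_real contGu)
        simp
    then have *: "continuous_on UNIV (J u)" unfolding J_def
      by (rule continuous_on_compose2) (auto intro!: continuous_intros)
    have "J u ` UNIV = J u ` {0..1}"
    proof -
      have "J u t = J u (max 0 (min 1 t))" for t by (simp add: J_def)
      then show ?thesis by fastforce
    qed
    moreover have "bounded (J u ` {0..1})"
      by (intro compact_imp_bounded compact_continuous_image continuous_on_subset[OF *]) auto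
    ultimately show ?thesis using * by (simp add: bcontfun_def)
  qed
  define T where "T u = Bcontfun (J u)" for u
  have T: "apply_bcontfun (T u) = J u" for u unfolding T_def by (rule Bcontfun_inverse[OF J])
  have "dist (T u) (T v) \<le> 1/2 * dist u v" for u v
  proof (rule dist_bound)
    fix t :: real
    let ?t = "max 0 (min 1 t)"
    have t: "?t \<in> {0..1}" by auto
    have c: "continuous_on {0..1} (\<lambda>s. G s (apply_bcontfun w s))" for w
      by (rule contGu) simp
    have "J u t - J v t = integral {0..?t} (\<lambda>s. G s (apply_bcontfun u s) - G s (apply_bcontfun v s))"
      unfolding J_def using integrable_initial_segment[OF c t]
      by (subst integral_diff) auto
    also have "norm \<dots> \<le> dist u v / 2"
    proof (rule norm_integral_le[OF _ t])
      show "norm (G s (apply_bcontfun u s) - G s (apply_bcontfun v s)) \<le> dist u v / 2"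
        if "s \<in> {0..1}" for s
        using lipG[OF that, of "apply_bcontfun u s" "apply_bcontfun v s"] dist_bounded[of u s v]
        by (simp add: dist_norm)
    qed (intro continuous_intros c)
    finally show "dist (apply_bcontfun (T u) t) (apply_bcontfun (T v) t) \<le> 1/2 * dist u v"
      by (simp add: T dist_norm)
  qed
  then have "\<exists>!u. T u = u" by (intro banach_fix_type[of "1/2"]) auto
  then obtain u where "T u = u" by blast
  then have *: "apply_bcontfun u t = J u t" for t using T[of u] by simp
  have "\<forall>t\<in>{0..1}. apply_bcontfun u t = c + integral {0..t} (\<lambda>s. G s (apply_bcontfun u s))"
  proof
    fix t :: real assume "t \<in> {0..1}"
    then have "J u t = c + integral {0..t} (\<lambda>s. G s (apply_bcontfun u s))" by (simp add: J_def)
    with * show "apply_bcontfun u t = c + integral {0..t} (\<lambda>s. G s (apply_bcontfun u s))" by metis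
  qed
  moreover have "continuous_on {0..1} (apply_bcontfun u)" by simp
  ultimately show ?thesis by blast
qed

text \<open>Existence holds for each parameter separately; the issue is joint continuity. The
  difference of two solutions obeys the same contraction, driven by the change of \<open>c\<close>
  and by the change of \<open>F\<close> along one frozen solution, so it is small uniformly in
  time.\<close>

lemma volterra_solution_param:
  fixes F :: "'x::metric_space \<Rightarrow> real \<Rightarrow> 'e::euclidean_space \<Rightarrow> 'e"
  assumes contF: "continuous_on (S \<times> {0..1} \<times> UNIV) (\<lambda>(x, t, u). F x t u)"
    and lipF: "\<And>x t u v. x \<in> S \<Longrightarrow> t \<in> {0..1} \<Longrightarrow> norm (F x t u - F x t v) \<le> norm (u - v) / 2"
    and contc: "continuous_on S c"
  shows "\<exists>V. continuous_on (S \<times> {0..1}) (\<lambda>(x, t). V x t) \<and>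
    (\<forall>x\<in>S. \<forall>t\<in>{0..1}. V x t = c x + integral {0..t} (\<lambda>s. F x s (V x s)))"
proof -
  have "\<exists>u. continuous_on {0..1} u \<and> (\<forall>t\<in>{0..1}. u t = c x + integral {0..t} (\<lambda>s. F x s (u s)))"
    if "x \<in> S" for x
  proof (rule volterra_solution)
    have "continuous_on ({0..1} \<times> UNIV) (\<lambda>p. (\<lambda>(x, t, u). F x t u) (x, p))"
      by (rule continuous_on_compose2[OF contF]) (use that in \<open>auto intro!: continuous_intros\<close>)
    then show "continuous_on ({0..1} \<times> UNIV) (\<lambda>(t, u). F x t u)" by (simp add: split_def)
  qed (use lipF that in blast)
  then obtain V where contV: "\<And>x. x \<in> S \<Longrightarrow> continuous_on {0..1} (V x)"
    and eqV: "\<And>x t. x \<in> S \<Longrightarrow> t \<in> {0..1} \<Longrightarrow> V x t = c x + integral {0..t} (\<lambda>s. F x s (V x s))"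
    by metis
  have contFV: "continuous_on (S \<times> {0..1}) (\<lambda>(y, s). F y s (V x s))" if "x \<in> S" for x
  proof -
    have "continuous_on (S \<times> {0..1}) (\<lambda>p. V x (snd p))"
      by (rule continuous_on_compose2[OF contV[OF that]]) (auto intro!: continuous_intros)
    then have "continuous_on (S \<times> {0..1}) (\<lambda>p. (\<lambda>(x, t, u). F x t u) (fst p, snd p, V x (snd p)))"
      by (intro continuous_on_compose2[OF contF]) (auto intro!: continuous_intros)
    then show ?thesis by (simp add: split_def)
  qed
  have contFV1: "continuous_on {0..1} (\<lambda>s. F y s (V x s))" if "x \<in> S" "y \<in> S" for x y
  by (rule continuous_on_slice[OF contFV[OF that(1)] that(2)])
  have unif: "\<exists>d>0. \<forall>y\<in>S. dist y x < d \<longrightarrow> (\<forall>t\<in>{0..1}. norm (V y t - V x t) \<le> e)"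
    if x: "x \<in> S" and "e > 0" for x e
  proof -
    obtain X0 where X0: "x \<in> X0" "open X0"
      "\<forall>y\<in>X0 \<inter> S. \<forall>t\<in>{0..1}. dist ((\<lambda>(y, s). F y s (V x s)) (y, t)) ((\<lambda>(y, s). F y s (V x s)) (x, t)) \<le> e / 4"
      using continuous_on_prod_compactE[OF contFV[OF x] compact_Icc x, of "e / 4"] \<open>e > 0\<close> by auto
    obtain d1 where d1: "d1 > 0" "ball x d1 \<subseteq> X0" using X0 openE by blast
    obtain d2 where d2: "d2 > 0" "\<And>y. y \<in> S \<Longrightarrow> dist y x < d2 \<Longrightarrow> dist (c y) (c x) < e / 4"
      using continuous_onE[OF contc x, of "e / 4"] \<open>e > 0\<close> less_imp_le by (metis divide_pos_pos zero_less_numeral)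
    have "norm (V y t - V x t) \<le> e" if y: "y \<in> S" "dist y x < min d1 d2" and t: "t \<in> {0..1}" for y t
    proof -
      have Fle: "norm (F y s (V x s) - F x s (V x s)) \<le> e / 4" if "s \<in> {0..1}" for s
      proof -
        have "y \<in> X0 \<inter> S" using y d1 by (auto simp: dist_commute)
        with X0(3) that have "dist ((\<lambda>(y, s). F y s (V x s)) (y, s)) ((\<lambda>(y, s). F y s (V x s)) (x, s)) \<le> e / 4"
          by blast
        then show ?thesis by (simp add: dist_norm)
      qed
      have cle: "norm (c y - c x) \<le> e / 4" using d2(2)[OF y(1)] y(2) by (simp add: dist_norm)
      \<comment> \<open>\<open>e / 4\<close> from the initial value and \<open>e / 4\<close> from
        the coefficient add up to \<open>e / 2\<close>; absorbing half of the supremum doubles this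
        to \<open>e\<close>.\<close>
      have "norm (V y t - V x t) \<le> (e / 2) / (1 - 1/2)"
      proof (rule sup_norm_estimate[OF _ _ _ t])
        show "continuous_on {0..1} (\<lambda>t. V y t - V x t)"
          by (intro continuous_intros contV x y)
        fix m t :: real assume m: "\<And>t. t \<in> {0..1} \<Longrightarrow> norm (V y t - V x t) \<le> m" and t: "t \<in> {0..1}"
        have "V y t - V x t = (c y - c x) + integral {0..t} (\<lambda>s. F y s (V y s) - F x s (V x s))"
          using eqV[OF y(1) t] eqV[OF x t] integrable_initial_segment[OF contFV1 t] x y
          by (subst integral_diff) auto
        moreover have "norm (integral {0..t} (\<lambda>s. F y s (V y s) - F x s (V x s))) \<le> e / 4 + m / 2"
        proof (rule norm_integral_le[OF _ t])
          show "continuous_on {0..1} (\<lambda>s. F y s (V y s) - F x s (V x s))"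
            by (intro continuous_intros contFV1 x y)
          fix s :: real assume s: "s \<in> {0..1}"
          have "F y s (V y s) - F x s (V x s) =
              (F y s (V x s) - F x s (V x s)) + (F y s (V y s) - F y s (V x s))" by simp
          also have "norm \<dots> \<le> e / 4 + m / 2"
            using Fle[OF s] lipF[OF y(1) s, of "V y s" "V x s"] m[OF s] by norm
          finally show "norm (F y s (V y s) - F x s (V x s)) \<le> e / 4 + m / 2" .
        qed
        ultimately show "norm (V y t - V x t) \<le> e / 2 + 1 / 2 * m"
          using cle norm_triangle_ineq[of "c y - c x" "integral {0..t} (\<lambda>s. F y s (V y s) - F x s (V x s))"]
          by simp
      qed simp
      then show ?thesis by simp
    qed
    then show ?thesis using d1(1) d2(1) by (intro exI[of _ "min d1 d2"]) auto
  qed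
  have "continuous_on (S \<times> {0..1}) (\<lambda>(x, t). V x t)"
    unfolding continuous_on_iff
  proof (intro ballI allI impI)
    fix p e assume p: "p \<in> S \<times> {0..1::real}" and e: "(0::real) < e"
    obtain x t where xt: "p = (x, t)" "x \<in> S" "t \<in> {0..1}" using p by auto
    obtain d1 where d1: "d1 > 0" "\<And>y t. y \<in> S \<Longrightarrow> dist y x < d1 \<Longrightarrow> t \<in> {0..1} \<Longrightarrow> norm (V y t - V x t) \<le> e / 3"
      using unif[OF xt(2), of "e / 3"] e by auto
    obtain d2 where d2: "d2 > 0" "\<And>s. s \<in> {0..1} \<Longrightarrow> dist s t < d2 \<Longrightarrow> dist (V x s) (V x t) < e / 3"
      using continuous_onE[OF contV[OF xt(2)] xt(3), of "e / 3"] e less_imp_le by (metis divide_pos_pos zero_less_numeral)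
    have "dist (V y s) (V x t) < e" if "y \<in> S" "s \<in> {0..1}" "dist (y, s) (x, t) < min d1 d2" for y s
    proof -
      have "dist y x < d1" "dist s t < d2"
        using that(3) dist_fst_le[of "(y, s)" "(x, t)"] dist_snd_le[of "(y, s)" "(x, t)"] by auto
      then show ?thesis using d1(2)[OF that(1) _ that(2)] d2(2)[OF that(2)] e unfolding dist_norm by norm
    qed
    then show "\<exists>d>0. \<forall>p'\<in>S \<times> {0..1}. dist p' p < d \<longrightarrow>
        dist (case p' of (x, t) \<Rightarrow> V x t) (case p of (x, t) \<Rightarrow> V x t) < e"
      using d1(1) d2(1) by (intro exI[of _ "min d1 d2"]) (auto simp: xt(1))
  qed
  then show ?thesis using eqV by blast
qed

section \<open>Smooth dependence on parameters\<close>

lemma Ck_param_time: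
  assumes "open S" "continuous_on I z"
  shows "Ck_param k S I (\<lambda>x t. z t)"
proof -
  have "continuous_on (S \<times> I) (\<lambda>p. z (snd p))"
    by (rule continuous_on_compose2[OF assms(2)]) (auto intro!: continuous_intros)
  then have *: "continuous_on (S \<times> I) (\<lambda>(x, t). z t)" by (simp add: split_def)
  show ?thesis
  proof (cases k)
    case (Suc n)
    show ?thesis unfolding Suc
      by (rule Ck_param_SucI[OF assms(1) *, where F' = "\<lambda>x t v. 0"]) (auto intro: Ck_param_const assms(1))
  qed (use * in simp)
qed

lemma Ck_param_Pair:
  assumes "open S" "Ck_param k S I F" "Ck_param k S I G"
  shows "Ck_param k S I (\<lambda>x t. (F x t, G x t))"
proof -
  have "Ck_param k S I (\<lambda>x t. (F x t, 0) + (0, G x t))"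
    by (intro Ck_param_add assms(1) Ck_param_linear[OF assms(1) _ assms(2), of "\<lambda>u. (u, 0)"]
        Ck_param_linear[OF assms(1) _ assms(3), of "\<lambda>u. (0, u)"]
        bounded_linear_Pair bounded_linear_zero bounded_linear_ident)
  then show ?thesis by simp
qed

text \<open>The remainder is controlled by the oscillation of the derivative between
  \<open>x\<close> and nearby points. Joint continuity and compactness of \<open>I\<close> make that
  oscillation small for all times at once.\<close>

lemma Ck_param_uniform_taylor:
  fixes F :: "'b::euclidean_space \<Rightarrow> real \<Rightarrow> 'c::euclidean_space"
  assumes "open S" "Ck_param (Suc 0) S I F" "compact I" "x \<in> S" "e > 0"
  shows "\<exists>d>0. \<forall>k. norm k < d \<longrightarrow> x + k \<in> S \<and> (\<forall>t\<in>I.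
    norm (F (x + k) t - F x t - frechet_derivative (\<lambda>y. F y t) (at x) k) \<le> e * norm k)"
proof -
  define D where "D y t = frechet_derivative (\<lambda>y. F y t) (at y)" for y t
  \<comment> \<open>The operator norm is bounded by the sum over the basis, so each basis vector may
    use up \<open>e / n\<close>.\<close>
  define n where "n = real (DIM('b))"
  have "n > 0" by (simp add: n_def)
  have contD: "continuous_on (S \<times> I) (\<lambda>(y, t). D y t b)" for b
    using Ck_param_SucD(2)[OF assms(2), of b] by (simp add: D_def)
  have "\<exists>X. x \<in> X \<and> open X \<and> (\<forall>y\<in>X \<inter> S. \<forall>t\<in>I. norm (D y t b - D x t b) \<le> e / n)" for b
    using continuous_on_prod_compactE[OF contD assms(3,4), of "e / n" b] \<open>e > 0\<close> \<open>n > 0\<close>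
    by (simp add: dist_norm) metis
  then obtain X where X: "\<And>b. x \<in> X b" "\<And>b. open (X b)"
    "\<And>b y t. y \<in> X b \<Longrightarrow> y \<in> S \<Longrightarrow> t \<in> I \<Longrightarrow> norm (D y t b - D x t b) \<le> e / n"
    by (metis IntI)
  have "open (S \<inter> (\<Inter>b\<in>Basis. X b))" using X(2) assms(1) by (intro open_Int open_INT) auto
  moreover have "x \<in> S \<inter> (\<Inter>b\<in>Basis. X b)" using X(1) assms(4) by blast
  ultimately obtain d where d: "d > 0" "ball x d \<subseteq> S \<inter> (\<Inter>b\<in>Basis. X b)"
    by (rule openE)
  have inS: "y \<in> S" if "y \<in> ball x d" for y using d(2) that by blast
  have inX: "y \<in> X b" if "y \<in> ball x d" "b \<in> Basis" for y b using d(2) that by blast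
  have derF: "((\<lambda>y. F y t) has_derivative D y t) (at y)" if "y \<in> S" "t \<in> I" for y t
    using Ck_param_SucD(1)[OF assms(2) that] by (simp add: D_def)
  have "norm (F (x + k) t - F x t - D x t k) \<le> e * norm k" if "norm k < d" "t \<in> I" for k t
  proof -
    have "norm (F (x + k) t - F x t - D x t ((x + k) - x)) \<le> norm ((x + k) - x) * e"
    proof (rule differentiable_bound_linearization[where S = "ball x d"])
      show "x + s *\<^sub>R (x + k - x) \<in> ball x d" if "s \<in> {0..1}" for s
      proof -
        have "s * norm k \<le> norm k" using that by (simp add: mult_left_le_one_le)
        then show ?thesis using that \<open>norm k < d\<close> by (simp add: dist_norm)
      qed
      show "((\<lambda>y. F y t) has_derivative D y t) (at y within ball x d)" if "y \<in> ball x d" for y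
        by (rule has_derivative_at_withinI[OF derF[OF inS[OF that] \<open>t \<in> I\<close>]])
      show "onorm (D y t - D x t) \<le> e" if y: "y \<in> ball x d" for y
      proof -
        have bl: "bounded_linear (D y t)" "bounded_linear (D x t)"
          using has_derivative_bounded_linear[OF derF[OF inS[OF y] \<open>t \<in> I\<close>]]
            has_derivative_bounded_linear[OF derF[OF assms(4) \<open>t \<in> I\<close>]] by blast+
        have "onorm (\<lambda>v. D y t v - D x t v) \<le> (\<Sum>b\<in>Basis. norm (D y t b - D x t b))"
          by (rule onorm_componentwise) (intro bounded_linear_sub bl)
        also have "\<dots> \<le> (\<Sum>b\<in>(Basis::'b set). e / n)"
          by (intro sum_mono X(3) inX[OF y] inS[OF y] \<open>t \<in> I\<close>)
        also have "\<dots> = e" by (simp add: n_def)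
        finally show ?thesis by (simp add: fun_diff_def)
      qed
    qed (use d(1) in simp)
    then show ?thesis by (simp add: mult.commute)
  qed
  moreover have "x + k \<in> S" if "norm k < d" for k
    by (rule inS) (use that in \<open>simp add: dist_norm\<close>)
  ultimately show ?thesis using d(1) unfolding D_def by blast
qed

text \<open>Translation by the curve reduces this to the expansion at the single point 0; \<rho> is
  the width of a tube around the compact image of \<open>z\<close> inside \<open>S\<close>.\<close>

lemma Ck_param_uniform_taylor_along:
  fixes F :: "'b::euclidean_space \<Rightarrow> real \<Rightarrow> 'c::euclidean_space"
  assumes "open S" "Ck_param (Suc 0) S I F" "compact I" "continuous_on I z" "z ` I \<subseteq> S" "e > 0"
  shows "\<exists>d>0. \<forall>k t. norm k < d \<longrightarrow> t \<in> I \<longrightarrow> z t + k \<in> S \<and>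
    norm (F (z t + k) t - F (z t) t - frechet_derivative (\<lambda>y. F y t) (at (z t)) k) \<le> e * norm k"
proof -
  obtain \<rho> where \<rho>: "\<rho> > 0" "(\<Union>y\<in>z ` I. ball y \<rho>) \<subseteq> S"
    using compact_subset_open_imp_ball_epsilon_subset[OF compact_continuous_image[OF assms(4,3)] assms(1,5)]
    by blast
  have inS: "z t + k \<in> S" if "k \<in> ball 0 \<rho>" "t \<in> I" for k t
  proof -
    have "z t + k \<in> ball (z t) \<rho>" using that(1) by (simp add: dist_norm)
    then show ?thesis using \<rho>(2) that(2) by blast
  qed
  have "Ck_param (Suc 0) (ball 0 \<rho>) I (\<lambda>k t. F (z t + k) t)"
  proof (rule Ck_param_compose[OF _ assms(1) _ assms(2)])
    show "Ck_param (Suc 0) (ball 0 \<rho>) I (\<lambda>k t. z t + k)"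
      by (intro Ck_param_add Ck_param_time assms(4) Ck_param_ident open_ball)
  qed (use inS in auto)
  from Ck_param_uniform_taylor[OF open_ball this assms(3) _ assms(6), of 0] \<rho>(1)
  obtain d where "d > 0" and *: "\<forall>k. norm k < d \<longrightarrow> norm k < \<rho> \<and> (\<forall>t\<in>I. norm (F (z t + k) t - F (z t) t -
      frechet_derivative (\<lambda>k. F (z t + k) t) (at 0) k) \<le> e * norm k)"
    by auto
  from * have d: "d > 0" "\<And>k::'b. norm k < d \<Longrightarrow> norm k < \<rho>"
    "\<And>k t. norm k < d \<Longrightarrow> t \<in> I \<Longrightarrow> norm (F (z t + k) t - F (z t) t -
      frechet_derivative (\<lambda>k. F (z t + k) t) (at 0) k) \<le> e * norm k"
    using \<open>d > 0\<close> by blast+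
  have *: "frechet_derivative (\<lambda>k. F (z t + k) t) (at 0) = frechet_derivative (\<lambda>y. F y t) (at (z t))"
    if "t \<in> I" for t
  proof (rule frechet_derivative_at[symmetric])
    have "((\<lambda>y. F y t) has_derivative frechet_derivative (\<lambda>y. F y t) (at (z t))) (at (z t + 0))"
      using Ck_param_SucD(1)[OF assms(2), of "z t" t] assms(5) that by auto
    then have "((\<lambda>k. F (z t + k) t) has_derivative (\<lambda>h. frechet_derivative (\<lambda>y. F y t) (at (z t)) h)) (at 0)"
      by (rule has_derivative_compose[rotated]) (auto intro!: derivative_eq_intros)
    then show "((\<lambda>k. F (z t + k) t) has_derivative frechet_derivative (\<lambda>y. F y t) (at (z t))) (at 0)" .
  qed
  show ?thesis
  proof (intro exI[of _ d] conjI allI impI)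
    show "norm (F (z t + k) t - F (z t) t - frechet_derivative (\<lambda>y. F y t) (at (z t)) k) \<le> e * norm k"
      if "norm k < d" "t \<in> I" for k t
      using d(3)[OF that] *[OF that(2)] by simp
  qed (use d(1) in \<open>auto intro!: inS dest: d(2)\<close>)
qed

text \<open>For small \<open>s\<close> the defining estimate of the derivative leaves only the
  difference quotients in the direction \<open>v\<close>. Working with a single direction matters
  because the integrands below are assumed Lipschitz in the unknown only, and not in the
  parameter.\<close>

lemma has_derivative_norm_le_Lipschitz:
  fixes f :: "'b::real_normed_vector \<Rightarrow> 'c::real_normed_vector"
  assumes der: "(f has_derivative f') (at x)" and "d > 0" "v \<noteq> 0"
    and lip: "\<And>s. 0 < s \<Longrightarrow> s < d \<Longrightarrow> norm (f (x + s *\<^sub>R v) - f x) \<le> L * s"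
  shows "norm (f' v) \<le> L"
proof (rule field_le_epsilon)
  fix e :: real assume "e > 0"
  define \<epsilon> where "\<epsilon> = e / norm v"
  have "\<epsilon> > 0" using \<open>e > 0\<close> \<open>v \<noteq> 0\<close> by (simp add: \<epsilon>_def)
  then obtain \<delta> where \<delta>: "\<delta> > 0" "\<And>y. norm (y - x) < \<delta> \<Longrightarrow> norm (f y - f x - f' (y - x)) \<le> \<epsilon> * norm (y - x)"
    using der unfolding has_derivative_at_alt by blast
  define s where "s = min (d / 2) (\<delta> / (2 * norm v))"
  have s: "s > 0" "s < d" using \<open>d > 0\<close> \<delta>(1) \<open>v \<noteq> 0\<close> by (auto simp: s_def min_def)
  have "s * norm v \<le> \<delta> / 2"
    using \<open>v \<noteq> 0\<close> by (simp add: s_def min_def field_simps)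
  then have "s * norm v < \<delta>" using \<delta>(1) by linarith
  then have "norm (f (x + s *\<^sub>R v) - f x - f' (s *\<^sub>R v)) \<le> \<epsilon> * (s * norm v)"
    using \<delta>(2)[of "x + s *\<^sub>R v"] s by simp
  also have "\<dots> = e * s" using \<open>v \<noteq> 0\<close> by (simp add: \<epsilon>_def)
  finally have "norm (f' (s *\<^sub>R v)) \<le> e * s + L * s"
    using lip[OF s] norm_triangle_ineq3[of "f (x + s *\<^sub>R v) - f x" "f' (s *\<^sub>R v)"] by linarith
  moreover have "f' (s *\<^sub>R v) = s *\<^sub>R f' v"
    using has_derivative_bounded_linear[OF der] by (simp add: bounded_linear.linear linear_scale)
  ultimately have "s * norm (f' v) \<le> s * (L + e)" using s by (simp add: algebra_simps)
  then show "norm (f' v) \<le> L + e" using s by simp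
qed

text \<open>The linearised equation inherits the constant 1/2, so it is again a contraction and
  \<open>volterra_solution_param\<close> applies to it.\<close>

lemma volterra_derivative_bound:
  fixes F :: "('x::euclidean_space \<times> 'e::euclidean_space) \<Rightarrow> real \<Rightarrow> 'e"
  assumes U: "open U"
    and F: "Ck_param (Suc 0) (S \<times> U) {0..1} F"
    and uU: "\<And>x t. x \<in> S \<Longrightarrow> t \<in> {0..1} \<Longrightarrow> u x t \<in> U"
    and lip: "\<And>x t v w. x \<in> S \<Longrightarrow> t \<in> {0..1} \<Longrightarrow> v \<in> U \<Longrightarrow> w \<in> U \<Longrightarrow>
      norm (F (x, v) t - F (x, w) t) \<le> norm (v - w) / 2"
    and x: "x \<in> S" and t: "t \<in> {0..1}"
  shows "norm (frechet_derivative (\<lambda>q. F q t) (at (x, u x t)) (0, v)) \<le> norm v / 2"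
proof -
  define DF where "DF p t = frechet_derivative (\<lambda>q. F q t) (at p)" for p t
  have derF: "((\<lambda>q. F q t) has_derivative DF p t) (at p)" if "p \<in> S \<times> U" for p
    using Ck_param_SucD(1)[OF F that t] by (simp add: DF_def)
  have linDF: "linear (DF (x, u x t) t)"
    using has_derivative_linear[OF derF[of "(x, u x t)"]] x t uU by auto
  have "norm (DF (x, u x t) t (0, v)) \<le> norm v / 2"
  proof (cases "v = 0")
    case True
    then show ?thesis using linear_0[OF linDF] by (simp add: zero_prod_def)
  next
    case False
    obtain r where r: "r > 0" "ball (u x t) r \<subseteq> U" using U uU[OF x t] openE by blast
    show ?thesis
    proof (rule has_derivative_norm_le_Lipschitz[OF derF, where d = "r / norm v"])
      show "norm (F ((x, u x t) + s *\<^sub>R (0, v)) t - F (x, u x t) t) \<le> norm v / 2 * s"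
        if "0 < s" "s < r / norm v" for s
      proof -
        have "norm (s *\<^sub>R v) < r" using that False by (simp add: field_simps)
        then have "u x t + s *\<^sub>R v \<in> U" using r by (auto simp: subset_iff dist_norm)
        then have "norm (F (x, u x t + s *\<^sub>R v) t - F (x, u x t) t) \<le> norm (s *\<^sub>R v) / 2"
          using lip[OF x t _ uU[OF x t], of "u x t + s *\<^sub>R v"] by simp
        then show ?thesis using that by (simp add: mult.commute)
      qed
    qed (use r False x t uU in \<open>auto simp: zero_prod_def\<close>)
  qed
  then show ?thesis by (simp add: DF_def)
qed

text \<open>The candidate derivative solves the linearised equation. The true increment minus this
  candidate satisfies an integral inequality with contraction factor below 1, so it is as small as
  the Taylor remainders of \<open>F\<close> and \<open>c\<close>.\<close>

lemma volterra_derivative: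
  fixes F :: "('x::euclidean_space \<times> 'e::euclidean_space) \<Rightarrow> real \<Rightarrow> 'e"
  defines "DF p t \<equiv> frechet_derivative (\<lambda>q. F q t) (at p)"
  assumes S: "open S" and U: "open U"
    and F: "Ck_param (Suc 0) (S \<times> U) {0..1} F"
    and c: "smooth_on S c"
    and contu: "continuous_on (S \<times> {0..1}) (\<lambda>(x, t). u x t)"
    and uU: "\<And>x t. x \<in> S \<Longrightarrow> t \<in> {0..1} \<Longrightarrow> u x t \<in> U"
    and equ: "\<And>x t. x \<in> S \<Longrightarrow> t \<in> {0..1} \<Longrightarrow> u x t = c x + integral {0..t} (\<lambda>s. F (x, u x s) s)"
    and lip: "\<And>x t v w. x \<in> S \<Longrightarrow> t \<in> {0..1} \<Longrightarrow> v \<in> U \<Longrightarrow> w \<in> U \<Longrightarrow>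
      norm (F (x, v) t - F (x, w) t) \<le> norm (v - w) / 2"
  shows "\<exists>L. (\<forall>x\<in>S. \<forall>t\<in>{0..1}. ((\<lambda>y. u y t) has_derivative L x t) (at x)) \<and>
    (\<forall>h. continuous_on (S \<times> {0..1}) (\<lambda>(x, t). L x t h)) \<and>
    (\<forall>h. \<forall>x\<in>S. \<forall>t\<in>{0..1}. L x t h =
      frechet_derivative c (at x) h + integral {0..t} (\<lambda>s. DF (x, u x s) s (h, L x s h)))"
proof -
  have SU: "open (S \<times> U)" by (intro open_Times S U)
  have derF: "((\<lambda>q. F q t) has_derivative DF p t) (at p)" if "p \<in> S \<times> U" "t \<in> {0..1}" for p t
    using Ck_param_SucD(1)[OF F that] by (simp add: DF_def)
  have linDF: "linear (DF (x, u x t) t)" if "x \<in> S" "t \<in> {0..1}" for x t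
    using has_derivative_linear[OF derF[of "(x, u x t)" t]] that uU by auto
  have DFle: "norm (DF (x, u x t) t (0, v)) \<le> norm v / 2" if "x \<in> S" "t \<in> {0..1}" for x t v
    using volterra_derivative_bound[OF U F uU lip that] unfolding DF_def .
  have contDF: "continuous_on (S \<times> {0..1}) (\<lambda>(x, t). DF (x, u x t) t b)" for b
  proof -
    have c1: "continuous_on ((S \<times> U) \<times> {0..1}) (\<lambda>(p, t). DF p t b)"
      using Ck_param_continuous[OF Ck_param_SucD(2)[OF F, of b]] by (simp add: DF_def)
    have "continuous_on (S \<times> {0..1}) (\<lambda>q. (\<lambda>(p, t). DF p t b) ((fst q, u (fst q) (snd q)), snd q))"
      by (rule continuous_on_compose2[OF c1])
        (use contu uU in \<open>auto intro!: continuous_intros simp: split_def\<close>)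
    then show ?thesis by (simp add: split_def)
  qed
  have DFsplit: "DF (x, u x t) t (h, v) =
      DF (x, u x t) t (h, 0) + (\<Sum>b\<in>Basis. (v \<bullet> b) *\<^sub>R DF (x, u x t) t (0, b))"
    if "x \<in> S" "t \<in> {0..1}" for x t h v
  proof -
    have l: "linear (\<lambda>v. DF (x, u x t) t (0, v))"
      using linear_compose[OF _ linDF[OF that], of "\<lambda>v. (0, v)"]
      by (simp add: o_def linear_iff)
    have "DF (x, u x t) t ((h, 0) + (0, v)) = DF (x, u x t) t (h, 0) + DF (x, u x t) t (0, v)"
      by (rule linear_add[OF linDF[OF that]])
    then show ?thesis using linear_euclidean_sum[OF l, of v] by simp
  qed
  have "\<exists>V. continuous_on (S \<times> {0..1}) (\<lambda>(x, t). V x t) \<and> (\<forall>x\<in>S. \<forall>t\<in>{0..1}. V x t =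
      frechet_derivative c (at x) h + integral {0..t} (\<lambda>s. DF (x, u x s) s (h, V x s)))" for h
  proof (rule volterra_solution_param[where F = "\<lambda>x t v. DF (x, u x t) t (h, v)"])
    have "continuous_on (S \<times> {0..1} \<times> (UNIV::'e set)) (\<lambda>q. (\<lambda>(x, t). DF (x, u x t) t b) (fst q, fst (snd q)))" for b
      by (rule continuous_on_compose2[OF contDF]) (auto intro!: continuous_intros)
    then have "continuous_on (S \<times> {0..1} \<times> UNIV) (\<lambda>q. DF (fst q, u (fst q) (fst (snd q))) (fst (snd q)) (h, 0) +
        (\<Sum>b\<in>Basis. (snd (snd q) \<bullet> b) *\<^sub>R DF (fst q, u (fst q) (fst (snd q))) (fst (snd q)) (0, b)))"
      by (intro continuous_intros) (auto simp: split_def)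
    then have "continuous_on (S \<times> {0..1} \<times> UNIV) (\<lambda>q. DF (fst q, u (fst q) (fst (snd q))) (fst (snd q)) (h, snd (snd q)))"
      by (rule continuous_on_eq) (auto simp: DFsplit[symmetric])
    then show "continuous_on (S \<times> {0..1} \<times> UNIV) (\<lambda>(x, t, v). DF (x, u x t) t (h, v))"
      by (simp add: split_def)
    show "norm (DF (x, u x t) t (h, v) - DF (x, u x t) t (h, w)) \<le> norm (v - w) / 2"
      if "x \<in> S" "t \<in> {0..1}" for x t v w
      using DFle[OF that, of "v - w"] linear_diff[OF linDF[OF that], of "(h, v)" "(h, w)"] by simp
    show "continuous_on S (\<lambda>x. frechet_derivative c (at x) h)"
      by (intro smooth_on_continuous smooth_on_frechet_derivative c)
  qed
  then have "\<exists>W. \<forall>h. continuous_on (S \<times> {0..1}) (\<lambda>(x, t). W h x t) \<and> (\<forall>x\<in>S. \<forall>t\<in>{0..1}. W h x t =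
      frechet_derivative c (at x) h + integral {0..t} (\<lambda>s. DF (x, u x s) s (h, W h x s)))"
    by (intro choice allI)
  then obtain W where contW: "\<And>h. continuous_on (S \<times> {0..1}) (\<lambda>(x, t). W h x t)"
    and eqW: "\<And>h x t. x \<in> S \<Longrightarrow> t \<in> {0..1} \<Longrightarrow> W h x t =
      frechet_derivative c (at x) h + integral {0..t} (\<lambda>s. DF (x, u x s) s (h, W h x s))"
    by blast
  \<comment> \<open>Only the solutions for basis directions are kept and combined linearly. This
    makes \<open>L\<close> linear by construction; that it solves the equation for every
    \<open>h\<close> is then read off from linearity in \<open>eqL\<close>, without a uniqueness
    argument.\<close>
  define L where "L x t h = (\<Sum>b\<in>Basis. (h \<bullet> b) *\<^sub>R W b x t)" for x t h
  have blL: "bounded_linear (L x t)" for x t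
    unfolding L_def by (intro bounded_linear_sum bounded_linear_scaleR_const bounded_linear_inner_left)
  have contL: "continuous_on (S \<times> {0..1}) (\<lambda>(x, t). L x t h)" for h
    using contW unfolding L_def split_def by (intro continuous_intros)
  have contu1: "continuous_on {0..1} (u x)" if "x \<in> S" for x
  by (rule continuous_on_slice[OF contu that])
  have contW1: "continuous_on {0..1} (W h x)" if "x \<in> S" for x h
  by (rule continuous_on_slice[OF contW that])
  have contL1: "continuous_on {0..1} (\<lambda>t. L x t h)" if "x \<in> S" for x h
    unfolding L_def by (intro continuous_intros contW1 that)
  have contDF1: "continuous_on {0..1} (\<lambda>t. DF (x, u x t) t b)" if "x \<in> S" for x b
  by (rule continuous_on_slice[OF contDF that])
  have contDFv: "continuous_on {0..1} (\<lambda>t. DF (x, u x t) t (h, v t))"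
    if "x \<in> S" "continuous_on {0..1} v" for x h v
  proof -
    have "continuous_on {0..1} (\<lambda>t. DF (x, u x t) t (h, 0) + (\<Sum>b\<in>Basis. (v t \<bullet> b) *\<^sub>R DF (x, u x t) t (0, b)))"
      by (intro continuous_intros contDF1 that)
    then show ?thesis by (rule continuous_on_eq) (auto simp: DFsplit[OF that(1), symmetric])
  qed
  have contFu: "continuous_on {0..1} (\<lambda>t. F (x, u x t) t)" if "x \<in> S" for x
  proof -
    have "continuous_on {0..1} (\<lambda>t. (\<lambda>(p, t). F p t) ((x, u x t), t))"
      by (rule continuous_on_compose2[OF Ck_param_continuous[OF F]])
        (use that uU in \<open>auto intro!: continuous_intros contu1\<close>)
    then show ?thesis by simp
  qed
  have lin_c: "linear (frechet_derivative c (at x))" if "x \<in> S" for x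
    using has_derivative_linear[OF smooth_on_has_derivative[OF c that]] .
  have eqL: "L x t h = frechet_derivative c (at x) h + integral {0..t} (\<lambda>s. DF (x, u x s) s (h, L x s h))"
    if x: "x \<in> S" and t: "t \<in> {0..1}" for x t h
  proof -
    have "DF (x, u x s) s (h, L x s h) = (\<Sum>b\<in>Basis. (h \<bullet> b) *\<^sub>R DF (x, u x s) s (b, W b x s))"
      if "s \<in> {0..1}" for s
    proof -
      have "(h, L x s h) = (\<Sum>b\<in>Basis. (h \<bullet> b) *\<^sub>R (b, W b x s))"
        by (simp add: L_def sum_prod[symmetric] prod_eq_iff fst_sum snd_sum euclidean_representation)
      then show ?thesis
        by (simp add: linear_sum[OF linDF[OF x that]] linear_scale[OF linDF[OF x that]] del: scaleR_Pair)
    qed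
    then have "integral {0..t} (\<lambda>s. DF (x, u x s) s (h, L x s h)) =
        integral {0..t} (\<lambda>s. \<Sum>b\<in>Basis. (h \<bullet> b) *\<^sub>R DF (x, u x s) s (b, W b x s))"
      using t by (intro integral_cong) auto
    also have "\<dots> = (\<Sum>b\<in>Basis. (h \<bullet> b) *\<^sub>R integral {0..t} (\<lambda>s. DF (x, u x s) s (b, W b x s)))"
      using t x by (subst integral_sum)
        (auto intro!: integrable_initial_segment continuous_intros contDFv contW1)
    also have "\<dots> = (\<Sum>b\<in>Basis. (h \<bullet> b) *\<^sub>R (W b x t - frechet_derivative c (at x) b))"
      using eqW[OF x t] by simp
    also have "\<dots> = L x t h - frechet_derivative c (at x) h"
      unfolding L_def linear_euclidean_sum[OF lin_c[OF x], of h]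
      by (simp add: scaleR_diff_right sum_subtractf)
    finally show ?thesis by simp
  qed
  have "((\<lambda>y. u y t) has_derivative L x t) (at x)" if x: "x \<in> S" and t: "t \<in> {0..1}" for x t
    unfolding has_derivative_at_alt
  proof (intro conjI blL allI impI)
    fix \<epsilon> :: real assume "\<epsilon> > 0"
    have "\<exists>B. \<forall>s\<in>{0..1}. norm (W b x s) \<le> B" for b
      using compact_imp_bounded[OF compact_continuous_image[OF contW1[OF x] compact_Icc]]
      unfolding bounded_iff by auto
    then obtain B where B: "\<And>b s. s \<in> {0..1} \<Longrightarrow> norm (W b x s) \<le> B b" by metis
    define C where "C = (\<Sum>b\<in>(Basis::'x set). B b)"
    have "0 \<le> B b" for b using order_trans[OF norm_ge_zero B[of 0 b]] by simp
    then have "C \<ge> 0" unfolding C_def by (intro sum_nonneg) auto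
    have Lle: "norm (L x s h) \<le> C * norm h" if "s \<in> {0..1}" for s h
    proof -
      have "norm (L x s h) \<le> (\<Sum>b\<in>Basis. norm h * B b)"
        unfolding L_def
        by (rule sum_norm_le) (use B[OF that] in \<open>auto intro!: mult_mono simp: Basis_le_norm\<close>)
      then show ?thesis by (simp only: C_def sum_distrib_left[symmetric] mult.commute[of _ "norm h"])
    qed
    \<comment> \<open>The bound 1/4 gives the factor \<open>e + 1/2 \<le> 3/4\<close>, and 1/(1 -
      3/4) is the 4 in the second bound. In \<open>2 + C\<close>, one unit comes from the remainder
      of \<open>c\<close> and \<open>1 + C\<close> from that of \<open>F\<close>.\<close>
    define e where "e = min (1/4) (\<epsilon> / (4 * (2 + C)))"
    have e: "e > 0" "e \<le> 1/4" "4 * (e * (2 + C)) \<le> \<epsilon>"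
    proof -
      show "e > 0" using \<open>\<epsilon> > 0\<close> \<open>C \<ge> 0\<close> by (simp add: e_def)
      show "e \<le> 1/4" unfolding e_def by (rule min.cobounded1)
      have "e \<le> \<epsilon> / (4 * (2 + C))" unfolding e_def by (rule min.cobounded2)
      then show "4 * (e * (2 + C)) \<le> \<epsilon>" using \<open>C \<ge> 0\<close> by (simp add: field_simps)
    qed
    have zS: "(\<lambda>s. (x, u x s)) ` {0..1} \<subseteq> S \<times> U" using x uU by auto
    have contz: "continuous_on {0..1} (\<lambda>s. (x, u x s))" by (intro continuous_intros contu1 x)
    obtain d1 where d1: "d1 > 0" "\<And>k s. norm k < d1 \<Longrightarrow> s \<in> {0..1} \<Longrightarrow>
        norm (F ((x, u x s) + k) s - F (x, u x s) s - DF (x, u x s) s k) \<le> e * norm k"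
      using Ck_param_uniform_taylor_along[OF SU F compact_Icc contz zS e(1)] unfolding DF_def by blast
    obtain X where X: "x \<in> X" "open X" "\<forall>y\<in>X \<inter> S. \<forall>s\<in>{0..1}. dist (u y s) (u x s) \<le> d1 / 4"
      using continuous_on_prod_compactE[OF contu compact_Icc x, of "d1 / 4"] d1(1) by auto
    obtain d2 where d2: "d2 > 0" "\<And>y. norm (y - x) < d2 \<Longrightarrow>
        norm (c y - c x - frechet_derivative c (at x) (y - x)) \<le> e * norm (y - x)"
      using smooth_on_has_derivative[OF c x] e(1) unfolding has_derivative_at_alt by blast
    obtain d3 where d3: "d3 > 0" "ball x d3 \<subseteq> X \<inter> S"
      using openE[OF open_Int[OF X(2) S] IntI[OF X(1) x]] by blast
    \<comment> \<open>A quarter of \<open>d1\<close> for the parameter and a quarter for the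
      solution keep the joint increment below \<open>d1\<close>.\<close>
    define d where "d = min (d1 / 4) (min d2 d3)"
    have "norm (u y t - u x t - L x t (y - x)) \<le> \<epsilon> * norm (y - x)" if y: "norm (y - x) < d" for y
    proof -
      define h where "h = y - x"
      have yXS: "y \<in> X" "y \<in> S"
      proof -
        have "y \<in> ball x d3" using y by (simp add: d_def dist_norm norm_minus_commute)
        then show "y \<in> X" "y \<in> S" using d3(2) by blast+
      qed
      define r where "r s = u y s - u x s - L x s h" for s
      have contr: "continuous_on {0..1} r"
        unfolding r_def by (intro continuous_intros contu1 contL1 x yXS)
      \<comment> \<open>Taylor remainder of \<open>F\<close> along the true increment. Replacing
        that increment by its linear prediction adds only the derivative applied to
        \<open>(0, r s)\<close>, which costs at most half the norm of \<open>r s\<close>.\<close>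
      define E where "E s = F (y, u y s) s - F (x, u x s) s - DF (x, u x s) s (h, u y s - u x s)" for s
      have Ele: "norm (E s) \<le> e * (1 + C) * norm h + e * norm (r s)" if s: "s \<in> {0..1}" for s
      proof -
        define k where "k = (h, u y s - u x s)"
        have k1: "norm k \<le> norm h + norm (u y s - u x s)" unfolding k_def by (rule norm_Pair_le)
        have "norm (u y s - u x s) \<le> d1 / 4" using X(3) yXS s by (simp add: dist_norm)
        moreover have "norm h < d1 / 4" using y by (simp add: h_def d_def)
        ultimately have "norm k < d1" using k1 d1(1) by linarith
        then have "norm (E s) \<le> e * norm k"
          using d1(2)[of k s] s by (simp add: E_def k_def h_def)
        moreover have "norm (u y s - u x s) \<le> norm (r s) + C * norm h"
          using Lle[OF s, of h] norm_triangle_ineq[of "r s" "L x s h"] by (simp add: r_def)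
        then have "norm k \<le> (1 + C) * norm h + norm (r s)" using k1 by (simp add: algebra_simps)
        then have "e * norm k \<le> e * ((1 + C) * norm h + norm (r s))" using e(1) by simp
        ultimately show ?thesis by (simp add: algebra_simps)
      qed
      have "norm (r t) \<le> (e * (2 + C) * norm h) / (1 - 3/4)"
      proof (rule sup_norm_estimate[OF contr _ _ t])
        fix m s :: real assume m: "\<And>s. s \<in> {0..1} \<Longrightarrow> norm (r s) \<le> m" and s: "s \<in> {0..1}"
        have Er: "F (y, u y s) s - F (x, u x s) s - DF (x, u x s) s (h, L x s h) = E s + DF (x, u x s) s (0, r s)"
          if "s \<in> {0..1}" for s
          using linear_diff[OF linDF[OF x that], of "(h, u y s - u x s)" "(h, L x s h)"]
          by (simp add: E_def r_def)
        define I where "I = integral {0..s} (\<lambda>s. F (y, u y s) s - F (x, u x s) s - DF (x, u x s) s (h, L x s h))"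
        have i: "(\<lambda>s. F (y, u y s) s) integrable_on {0..s}" "(\<lambda>s. F (x, u x s) s) integrable_on {0..s}"
            "(\<lambda>s. DF (x, u x s) s (h, L x s h)) integrable_on {0..s}"
          by (intro integrable_initial_segment[OF _ s] contFu contDFv contL1 x yXS)+
        have "I = integral {0..s} (\<lambda>s. F (y, u y s) s) - integral {0..s} (\<lambda>s. F (x, u x s) s) -
            integral {0..s} (\<lambda>s. DF (x, u x s) s (h, L x s h))"
          unfolding I_def integral_diff[OF integrable_diff[OF i(1,2)] i(3)] integral_diff[OF i(1,2)] ..
        then have rI: "r s = (c y - c x - frechet_derivative c (at x) h) + I"
          using equ[OF yXS(2) s] equ[OF x s] eqL[OF x s, of h] unfolding r_def by simp
        have nI: "norm I \<le> e * (1 + C) * norm h + (e + 1/2) * m"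
          unfolding I_def
        proof (rule norm_integral_le[OF _ s])
          show "continuous_on {0..1} (\<lambda>s. F (y, u y s) s - F (x, u x s) s - DF (x, u x s) s (h, L x s h))"
            by (intro continuous_intros contFu contDFv contL1 x yXS)
          fix s :: real assume s: "s \<in> {0..1}"
          have "norm (E s + DF (x, u x s) s (0, r s)) \<le> norm (E s) + norm (r s) / 2"
            using DFle[OF x s, of "r s"] norm_triangle_ineq[of "E s" "DF (x, u x s) s (0, r s)"] by linarith
          also have "\<dots> \<le> e * (1 + C) * norm h + (e * norm (r s) + norm (r s) / 2)" using Ele[OF s] by simp
          also have "e * norm (r s) + norm (r s) / 2 \<le> e * m + m / 2"
            using m[OF s] e(1) by (intro add_mono mult_left_mono) auto
          finally show "norm (F (y, u y s) s - F (x, u x s) s - DF (x, u x s) s (h, L x s h))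
              \<le> e * (1 + C) * norm h + (e + 1/2) * m"
            using Er[OF s] by (simp add: algebra_simps)
        qed
        have nc: "norm (c y - c x - frechet_derivative c (at x) h) \<le> e * norm h"
          using d2(2)[of y] y by (simp add: h_def d_def)
        have "0 \<le> m" using order_trans[OF norm_ge_zero m[OF s]] .
        then have "(e + 1/2) * m \<le> 3/4 * m" using e(2) by (intro mult_right_mono) auto
        then have "norm (r s) \<le> e * norm h + (e * (1 + C) * norm h + 3/4 * m)"
          unfolding rI using nI nc norm_triangle_ineq[of "c y - c x - frechet_derivative c (at x) h" I]
          by linarith
        then show "norm (r s) \<le> e * (2 + C) * norm h + 3/4 * m" by (simp add: algebra_simps)
      qed simp
      also have "\<dots> = 4 * (e * (2 + C)) * norm h" by simp
      also have "\<dots> \<le> \<epsilon> * norm h" using e(3) by (intro mult_right_mono) auto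
      finally show ?thesis by (simp add: r_def h_def)
    qed
    moreover have "d > 0" using d1(1) d2(1) d3(1) by (simp add: d_def)
    ultimately show "\<exists>d>0. \<forall>y. norm (y - x) < d \<longrightarrow>
        norm (u y t - u x t - L x t (y - x)) \<le> \<epsilon> * norm (y - x)" by blast
  qed
  then show ?thesis using contL eqL by blast
qed


text \<open>Each directional derivative of \<open>u\<close> solves an equation of the same form, so
  the induction generalises over both equation and solution. The new right-hand side contains
  \<open>u\<close> itself, whose regularity at the lower order is the induction hypothesis for the
  original equation.\<close>

theorem volterra_Ck:
  fixes F :: "('x::euclidean_space \<times> 'e::euclidean_space) \<Rightarrow> real \<Rightarrow> 'e"
  assumes S: "open S" and "open U" "Ck_param k (S \<times> U) {0..1} F" "smooth_on S c"
    and "continuous_on (S \<times> {0..1}) (\<lambda>(x, t). u x t)"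
    and "\<And>x t. x \<in> S \<Longrightarrow> t \<in> {0..1} \<Longrightarrow> u x t \<in> U"
    and "\<And>x t. x \<in> S \<Longrightarrow> t \<in> {0..1} \<Longrightarrow> u x t = c x + integral {0..t} (\<lambda>s. F (x, u x s) s)"
    and "\<And>x t v w. x \<in> S \<Longrightarrow> t \<in> {0..1} \<Longrightarrow> v \<in> U \<Longrightarrow> w \<in> U \<Longrightarrow>
      norm (F (x, v) t - F (x, w) t) \<le> norm (v - w) / 2"
  shows "Ck_param k S {0..1} u"
  using assms(2-)
proof (induction k arbitrary: U F c u)
  case 0
  then show ?case by simp
next
  case (Suc k)
  note U = Suc.prems(1) and F = Suc.prems(2) and c = Suc.prems(3) and contu = Suc.prems(4)
    and uU = Suc.prems(5) and equ = Suc.prems(6) and lip = Suc.prems(7)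
  define DF where "DF p t = frechet_derivative (\<lambda>q. F q t) (at p)" for p t
  have SU: "open (S \<times> U)" by (intro open_Times S U)
  have F1: "Ck_param (Suc 0) (S \<times> U) {0..1} F"
    using F by (induction k) (auto intro: Ck_param_Suc_imp simp del: Ck_param.simps)
  have u: "Ck_param k S {0..1} u"
    by (rule Suc.IH[OF U Ck_param_Suc_imp[OF F] c contu uU equ lip])
  obtain L where L: "\<And>x t. x \<in> S \<Longrightarrow> t \<in> {0..1} \<Longrightarrow> ((\<lambda>y. u y t) has_derivative L x t) (at x)"
    and contL: "\<And>h. continuous_on (S \<times> {0..1}) (\<lambda>(x, t). L x t h)"
    and eqL: "\<And>h x t. x \<in> S \<Longrightarrow> t \<in> {0..1} \<Longrightarrow> L x t h =
      frechet_derivative c (at x) h + integral {0..t} (\<lambda>s. DF (x, u x s) s (h, L x s h))"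
    using volterra_derivative[OF S U F1 c contu uU equ lip] unfolding DF_def by blast
  have derF: "((\<lambda>q. F q t) has_derivative DF p t) (at p)" if "p \<in> S \<times> U" "t \<in> {0..1}" for p t
    using Ck_param_SucD(1)[OF F that] by (simp add: DF_def)
  have linDF: "linear (DF (x, u x t) t)" if "x \<in> S" "t \<in> {0..1}" for x t
    using has_derivative_linear[OF derF[of "(x, u x t)" t]] that uU by auto
  have DFle: "norm (DF (x, u x t) t (0, v)) \<le> norm v / 2" if "x \<in> S" "t \<in> {0..1}" for x t v
    using volterra_derivative_bound[OF U F1 uU lip that] unfolding DF_def .
  show ?case
  proof (rule Ck_param_SucI[OF S contu L])
    fix h
    \<comment> \<open>The linearised field is affine in the unknown and defined for all of its
      values, so the whole space takes the place of \<open>U\<close>.\<close>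
    show "Ck_param k S {0..1} (\<lambda>x t. L x t h)"
    proof (rule Suc.IH[where U = UNIV and F = "\<lambda>p t. DF (fst p, u (fst p) t) t (h, snd p)",
          OF open_UNIV _ smooth_on_frechet_derivative[OF c] contL])
      show "L x t h = frechet_derivative c (at x) h + integral {0..t}
          (\<lambda>s. DF (fst (x, L x s h), u (fst (x, L x s h)) s) s (h, snd (x, L x s h)))"
        if "x \<in> S" "t \<in> {0..1}" for x t
        using eqL[OF that] by simp
      show "norm (DF (fst (x, v), u (fst (x, v)) t) t (h, snd (x, v)) -
          DF (fst (x, w), u (fst (x, w)) t) t (h, snd (x, w))) \<le> norm (v - w) / 2"
        if "x \<in> S" "t \<in> {0..1}" for x t v w
        using DFle[OF that, of "v - w"] linear_diff[OF linDF[OF that], of "(h, v)" "(h, w)"] by simp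
      have SU': "open (S \<times> (UNIV::'e set))" by (intro open_Times S open_UNIV)
      have fst: "Ck_param k (S \<times> (UNIV::'e set)) {0..1} (\<lambda>p t. fst p)"
        by (rule Ck_param_linear[OF SU' bounded_linear_fst Ck_param_ident[OF SU']])
      have "Ck_param k (S \<times> (UNIV::'e set)) {0..1} (\<lambda>p t. u (fst p) t)"
        by (rule Ck_param_compose[OF SU' S _ u fst]) auto
      then have pair: "Ck_param k (S \<times> (UNIV::'e set)) {0..1} (\<lambda>p t. (fst p, u (fst p) t))"
        by (rule Ck_param_Pair[OF SU' fst])
      have DFb: "Ck_param k (S \<times> (UNIV::'e set)) {0..1} (\<lambda>p t. DF (fst p, u (fst p) t) t b)" for b
      proof (rule Ck_param_compose[OF SU' SU _ _ pair, where G = "\<lambda>q t. DF q t b"])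
        show "Ck_param k (S \<times> U) {0..1} (\<lambda>q t. DF q t b)"
          using Ck_param_SucD(2)[OF F, of b] by (simp add: DF_def)
      qed (use uU in auto)
      show "Ck_param k (S \<times> UNIV) {0..1} (\<lambda>p t. DF (fst p, u (fst p) t) t (h, snd p))"
      proof (rule Ck_param_linear_apply[OF SU', where A = "\<lambda>p t. DF (fst p, u (fst p) t) t"])
        show "linear (DF (fst p, u (fst p) t) t)" if "p \<in> S \<times> UNIV" "t \<in> {0..1}" for p :: "'x \<times> 'e" and t
          using linDF[of "fst p" t] that by auto
        show "Ck_param k (S \<times> (UNIV::'e set)) {0..1} (\<lambda>p t. (h, snd p))"
          by (rule Ck_param_Pair[OF SU' Ck_param_const[OF SU']
                Ck_param_linear[OF SU' bounded_linear_snd Ck_param_ident[OF SU']]])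
      qed (rule DFb)
    qed auto
  qed
qed

section \<open>The smooth inverse function theorem\<close>

lemma Ck_param_prod:
  fixes F :: "'i \<Rightarrow> 'b::euclidean_space \<Rightarrow> real \<Rightarrow> real"
  assumes "open S" "\<And>i. i \<in> B \<Longrightarrow> Ck_param k S I (F i)"
  shows "Ck_param k S I (\<lambda>x t. \<Prod>i\<in>B. F i x t)"
  using assms(2)
  by (induction B rule: infinite_finite_induct)
    (auto intro: Ck_param_mult Ck_param_const assms(1))

lemma Ck_param_det:
  fixes A :: "'b::euclidean_space \<Rightarrow> real \<Rightarrow> real^'n^'n"
  assumes "open S" "\<And>i j. Ck_param k S I (\<lambda>x t. A x t $ i $ j)"
  shows "Ck_param k S I (\<lambda>x t. det (A x t))"
  unfolding det_def
  by (intro Ck_param_sum Ck_param_mult Ck_param_prod Ck_param_const assms)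

lemma Ck_param_vec:
  fixes F :: "'b::euclidean_space \<Rightarrow> real \<Rightarrow> real^'n"
  assumes "open S" "\<And>i. Ck_param k S I (\<lambda>x t. F x t $ i)"
  shows "Ck_param k S I F"
proof -
  have "Ck_param k S I (\<lambda>x t. \<Sum>i\<in>UNIV. (F x t $ i) *\<^sub>R axis i (1::real))"
    by (intro Ck_param_sum Ck_param_scaleR Ck_param_const assms)
  moreover have "(\<Sum>i\<in>UNIV. (F x t $ i) *\<^sub>R axis i (1::real)) = F x t" for x t
    using basis_expansion[of "F x t"] by (simp add: scalar_mult_eq_scaleR)
  ultimately show ?thesis by simp
qed

lemma Ck_param_component:
  fixes F :: "'b::euclidean_space \<Rightarrow> real \<Rightarrow> real^'n"
  assumes "open S" "Ck_param k S I F"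
  shows "Ck_param k S I (\<lambda>x t. F x t $ i)"
  by (rule Ck_param_linear[OF assms(1) bounded_linear_vec_nth assms(2)])

text \<open>Cramer's rule writes the inverse as a quotient of polynomials in the matrix entries with
  nonvanishing denominator.\<close>

lemma Ck_param_linear_inverse:
  fixes M :: "'b::euclidean_space \<Rightarrow> real \<Rightarrow> real^'n \<Rightarrow> real^'n"
  assumes "open S" and lin: "\<And>x t. x \<in> S \<Longrightarrow> t \<in> I \<Longrightarrow> linear (M x t)"
    and bij: "\<And>x t. x \<in> S \<Longrightarrow> t \<in> I \<Longrightarrow> bij (M x t)"
    and Ck: "\<And>v. Ck_param k S I (\<lambda>x t. M x t v)"
  shows "Ck_param k S I (\<lambda>x t. inv (M x t) e)"
proof -
  define A where "A x t = matrix (M x t)" for x t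
  have Aij: "Ck_param k S I (\<lambda>x t. A x t $ i $ j)" for i j
    unfolding A_def matrix_def using Ck_param_component[OF assms(1) Ck] by simp
  have det: "det (A x t) \<noteq> 0" if "x \<in> S" "t \<in> I" for x t
  proof -
    have "invertible (A x t)"
      unfolding A_def using invertible_eq_bij[of "matrix (M x t)"] bij[OF that] lin[OF that]
      by (simp add: matrix_works)
    then show ?thesis using invertible_det_nz by blast
  qed
  have eq: "inv (M x t) e = (\<chi> k. det (\<chi> i j. if j = k then e $ i else A x t $ i $ j) * inverse (det (A x t)))"
    if "x \<in> S" "t \<in> I" for x t
  proof -
    have "A x t *v inv (M x t) e = e"
      using bij[OF that] lin[OF that] by (simp add: A_def matrix_works bij_is_surj surj_f_inv_f)
    then show ?thesis
      unfolding cramer[OF det[OF that]] divide_inverse .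
  qed
  have "Ck_param k S I (\<lambda>x t. (\<chi> k. det (\<chi> i j. if j = k then e $ i else A x t $ i $ j) * inverse (det (A x t))) :: real^'n)"
  proof (rule Ck_param_vec[OF assms(1)])
    fix l
    have "Ck_param k S I (\<lambda>x t. (\<chi> i j. if j = l then e $ i else A x t $ i $ j) $ i $ j)" for i j
      using Aij[of i j] Ck_param_const[OF assms(1)] by (cases "j = l") auto
    then have "Ck_param k S I (\<lambda>x t. det (\<chi> i j. if j = l then e $ i else A x t $ i $ j))"
      by (rule Ck_param_det[OF assms(1)])
    moreover have "Ck_param k S I (\<lambda>x t. inverse (det (A x t)))"
      by (rule Ck_param_inverse[OF assms(1) det Ck_param_det[OF assms(1) Aij]])
    ultimately show "Ck_param k S I (\<lambda>x t. (\<chi> k. det (\<chi> i j. if j = k then e $ i else A x t $ i $ j) * inverse (det (A x t))) $ l)"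
      using Ck_param_mult[OF assms(1)] by simp
  qed
  then show ?thesis by (rule Ck_param_cong[OF assms(1), rotated]) (simp add: eq)
qed

text \<open>Bootstrapping: the derivative of \<open>g\<close> is the inverse of the derivative of
  \<open>f\<close> at \<open>g y\<close>, which is as regular as \<open>g\<close>. Hence each order
  of differentiability of \<open>g\<close> yields the next.\<close>

lemma smooth_on_inverse_map:
  fixes f :: "real^'n \<Rightarrow> real^'n"
  assumes "open U" "open V" "g ` V \<subseteq> U" and f: "smooth_on U f"
    and derg: "\<And>y. y \<in> V \<Longrightarrow> (g has_derivative inv (frechet_derivative f (at (g y)))) (at y)"
    and bij: "\<And>y. y \<in> V \<Longrightarrow> bij (frechet_derivative f (at (g y)))"
  shows "smooth_on V g"
proof -
  have contg: "continuous_on V g"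
    using derg has_derivative_continuous continuous_at_imp_continuous_on by blast
  have "Ck_param k V {0} (\<lambda>y t. g y)" for k
  proof (induction k)
    case 0
    have "continuous_on (V \<times> {0::real}) (\<lambda>p. g (fst p))"
      by (rule continuous_on_compose2[OF contg]) (auto intro!: continuous_intros)
    then show ?case by (simp add: split_def)
  next
    case (Suc k)
    show ?case
    proof (rule Ck_param_SucI[OF assms(2) Ck_param_continuous[OF Suc] derg])
      show "Ck_param k V {0} (\<lambda>y t. inv (frechet_derivative f (at (g y))) v)" for v
      proof (rule Ck_param_linear_inverse[OF assms(2), where M = "\<lambda>y t. frechet_derivative f (at (g y))"])
        show "linear (frechet_derivative f (at (g y)))" if "y \<in> V" for y
          using smooth_on_has_derivative[OF f, of "g y"] has_derivative_linear that assms(3) by blast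
        show "Ck_param k V {0} (\<lambda>y t. frechet_derivative f (at (g y)) v)" for v
          using Ck_param_compose[OF assms(2,1) _ _ Suc, of "\<lambda>x t. frechet_derivative f (at x) v"]
            smooth_on_frechet_derivative[OF f, of v] assms(1,3) by (auto simp: smooth_on_iff_param)
      qed (rule bij)
    qed
  qed
  then show ?thesis by (simp add: smooth_on_iff_param[OF assms(2)])
qed

text \<open>The C1 inverse function theorem gives a local inverse together with the formula for its
  derivative; \<open>smooth_on_inverse_map\<close> then raises its regularity.\<close>

theorem smooth_inverse_function:
  fixes f :: "real^'n \<Rightarrow> real^'n"
  assumes "open S" and f: "smooth_on S f" and "x0 \<in> S"
    and bij: "bij (frechet_derivative f (at x0))"
  obtains U V g where "open U" "U \<subseteq> S" "x0 \<in> U" "open V" "homeomorphism U V f g" "smooth_on V g"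
    "\<And>x. x \<in> U \<Longrightarrow> bij (frechet_derivative f (at x))"
proof -
  have bl: "bounded_linear (frechet_derivative f (at x))" if "x \<in> S" for x
    using smooth_on_has_derivative[OF f that] has_derivative_bounded_linear by blast
  define f' where "f' x = Blinfun (frechet_derivative f (at x))" for x
  have f': "blinfun_apply (f' x) = frechet_derivative f (at x)" if "x \<in> S" for x
    unfolding f'_def by (rule bounded_linear_Blinfun_apply[OF bl[OF that]])
  have derf: "(f has_derivative blinfun_apply (f' x)) (at x)" if "x \<in> S" for x
    using smooth_on_has_derivative[OF f that] f'[OF that] by simp
  have contf': "continuous_on S f'"
  proof (rule continuous_on_blinfun_componentwise)
    fix i :: "real^'n"
    show "continuous_on S (\<lambda>x. blinfun_apply (f' x) i)"
      using smooth_on_continuous[OF smooth_on_frechet_derivative[OF f, of i]]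
      by (rule continuous_on_eq) (simp add: f')
  qed
  have lin: "linear (frechet_derivative f (at x0))"
    using bl[OF assms(3)] bounded_linear.linear by blast
  have linv: "linear (inv (frechet_derivative f (at x0)))"
    by (rule inj_linear_imp_inv_linear[OF lin bij_is_inj[OF bij]])
  define invf where "invf = Blinfun (inv (frechet_derivative f (at x0)))"
  have invf: "blinfun_apply invf = inv (frechet_derivative f (at x0))"
    unfolding invf_def by (rule bounded_linear_Blinfun_apply) (use linv linear_conv_bounded_linear in blast)
  have "invf o\<^sub>L f' x0 = id_blinfun"
    by (rule blinfun_eqI) (simp add: invf f'[OF assms(3)] bij_is_inj[OF bij])
  then obtain U V g g' where *: "open U" "U \<subseteq> S" "x0 \<in> U" "open V" "f x0 \<in> V" "homeomorphism U V f g"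
    "\<And>y. y \<in> V \<Longrightarrow> (g has_derivative (g' y)) (at y)"
    "\<And>y. y \<in> V \<Longrightarrow> g' y = inv (blinfun_apply (f'(g y)))"
    "\<And>y. y \<in> V \<Longrightarrow> bij (blinfun_apply (f'(g y)))"
    using inverse_function_theorem[OF assms(1) derf contf' assms(3)] by metis
  have gU: "g y \<in> U" if "y \<in> V" for y using *(6) that by (auto simp: homeomorphism_def)
  have gS: "g y \<in> S" if "y \<in> V" for y using gU[OF that] *(2) by blast
  have bijV: "bij (frechet_derivative f (at (g y)))" if "y \<in> V" for y
    using *(9)[OF that] f'[OF gS[OF that]] by simp
  have "smooth_on V g"
  proof (rule smooth_on_inverse_map[OF \<open>open S\<close> *(4) _ f _ bijV])
    show "(g has_derivative inv (frechet_derivative f (at (g y)))) (at y)" if "y \<in> V" for y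
      using *(7,8)[OF that] f'[OF gS[OF that]] by simp
  qed (use gS in blast)+
  moreover have "bij (frechet_derivative f (at x))" if "x \<in> U" for x
    using bijV[of "f x"] *(6) that by (auto simp: homeomorphism_def)
  ultimately show ?thesis using that *(1-4,6) by blast
qed

section \<open>Adapted coordinates for a parallel projection field\<close>

text \<open>Product and chain rule for a field of linear maps. By expansion in the basis,
  differentiability of the field on fixed vectors suffices; the restriction to \<open>T\<close>
  admits curves on a closed interval.\<close>

lemma has_derivative_linear_field:
  fixes A :: "'b::euclidean_space \<Rightarrow> 'c::euclidean_space \<Rightarrow> 'd::euclidean_space"
  assumes S: "open S" "f ` T \<subseteq> S" "p \<in> T"
    and lin: "\<And>x. x \<in> S \<Longrightarrow> linear (A x)"
    and A: "\<And>v. (\<lambda>x. A x v) differentiable (at (f p))"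
    and f: "(f has_derivative f') (at p within T)" and w: "(w has_derivative w') (at p within T)"
  shows "((\<lambda>q. A (f q) (w q)) has_derivative
    (\<lambda>h. frechet_derivative (\<lambda>x. A x (w p)) (at (f p)) (f' h) + A (f p) (w' h))) (at p within T)"
proof -
  define D where "D v = frechet_derivative (\<lambda>x. A x v) (at (f p))" for v
  have D: "((\<lambda>x. A x v) has_derivative D v) (at (f p))" for v
    unfolding D_def using A[of v] by (simp add: frechet_derivative_works)
  have expand: "A x v = (\<Sum>b\<in>Basis. (v \<bullet> b) *\<^sub>R A x b)" if "x \<in> S" for x v
    by (rule linear_euclidean_sum[OF lin[OF that]])
  have fp: "f p \<in> S" using S by blast
  have Dsum: "D v = (\<lambda>h. \<Sum>b\<in>Basis. (v \<bullet> b) *\<^sub>R D b h)" for v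
  proof -
    have "((\<lambda>x. \<Sum>b\<in>Basis. (v \<bullet> b) *\<^sub>R A x b) has_derivative (\<lambda>h. \<Sum>b\<in>Basis. (v \<bullet> b) *\<^sub>R D b h)) (at (f p))"
      by (intro has_derivative_sum has_derivative_scaleR_right D)
    then have "((\<lambda>x. A x v) has_derivative (\<lambda>h. \<Sum>b\<in>Basis. (v \<bullet> b) *\<^sub>R D b h)) (at (f p))"
      by (rule has_derivative_transform_within_open[OF _ S(1) fp]) (simp add: expand[symmetric])
    then show ?thesis by (rule has_derivative_unique[OF D])
  qed
  have Df: "((\<lambda>q. A (f q) b) has_derivative (\<lambda>h. D b (f' h))) (at p within T)" for b
    by (rule has_derivative_compose[OF f D])
  have wb: "((\<lambda>q. w q \<bullet> b) has_derivative (\<lambda>h. w' h \<bullet> b)) (at p within T)" for b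
    by (rule bounded_linear.has_derivative[OF bounded_linear_inner_left w])
  have "((\<lambda>q. \<Sum>b\<in>Basis. (w q \<bullet> b) *\<^sub>R A (f q) b) has_derivative
      (\<lambda>h. \<Sum>b\<in>Basis. (w p \<bullet> b) *\<^sub>R D b (f' h) + (w' h \<bullet> b) *\<^sub>R A (f p) b)) (at p within T)"
    by (intro has_derivative_sum has_derivative_scaleR Df wb)
  also have "(\<lambda>h. \<Sum>b\<in>Basis. (w p \<bullet> b) *\<^sub>R D b (f' h) + (w' h \<bullet> b) *\<^sub>R A (f p) b) =
      (\<lambda>h. D (w p) (f' h) + A (f p) (w' h))"
    unfolding Dsum[of "w p"] expand[OF fp, of "w' _"] sum.distrib ..
  finally have "((\<lambda>q. A (f q) (w q)) has_derivative (\<lambda>h. D (w p) (f' h) + A (f p) (w' h))) (at p within T)"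
    by (rule has_derivative_transform[rotated 2]) (use S expand in \<open>auto\<close>)
  then show ?thesis unfolding D_def .
qed

text \<open>Linearity in the vector comes from uniqueness of the derivative of a sum or multiple. It
  makes the derivatives of \<open>P\<close> bilinear, so that they can be bounded on compact
  sets.\<close>

lemma linear_frechet_derivative_field:
  fixes A :: "'b::euclidean_space \<Rightarrow> 'c::euclidean_space \<Rightarrow> 'd::euclidean_space"
  assumes "open S" "x \<in> S" "\<And>x. x \<in> S \<Longrightarrow> linear (A x)" "\<And>v. (\<lambda>x. A x v) differentiable (at x)"
  shows "linear (\<lambda>v. frechet_derivative (\<lambda>x. A x v) (at x) h)"
proof -
  have D: "((\<lambda>x. A x v) has_derivative frechet_derivative (\<lambda>x. A x v) (at x)) (at x)" for v
    using assms(4) by (simp add: frechet_derivative_works)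
  have 1: "frechet_derivative (\<lambda>x. A x (v + w)) (at x) =
      (\<lambda>h. frechet_derivative (\<lambda>x. A x v) (at x) h + frechet_derivative (\<lambda>x. A x w) (at x) h)" for v w
    by (rule has_derivative_unique[OF D], rule has_derivative_transform_within_open[OF
          has_derivative_add[OF D D] assms(1,2)]) (simp add: linear_add[OF assms(3)])
  have 2: "frechet_derivative (\<lambda>x. A x (c *\<^sub>R v)) (at x) =
      (\<lambda>h. c *\<^sub>R frechet_derivative (\<lambda>x. A x v) (at x) h)" for c v
    by (rule has_derivative_unique[OF D], rule has_derivative_transform_within_open[OF
          has_derivative_scaleR_right[OF D] assms(1,2)]) (simp add: linear_scale[OF assms(3)])
  show ?thesis unfolding linear_iff by (simp add: 1 2)
qed

text \<open>Bounds on the finitely many basis vectors, each obtained from compactness, add up to an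
  operator bound uniform on \<open>K\<close>.\<close>

lemma linear_family_bound:
  fixes A :: "'b::topological_space \<Rightarrow> 'c::euclidean_space \<Rightarrow> 'd::real_normed_vector"
  assumes "compact K" "\<And>x. x \<in> K \<Longrightarrow> linear (A x)" "\<And>b. continuous_on K (\<lambda>x. A x b)"
  shows "\<exists>B\<ge>0. \<forall>x\<in>K. \<forall>v. norm (A x v) \<le> B * norm v"
proof -
  have "\<exists>B\<ge>0. \<forall>x\<in>K. norm (A x b) \<le> B" for b
  proof -
    have "bounded ((\<lambda>x. A x b) ` K)"
      by (rule compact_imp_bounded[OF compact_continuous_image[OF assms(3,1)]])
    then obtain B where "\<forall>x\<in>K. norm (A x b) \<le> B" unfolding bounded_iff by auto
    then show ?thesis by (intro exI[of _ "max 0 B"]) auto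
  qed
  then have "\<exists>B. \<forall>b. B b \<ge> 0 \<and> (\<forall>x\<in>K. norm (A x b) \<le> B b)" by (intro choice allI)
  then obtain B where B: "\<And>b. B b \<ge> 0" "\<And>b x. x \<in> K \<Longrightarrow> norm (A x b) \<le> B b" by blast
  have "norm (A x v) \<le> (\<Sum>b\<in>Basis. B b) * norm v" if "x \<in> K" for x v
  proof -
    have "norm (A x v) \<le> (\<Sum>b\<in>Basis. B b * norm v)"
      unfolding linear_euclidean_sum[OF assms(2)[OF that], of v]
    proof (rule sum_norm_le)
      fix b :: 'c assume "b \<in> Basis"
      then have "\<bar>v \<bullet> b\<bar> * norm (A x b) \<le> norm v * B b"
        by (intro mult_mono B(2)[OF that] Basis_le_norm) auto
      then show "norm ((v \<bullet> b) *\<^sub>R A x b) \<le> B b * norm v" by (simp add: mult.commute)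
    qed
    then show ?thesis by (simp add: sum_distrib_right)
  qed
  moreover have "0 \<le> (\<Sum>b\<in>(Basis::'c set). B b)" by (intro sum_nonneg B)
  ultimately show ?thesis by blast
qed

lemma bilinear_family_bound:
  fixes A :: "'b::topological_space \<Rightarrow> 'c::euclidean_space \<Rightarrow> 'd::euclidean_space \<Rightarrow> 'e::real_normed_vector"
  assumes "compact K" "\<And>x. x \<in> K \<Longrightarrow> bilinear (A x)" "\<And>u v. continuous_on K (\<lambda>x. A x u v)"
  shows "\<exists>B\<ge>0. \<forall>x\<in>K. \<forall>u v. norm (A x u v) \<le> B * norm u * norm v"
proof -
  have "\<exists>B\<ge>0. \<forall>x\<in>K. \<forall>v. norm (A x b v) \<le> B * norm v" for b
    by (rule linear_family_bound[OF assms(1) _ assms(3)]) (use assms(2) in \<open>auto simp: bilinear_def\<close>)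
  then have "\<exists>B. \<forall>b. B b \<ge> 0 \<and> (\<forall>x\<in>K. \<forall>v. norm (A x b v) \<le> B b * norm v)" by (intro choice allI)
  then obtain B where B: "\<And>b. B b \<ge> 0" "\<And>b x v. x \<in> K \<Longrightarrow> norm (A x b v) \<le> B b * norm v" by blast
  have "norm (A x u v) \<le> (\<Sum>b\<in>Basis. B b) * norm u * norm v" if "x \<in> K" for x u v
  proof -
    have l: "linear (\<lambda>u. A x u v)" using assms(2)[OF that] by (simp add: bilinear_def)
    have "norm (A x u v) \<le> (\<Sum>b\<in>Basis. B b * (norm u * norm v))"
      unfolding linear_euclidean_sum[OF l, of u]
    proof (rule sum_norm_le)
      fix b :: 'c assume "b \<in> Basis"
      then have "\<bar>u \<bullet> b\<bar> * norm (A x b v) \<le> norm u * (B b * norm v)"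
        by (intro mult_mono B(2)[OF that] Basis_le_norm) auto
      then show "norm ((u \<bullet> b) *\<^sub>R A x b v) \<le> B b * (norm u * norm v)" by (simp add: ac_simps)
    qed
    then show ?thesis by (simp add: sum_distrib_right mult.assoc)
  qed
  moreover have "0 \<le> (\<Sum>b\<in>(Basis::'c set). B b)" by (intro sum_nonneg B)
  ultimately show ?thesis by blast
qed

text \<open>On the unit interval the mean value inequality bounds the supremum of \<omega> by half
  of itself.\<close>

lemma vector_derivative_gronwall_zero:
  fixes \<omega> :: "real \<Rightarrow> 'e::real_normed_vector"
  assumes der: "\<And>t. t \<in> {0..1} \<Longrightarrow> (\<omega> has_vector_derivative \<omega>' t) (at t within {0..1})"
    and le: "\<And>t. t \<in> {0..1} \<Longrightarrow> norm (\<omega>' t) \<le> norm (\<omega> t) / 2"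
    and "\<omega> 0 = 0" "t \<in> {0..1}"
  shows "\<omega> t = 0"
proof -
  have "norm (\<omega> t) \<le> 0 / (1 - 1/2)"
  proof (rule sup_norm_estimate[OF _ _ _ assms(4)])
    show "continuous_on {0..1} \<omega>"
      using der has_vector_derivative_continuous unfolding continuous_on_eq_continuous_within by blast
    fix m t :: real assume m: "\<And>t. t \<in> {0..1} \<Longrightarrow> norm (\<omega> t) \<le> m" and t: "t \<in> {0..1}"
    have "norm (\<omega> t - \<omega> 0) \<le> m / 2 * norm (t - 0)"
    proof (rule differentiable_bound[where S = "{0..1}" and f' = "\<lambda>t h. h *\<^sub>R \<omega>' t"])
      show "onorm (\<lambda>h. h *\<^sub>R \<omega>' s) \<le> m / 2" if "s \<in> {0..1}" for s
      proof (rule onorm_bound)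
        show "norm (h *\<^sub>R \<omega>' s) \<le> m / 2 * norm h" for h
          using mult_left_mono[OF order_trans[OF le[OF that]], of "m / 2" "norm h"] m[OF that]
          by (simp add: mult.commute)
        show "0 \<le> m / 2" using order_trans[OF norm_ge_zero m[OF that]] by simp
      qed
    qed (use der t in \<open>auto simp: has_vector_derivative_def\<close>)
    moreover have "m / 2 * norm (t - 0) \<le> m / 2"
      using t order_trans[OF norm_ge_zero m[OF t]] by (simp add: mult_left_le)
    ultimately show "norm (\<omega> t) \<le> 0 + 1/2 * m" using \<open>\<omega> 0 = 0\<close> by simp
  qed simp
  then show ?thesis by simp
qed

lemma has_vector_derivative_integral_equation:
  fixes f :: "real \<Rightarrow> 'e::banach"
  assumes "continuous_on {a..b} f" "\<And>t. t \<in> {a..b} \<Longrightarrow> y t = y0 + integral {a..t} f" "t \<in> {a..b}"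
  shows "(y has_vector_derivative f t) (at t within {a..b})"
proof -
  have "((\<lambda>t. y0 + integral {a..t} f) has_vector_derivative 0 + f t) (at t within {a..b})"
    by (intro has_vector_derivative_add has_vector_derivative_const integral_has_vector_derivative assms)
  then have "(y has_vector_derivative 0 + f t) (at t within {a..b})"
    by (rule has_vector_derivative_transform[OF assms(3), rotated]) (simp add: assms(2))
  then show ?thesis by simp
qed

text \<open>The radial equation \<open>u' = P(u) \<sigma> z\<close>, \<open>u(0) = x0 + \<kappa> z\<close> sweeps out the integral manifolds of
  the image of \<open>P\<close>. For a variation \<open>V\<close> tangent to the leaf, the component \<open>V - P(u) V\<close> is parallel
  along the radial curve because \<open>P\<close> is parallel and the connection is torsion-free; it vanishes
  initially, hence identically.\<close>

lemma parallel_projection_flow: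
  fixes P :: "'e::euclidean_space \<Rightarrow> 'e \<Rightarrow> 'e" and \<Gamma> :: "'e \<Rightarrow> 'e \<Rightarrow> 'e \<Rightarrow> 'e" and \<sigma> \<kappa> :: "'e \<Rightarrow> 'e"
  assumes \<Omega>: "open \<Omega>" "cball x0 r \<subseteq> \<Omega>" "r > 0"
    and linP: "\<And>x. x \<in> \<Omega> \<Longrightarrow> linear (P x)" and smP: "\<And>v. smooth_on \<Omega> (\<lambda>x. P x v)"
    and idem: "\<And>x v. x \<in> \<Omega> \<Longrightarrow> P x (P x v) = P x v"
    and bil\<Gamma>: "\<And>x. x \<in> \<Omega> \<Longrightarrow> bilinear (\<Gamma> x)" and sym\<Gamma>: "\<And>x u v. x \<in> \<Omega> \<Longrightarrow> \<Gamma> x u v = \<Gamma> x v u"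
    and par: "\<And>x u v. x \<in> \<Omega> \<Longrightarrow>
      frechet_derivative (\<lambda>z. P z v) (at x) u + \<Gamma> x u (P x v) = P x (\<Gamma> x u v)"
    and Ple: "\<And>x v. x \<in> cball x0 r \<Longrightarrow> norm (P x v) \<le> B * norm v"
    and DPle: "\<And>x u v. x \<in> cball x0 r \<Longrightarrow> norm (frechet_derivative (\<lambda>z. P z v) (at x) u) \<le> B * norm u * norm v"
    and \<Gamma>le: "\<And>x u v. x \<in> cball x0 r \<Longrightarrow> norm (\<Gamma> x u v) \<le> B * norm u * norm v"
    and lin\<sigma>: "linear \<sigma>" and lin\<kappa>: "linear \<kappa>"
    and \<sigma>le: "\<And>z. norm (\<sigma> z) \<le> \<eta> * norm z" and \<kappa>le: "\<And>z. norm (\<kappa> z) \<le> \<eta> * norm z"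
    and B: "B \<ge> 0" and \<eta>: "\<eta> \<ge> 0" "B * \<eta> \<le> 1/2" "B * B * \<eta> \<le> 1/2" "\<eta> + B * \<eta> < r"
    and P0: "\<And>w. P x0 (\<sigma> w) = \<sigma> w"
  shows "\<exists>\<phi>. smooth_on (ball 0 1) \<phi> \<and> \<phi> ` ball 0 1 \<subseteq> \<Omega> \<and> \<phi> 0 = x0 \<and>
    (\<forall>w. frechet_derivative \<phi> (at 0) w = \<kappa> w + \<sigma> w) \<and>
    (\<forall>z\<in>ball 0 1. \<forall>w. \<kappa> w = 0 \<longrightarrow>
      P (\<phi> z) (frechet_derivative \<phi> (at z) w) = frechet_derivative \<phi> (at z) w)"
proof -
  define S where "S = ball (0::'e) 1"
  define U where "U = ball x0 r"
  define K where "K = cball x0 r"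
  have S: "open S" and U: "open U" by (simp_all add: S_def U_def)
  have UK: "U \<subseteq> K" and K\<Omega>: "K \<subseteq> \<Omega>" using \<Omega> by (auto simp: U_def K_def)
  define P' where "P' x u v = frechet_derivative (\<lambda>z. P z v) (at x) u" for x u v
  have derP: "((\<lambda>x. P x v) has_derivative (\<lambda>u. P' x u v)) (at x)" if "x \<in> \<Omega>" for x v
    using smooth_on_has_derivative[OF smP that] by (simp add: P'_def)
  have diffP: "(\<lambda>x. P x v) differentiable (at x)" if "x \<in> \<Omega>" for x v
    using derP[OF that] unfolding differentiable_def by blast
  have linP': "linear (\<lambda>v. P' x u v)" if "x \<in> \<Omega>" for x u
    unfolding P'_def by (rule linear_frechet_derivative_field[OF \<Omega>(1) that linP diffP[OF that]])
  have \<sigma>B: "norm (\<sigma> z) \<le> \<eta>" "norm (\<kappa> z) \<le> \<eta>" if "z \<in> S" for z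
    using \<sigma>le[of z] \<kappa>le[of z] mult_left_le[of "norm z" \<eta>] \<eta>(1) that by (auto simp: S_def)
  have lipP: "norm (P x a - P y a) \<le> B * norm a * norm (x - y)" if "x \<in> K" "y \<in> K" for x y a
  proof (rule differentiable_bound[where S = K and f' = "\<lambda>x u. P' x u a"])
    show "onorm (\<lambda>u. P' x u a) \<le> B * norm a" if "x \<in> K" for x
    proof (rule onorm_bound)
      show "norm (P' x u a) \<le> B * norm a * norm u" for u
        using DPle[of x a u] that by (simp add: P'_def K_def ac_simps)
    qed (use B in simp)
  qed (use that K\<Omega> in \<open>auto simp: K_def intro!: has_derivative_at_withinI derP\<close>)
  have cP: "continuous_on K (\<lambda>x. P x b)" for b
    by (rule continuous_on_subset[OF smooth_on_continuous[OF smP] K\<Omega>])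
  \<comment> \<open>Composing with the nearest-point retraction onto the ball extends the vector
    field to the whole space. The retraction is 1-Lipschitz, so the constant 1/2 survives.\<close>
  define cp where "cp = closest_point K"
  have K: "convex K" "closed K" "K \<noteq> {}" using \<Omega>(3) by (auto simp: K_def)
  have cpK: "cp v \<in> K" for v unfolding cp_def by (rule closest_point_in_set[OF K(2,3)])
  have cpid: "cp v = v" if "v \<in> K" for v unfolding cp_def by (rule closest_point_self[OF that])
  have cplip: "norm (cp v - cp w) \<le> norm (v - w)" for v w
    using closest_point_lipschitz[OF K, of v w] by (simp add: cp_def dist_norm)
  have ccp: "continuous_on UNIV cp" unfolding cp_def by (rule continuous_on_closest_point[OF K])
  have bl\<sigma>: "bounded_linear \<sigma>" and bl\<kappa>: "bounded_linear \<kappa>"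
    using lin\<sigma> lin\<kappa> linear_conv_bounded_linear by blast+
  define c where "c z = x0 + \<kappa> z" for z
  have smc: "smooth_on S c"
    unfolding c_def by (intro smooth_on_add smooth_on_const smooth_on_linear[OF S bl\<kappa>] smooth_on_ident S)
  have "\<exists>u. continuous_on (S \<times> {0..1::real}) (\<lambda>(z, t). u z t) \<and>
    (\<forall>z\<in>S. \<forall>t\<in>{0..1}. u z t = c z + integral {0..t} (\<lambda>s. P (cp (u z s)) (\<sigma> z)))"
  proof (rule volterra_solution_param[where F = "\<lambda>z t v. P (cp v) (\<sigma> z)"])
    have "continuous_on (S \<times> {0..1::real} \<times> (UNIV::'e set)) (\<lambda>q. P (cp (snd (snd q))) b)" for b
      by (rule continuous_on_compose2[OF cP], rule continuous_on_compose2[OF ccp])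
        (use cpK in \<open>auto intro!: continuous_intros\<close>)
    then have "continuous_on (S \<times> {0..1::real} \<times> (UNIV::'e set))
        (\<lambda>q. \<Sum>b\<in>Basis. (\<sigma> (fst q) \<bullet> b) *\<^sub>R P (cp (snd (snd q))) b)"
      by (intro continuous_intros bounded_linear.continuous_on[OF bl\<sigma>])
    moreover have "(\<Sum>b\<in>Basis. (\<sigma> z \<bullet> b) *\<^sub>R P (cp v) b) = P (cp v) (\<sigma> z)" for z v
      using linear_euclidean_sum[OF linP, symmetric] cpK K\<Omega> by blast
    ultimately show "continuous_on (S \<times> {0..1} \<times> UNIV) (\<lambda>(z, t::real, v). P (cp v) (\<sigma> z))"
      by (simp add: split_def)
    show "norm (P (cp v) (\<sigma> z) - P (cp w) (\<sigma> z)) \<le> norm (v - w) / 2" if "z \<in> S" for z v w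
    proof -
      have "norm (P (cp v) (\<sigma> z) - P (cp w) (\<sigma> z)) \<le> B * norm (\<sigma> z) * norm (cp v - cp w)"
        by (rule lipP[OF cpK cpK])
      also have "\<dots> \<le> B * \<eta> * norm (v - w)"
        using B \<eta>(1) by (intro mult_mono \<sigma>B(1)[OF that] cplip) auto
      also have "\<dots> \<le> 1/2 * norm (v - w)" using \<eta>(2) by (intro mult_right_mono) auto
      finally show ?thesis by simp
    qed
  qed (use smooth_on_continuous[OF smc] in auto)
  then obtain u :: "'e \<Rightarrow> real \<Rightarrow> 'e" where contu: "continuous_on (S \<times> {0..1}) (\<lambda>(z, t). u z t)"
    and equ': "\<And>z t. z \<in> S \<Longrightarrow> t \<in> {0..1} \<Longrightarrow> u z t = c z + integral {0..t} (\<lambda>s. P (cp (u z s)) (\<sigma> z))"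
    by blast
  have contu1: "continuous_on {0..1} (u z)" if "z \<in> S" for z
  by (rule continuous_on_slice[OF contu that])
  have contPu: "continuous_on {0..1} (\<lambda>s. P (cp (u z s)) a)" if "z \<in> S" for z a
    by (rule continuous_on_compose2[OF cP], rule continuous_on_compose2[OF ccp contu1[OF that]])
      (use cpK in auto)
  \<comment> \<open>The velocity is at most \<open>B * \<eta>\<close> and the initial point lies
    within \<eta> of \<open>x0\<close>, so the solution never leaves the ball and the retraction is
    inactive.\<close>
  have uU: "u z t \<in> U" if z: "z \<in> S" and t: "t \<in> {0..1}" for z t
  proof -
    have "norm (integral {0..t} (\<lambda>s. P (cp (u z s)) (\<sigma> z))) \<le> B * \<eta>"
    proof (rule norm_integral_le[OF contPu[OF z] t])
      fix s
      have "norm (P (cp (u z s)) (\<sigma> z)) \<le> B * norm (\<sigma> z)" using Ple cpK by (simp add: K_def)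
      also have "\<dots> \<le> B * \<eta>" by (rule mult_left_mono[OF \<sigma>B(1)[OF z] B])
      finally show "norm (P (cp (u z s)) (\<sigma> z)) \<le> B * \<eta>" .
    qed
    then have "norm (\<kappa> z + integral {0..t} (\<lambda>s. P (cp (u z s)) (\<sigma> z))) < r"
      using \<sigma>B(2)[OF z] \<eta>(4) norm_triangle_ineq[of "\<kappa> z" "integral {0..t} (\<lambda>s. P (cp (u z s)) (\<sigma> z))"]
      by linarith
    moreover have "u z t - x0 = \<kappa> z + integral {0..t} (\<lambda>s. P (cp (u z s)) (\<sigma> z))"
      using equ'[OF z t] by (simp add: c_def)
    ultimately have "norm (u z t - x0) < r" by simp
    then show ?thesis by (simp add: U_def dist_norm norm_minus_commute)
  qed
  have u\<Omega>: "u z t \<in> \<Omega>" if "z \<in> S" "t \<in> {0..1}" for z t using uU[OF that] UK K\<Omega> by blast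
  have uK: "u z t \<in> K" if "z \<in> S" "t \<in> {0..1}" for z t using uU[OF that] UK by blast
  \<comment> \<open>The retraction is not smooth in general. Once the solution is confined to
    \<open>U\<close>, the same integral equation holds with the smooth field, and regularity is
    deduced from that version.\<close>
  define F :: "'e \<times> 'e \<Rightarrow> real \<Rightarrow> 'e" where "F q t = P (snd q) (\<sigma> (fst q))" for q t
  have equ: "u z t = c z + integral {0..t} (\<lambda>s. F (z, u z s) s)" if "z \<in> S" "t \<in> {0..1}" for z t
  proof -
    have "integral {0..t} (\<lambda>s. P (cp (u z s)) (\<sigma> z)) = integral {0..t} (\<lambda>s. F (z, u z s) s)"
      using that by (intro integral_cong) (auto simp: F_def cpid[OF uK])
    then show ?thesis using equ'[OF that] by simp
  qed
  have SU: "open (S \<times> U)" by (intro open_Times S U)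
  have F: "Ck_param k (S \<times> U) {0..1} F" for k
    unfolding F_def
  proof (rule Ck_param_linear_apply[OF SU, where A = "\<lambda>q t. P (snd q)" and V = "\<lambda>q t. \<sigma> (fst q)"])
    show "Ck_param k (S \<times> U) {0..1} (\<lambda>q t. \<sigma> (fst q))"
      by (intro Ck_param_linear[OF SU bl\<sigma>] Ck_param_linear[OF SU bounded_linear_fst] Ck_param_ident SU)
    have *: "Ck_param k \<Omega> {0..1} (\<lambda>x t. P x b)" for b
      using smP[of b] Ck_on_imp_param[OF \<Omega>(1)] by (auto simp: smooth_on_def)
    show "Ck_param k (S \<times> U) {0..1} (\<lambda>q t. P (snd q) b)" for b
      by (rule Ck_param_compose[OF SU \<Omega>(1) _ *, where V = "\<lambda>q t. snd q"])
        (use UK K\<Omega> in \<open>auto intro!: Ck_param_linear[OF SU bounded_linear_snd] Ck_param_ident SU\<close>)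
  qed (use linP UK K\<Omega> in auto)
  have lipF: "norm (F (z, v) t - F (z, w) t) \<le> norm (v - w) / 2"
    if "z \<in> S" "v \<in> U" "w \<in> U" for z t v w
  proof -
    have "norm (P v (\<sigma> z) - P w (\<sigma> z)) \<le> B * norm (\<sigma> z) * norm (v - w)"
      using lipP that UK by blast
    also have "\<dots> \<le> B * \<eta> * norm (v - w)"
      using B by (intro mult_right_mono mult_left_mono \<sigma>B(1)[OF that(1)]) auto
    also have "\<dots> \<le> 1/2 * norm (v - w)" using \<eta>(2) by (intro mult_right_mono) auto
    finally show ?thesis by (simp add: F_def)
  qed
  have Cku: "Ck_param k S {0..1} u" for k
    by (rule volterra_Ck[OF S U F smc contu uU equ lipF])
  define \<phi> where "\<phi> = (\<lambda>z. u z 1)"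
  have sm\<phi>: "smooth_on S \<phi>"
    unfolding smooth_on_def \<phi>_def using Ck_param_imp_on[OF Cku, of 1] by simp
  have DF: "frechet_derivative (\<lambda>q. F q t) (at (z, x)) (h, v) = P' x v (\<sigma> z) + P x (\<sigma> h)"
    if "z \<in> S" "x \<in> U" for z x t h v
  proof -
    have "((\<lambda>q. P (snd q) (\<sigma> (fst q))) has_derivative
        (\<lambda>k. frechet_derivative (\<lambda>y. P y (\<sigma> (fst (z, x)))) (at (snd (z, x))) (snd k) + P (snd (z, x)) (\<sigma> (fst k))))
        (at (z, x) within UNIV \<times> U)"
    proof (rule has_derivative_linear_field[OF \<Omega>(1), where f = snd and f' = snd and A = P
          and w = "\<lambda>q. \<sigma> (fst q)" and w' = "\<lambda>k. \<sigma> (fst k)"])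
      show "(snd has_derivative snd) (at (z, x) within UNIV \<times> U)"
        by (rule bounded_linear_imp_has_derivative[OF bounded_linear_snd])
      show "((\<lambda>q. \<sigma> (fst q)) has_derivative (\<lambda>k. \<sigma> (fst k))) (at (z, x) within UNIV \<times> U)"
        by (intro bounded_linear_imp_has_derivative bounded_linear_compose[OF bl\<sigma> bounded_linear_fst])
    qed (use that UK K\<Omega> linP in \<open>auto intro!: diffP\<close>)
    moreover have "at (z, x) within UNIV \<times> U = at (z, x)"
      by (rule at_within_open) (use that U in \<open>auto intro!: open_Times\<close>)
    ultimately have "((\<lambda>q. F q t) has_derivative (\<lambda>k. P' x (snd k) (\<sigma> z) + P x (\<sigma> (fst k)))) (at (z, x))"
      by (simp add: F_def P'_def)
    from frechet_derivative_at[OF this, symmetric] show ?thesis by simp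
  qed
  obtain L :: "'e \<Rightarrow> real \<Rightarrow> 'e \<Rightarrow> 'e" where L: "\<And>z t. z \<in> S \<Longrightarrow> t \<in> {0..1} \<Longrightarrow> ((\<lambda>y. u y t) has_derivative L z t) (at z)"
    and contL: "\<And>h. continuous_on (S \<times> {0..1}) (\<lambda>(z, t). L z t h)"
    and eqL': "\<And>h z t. z \<in> S \<Longrightarrow> t \<in> {0..1} \<Longrightarrow> L z t h = frechet_derivative c (at z) h +
      integral {0..t} (\<lambda>s. frechet_derivative (\<lambda>q. F q s) (at (z, u z s)) (h, L z s h))"
    using volterra_derivative[OF S U F smc contu uU equ lipF] by blast
  have Dc: "frechet_derivative c (at z) h = \<kappa> h" for z h
  proof -
    have "(c has_derivative \<kappa>) (at z)"
      unfolding c_def using bounded_linear_imp_has_derivative[OF bl\<kappa>]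
      by (auto intro!: derivative_eq_intros)
    then show ?thesis using frechet_derivative_at by metis
  qed
  have eqL: "L z t h = \<kappa> h + integral {0..t} (\<lambda>s. P' (u z s) (L z s h) (\<sigma> z) + P (u z s) (\<sigma> h))"
    if "z \<in> S" "t \<in> {0..1}" for z t h
  proof -
    have "integral {0..t} (\<lambda>s. frechet_derivative (\<lambda>q. F q s) (at (z, u z s)) (h, L z s h)) =
        integral {0..t} (\<lambda>s. P' (u z s) (L z s h) (\<sigma> z) + P (u z s) (\<sigma> h))"
      using that by (intro integral_cong) (auto simp: DF uU)
    then show ?thesis using eqL'[OF that, of h] by (simp add: Dc)
  qed
  have D\<phi>: "frechet_derivative \<phi> (at z) = L z 1" if "z \<in> S" for z
    using frechet_derivative_at[OF L[OF that, of 1]] by (simp add: \<phi>_def)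
  have P'sum: "P' x v a = (\<Sum>b\<in>Basis. (v \<bullet> b) *\<^sub>R P' x b a)" if "x \<in> \<Omega>" for x v a
    by (rule linear_euclidean_sum[OF has_derivative_linear[OF derP[OF that]]])
  \<comment> \<open>Parallelism solved for the coordinate derivative: every derivative of
    \<open>P\<close> becomes a commutator with the connection.\<close>
  have parD: "P' x v a = P x (\<Gamma> x v a) - \<Gamma> x v (P x a)" if "x \<in> \<Omega>" for x v a
    using par[OF that, of a v] by (simp add: P'_def algebra_simps)
  have tangent: "P (\<phi> z) (L z 1 w) = L z 1 w" if z: "z \<in> S" and w: "\<kappa> w = 0" for z w
  proof -
    have contL1: "continuous_on {0..1} (\<lambda>t. L z t w)"
    by (rule continuous_on_slice[OF contL z])
    have cPu: "continuous_on {0..1} (\<lambda>s. P (u z s) a)" for a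
      by (rule continuous_on_compose2[OF smooth_on_continuous[OF smP] contu1[OF z]])
        (use u\<Omega>[OF z] in auto)
    have cP'u: "continuous_on {0..1} (\<lambda>s. P' (u z s) b a)" for a b
      unfolding P'_def
      by (rule continuous_on_compose2[OF smooth_on_continuous[OF smooth_on_frechet_derivative[OF smP]] contu1[OF z]])
        (use u\<Omega>[OF z] in auto)
    have "continuous_on {0..1} (\<lambda>s. \<Sum>b\<in>Basis. (L z s w \<bullet> b) *\<^sub>R P' (u z s) b (\<sigma> z))"
      by (intro continuous_intros contL1 cP'u)
    then have cP'L: "continuous_on {0..1} (\<lambda>s. P' (u z s) (L z s w) (\<sigma> z))"
      by (rule continuous_on_eq) (rule P'sum[OF u\<Omega>[OF z], symmetric])
    have du: "(u z has_vector_derivative P (u z t) (\<sigma> z)) (at t within {0..1})" if "t \<in> {0..1}" for t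
      by (rule has_vector_derivative_integral_equation[OF cPu _ that]) (use equ[OF z] in \<open>simp add: F_def\<close>)
    have dV: "((\<lambda>t. L z t w) has_vector_derivative
        (P' (u z t) (L z t w) (\<sigma> z) + P (u z t) (\<sigma> w))) (at t within {0..1})" if "t \<in> {0..1}" for t
      by (rule has_vector_derivative_integral_equation[OF continuous_on_add[OF cP'L cPu] _ that])
        (rule eqL[OF z])
    define \<omega> where "\<omega> = (\<lambda>t. L z t w - P (u z t) (L z t w))"
    have "\<omega> 1 = 0"
    proof (rule vector_derivative_gronwall_zero[where \<omega>' = "\<lambda>t. - \<Gamma> (u z t) (P (u z t) (\<sigma> z)) (\<omega> t)"])
      fix t :: real assume t: "t \<in> {0..1}"
      define x V s where "x = u z t" and "V = L z t w" and "s = \<sigma> z"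
      note xVs = x_def[symmetric] V_def[symmetric] s_def[symmetric]
      have x: "x \<in> \<Omega>" using u\<Omega>[OF z t] by (simp add: x_def)
      define V' where "V' = P' x V s + P x (\<sigma> w)"
      have "((\<lambda>t. P (u z t) (L z t w)) has_derivative
          (\<lambda>h. frechet_derivative (\<lambda>y. P y (L z t w)) (at (u z t)) (h *\<^sub>R P x s) + P (u z t) (h *\<^sub>R V')))
          (at t within {0..1})"
        by (rule has_derivative_linear_field[OF \<Omega>(1), where f = "u z" and A = P and w = "\<lambda>t. L z t w"])
          (use t x u\<Omega>[OF z] linP diffP du[OF t] dV[OF t] in
            \<open>auto simp: has_vector_derivative_def xVs V'_def\<close>)
      then have "((\<lambda>t. P (u z t) (L z t w)) has_vector_derivative (P' x (P x s) V + P x V')) (at t within {0..1})"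
        using linear_scale[OF linP[OF x]] linear_scale[OF has_derivative_linear[OF derP[OF x]]]
        by (simp add: has_vector_derivative_def xVs P'_def scaleR_add_right)
      then have "(\<omega> has_vector_derivative (V' - (P' x (P x s) V + P x V'))) (at t within {0..1})"
        unfolding \<omega>_def using dV[OF t] by (intro has_vector_derivative_diff) (simp_all add: xVs V'_def)
      \<comment> \<open>The terms \<open>P x (\<sigma> w)\<close> cancel by idempotence, and
        torsion-freeness turns \<open>\<Gamma> x V (P x s)\<close> into
        \<open>\<Gamma> x (P x s) V\<close>. What remains is a linear equation for \<omega>
        alone.\<close>
      also have "V' - (P' x (P x s) V + P x V') = - \<Gamma> x (P x s) (V - P x V)"
      proof -
        note l = linear_add[OF linP[OF x]] linear_diff[OF linP[OF x]]
        have "V' - P x V' = - \<Gamma> x V (P x s) + P x (\<Gamma> x V (P x s))"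
          unfolding V'_def parD[OF x] by (simp add: l idem[OF x])
        moreover have "P' x (P x s) V = P x (\<Gamma> x V (P x s)) - \<Gamma> x (P x s) (P x V)"
          unfolding parD[OF x] using sym\<Gamma>[OF x, of V "P x s"] by simp
        moreover have "\<Gamma> x (P x s) (V - P x V) = \<Gamma> x V (P x s) - \<Gamma> x (P x s) (P x V)"
          using bilinear_rsub[OF bil\<Gamma>[OF x]] sym\<Gamma>[OF x, of V "P x s"] by simp
        moreover have "V' - (P' x (P x s) V + P x V') = (V' - P x V') - P' x (P x s) V" by simp
        ultimately show ?thesis by (simp only:) simp
      qed
      finally show "(\<omega> has_vector_derivative - \<Gamma> (u z t) (P (u z t) (\<sigma> z)) (\<omega> t)) (at t within {0..1})"
        by (simp add: \<omega>_def x_def V_def s_def)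
      have xK: "u z t \<in> cball x0 r" using uK[OF z t] by (simp add: K_def)
      have "norm (\<Gamma> (u z t) (P (u z t) (\<sigma> z)) (\<omega> t)) \<le> B * norm (P (u z t) (\<sigma> z)) * norm (\<omega> t)"
        by (rule \<Gamma>le[OF xK])
      also have "\<dots> \<le> B * (B * \<eta>) * norm (\<omega> t)"
        using order_trans[OF Ple[OF xK] mult_left_mono[OF \<sigma>B(1)[OF z] B]] B
        by (intro mult_right_mono mult_left_mono) auto
      also have "\<dots> \<le> 1/2 * norm (\<omega> t)" using \<eta>(3) by (intro mult_right_mono) (auto simp: ac_simps)
      finally show "norm (- \<Gamma> (u z t) (P (u z t) (\<sigma> z)) (\<omega> t)) \<le> norm (\<omega> t) / 2" by simp
    next
      \<comment> \<open>The linearised equation starts at \<open>\<kappa> w\<close>; this is where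
        the condition on \<open>w\<close> enters.\<close>
      have "L z 0 w = 0" using eqL[OF z, of 0 w] w by simp
      then show "\<omega> 0 = 0" using linear_0[OF linP[OF u\<Omega>[OF z, of 0]]] by (simp add: \<omega>_def)
    qed simp
    then show ?thesis by (simp add: \<omega>_def \<phi>_def)
  qed
  have x0: "x0 \<in> \<Omega>" and S0: "0 \<in> S" using \<Omega> by (auto simp: S_def)
  \<comment> \<open>At \<open>z = 0\<close> both \<sigma> and \<kappa> vanish, so the solution is
    constant and the linearised equation along it can be integrated explicitly.\<close>
  have u0: "u 0 t = x0" if "t \<in> {0..1}" for t
  proof -
    have "integral {0..t} (\<lambda>s. F (0, u 0 s) s) = integral {0..t} (\<lambda>s. 0)"
      using that by (intro integral_cong)
        (auto simp: F_def linear_0[OF lin\<sigma>] intro!: linear_0[OF linP] u\<Omega> S0)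
    then show ?thesis using equ[OF S0 that] by (simp add: c_def linear_0[OF lin\<kappa>])
  qed
  have L0: "L 0 1 w = \<kappa> w + \<sigma> w" for w
  proof -
    have "integral {0..1} (\<lambda>s. P' (u 0 s) (L 0 s w) (\<sigma> 0) + P (u 0 s) (\<sigma> w)) = integral {0..1::real} (\<lambda>s. \<sigma> w)"
      by (intro integral_cong) (simp add: u0 P0 linear_0[OF lin\<sigma>] linear_0[OF linP'[OF x0]])
    then show ?thesis using eqL[OF S0, of 1 w] by simp
  qed
  show ?thesis
  proof (intro exI[of _ \<phi>] conjI allI ballI impI)
    show "smooth_on (ball 0 1) \<phi>" using sm\<phi> by (simp add: S_def)
    show "\<phi> ` ball 0 1 \<subseteq> \<Omega>" using u\<Omega>[of _ 1] by (auto simp: \<phi>_def S_def)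
    show "\<phi> 0 = x0" by (simp add: \<phi>_def u0)
    show "frechet_derivative \<phi> (at 0) w = \<kappa> w + \<sigma> w" for w by (simp add: D\<phi>[OF S0] L0)
    show "P (\<phi> z) (frechet_derivative \<phi> (at z) w) = frechet_derivative \<phi> (at z) w"
      if "z \<in> ball 0 1" "\<kappa> w = 0" for z w
      using tangent[of z w] that D\<phi>[of z] by (simp add: S_def)
  qed
qed

lemma smooth_on_differentiable:
  "smooth_on S f \<Longrightarrow> x \<in> S \<Longrightarrow> f differentiable (at x)"
  using smooth_on_has_derivative unfolding differentiable_def by blast

lemma linear_euclidean_bound:
  fixes L :: "'b::euclidean_space \<Rightarrow> 'c::real_normed_vector"
  assumes "linear L"
  shows "\<exists>N\<ge>0. \<forall>v. norm (L v) \<le> N * norm v"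
  using linear_family_bound[of "{0::real}" "\<lambda>_. L"] assms by auto

text \<open>\<open>T\<close> is a frame and \<pi> singles out the leaf coordinates: \<sigma> and
  \<kappa> are small multiples of \<open>T\<close> after \<pi> and after its complement. Their sum
  is a multiple of \<open>T\<close>, so the flow map is a local diffeomorphism, and \<kappa> kills
  the directions fixed by \<pi>.\<close>

lemma parallel_projection_chart:
  fixes P :: "real^'n \<Rightarrow> real^'n \<Rightarrow> real^'n" and \<Gamma> :: "real^'n \<Rightarrow> real^'n \<Rightarrow> real^'n \<Rightarrow> real^'n"
    and T \<pi> :: "real^'n \<Rightarrow> real^'n"
  assumes \<Omega>: "open \<Omega>" "x0 \<in> \<Omega>"
    and linP: "\<And>x. x \<in> \<Omega> \<Longrightarrow> linear (P x)" and smP: "\<And>v. smooth_on \<Omega> (\<lambda>x. P x v)"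
    and idem: "\<And>x v. x \<in> \<Omega> \<Longrightarrow> P x (P x v) = P x v"
    and bil\<Gamma>: "\<And>x. x \<in> \<Omega> \<Longrightarrow> bilinear (\<Gamma> x)" and sym\<Gamma>: "\<And>x u v. x \<in> \<Omega> \<Longrightarrow> \<Gamma> x u v = \<Gamma> x v u"
    and sm\<Gamma>: "\<And>u v. smooth_on \<Omega> (\<lambda>x. \<Gamma> x u v)"
    and par: "\<And>x u v. x \<in> \<Omega> \<Longrightarrow>
      frechet_derivative (\<lambda>z. P z v) (at x) u + \<Gamma> x u (P x v) = P x (\<Gamma> x u v)"
    and linT: "linear T" and bijT: "bij T" and lin\<pi>: "linear \<pi>" and P0: "\<And>w. P x0 (T (\<pi> w)) = T (\<pi> w)"
  obtains S V \<phi> \<psi> where "open S" "0 \<in> S" "open V" "V \<subseteq> \<Omega>" "\<phi> 0 = x0" "homeomorphism S V \<phi> \<psi>"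
    "smooth_on S \<phi>" "smooth_on V \<psi>"
    "\<And>z w. z \<in> S \<Longrightarrow> \<pi> w = w \<Longrightarrow> P (\<phi> z) (frechet_derivative \<phi> (at z) w) = frechet_derivative \<phi> (at z) w"
proof -
  obtain r where r: "r > 0" "cball x0 r \<subseteq> \<Omega>" using open_contains_cball \<Omega> by blast
  note cont = continuous_on_subset[OF smooth_on_continuous r(2)]
  obtain B1 where B1: "B1 \<ge> 0" "\<And>x v. x \<in> cball x0 r \<Longrightarrow> norm (P x v) \<le> B1 * norm v"
    using linear_family_bound[OF compact_cball, of x0 r P] linP cont[OF smP] r(2) by blast
  have bilP': "bilinear (\<lambda>u v. frechet_derivative (\<lambda>z. P z v) (at x) u)" if "x \<in> \<Omega>" for x
    unfolding bilinear_def
    using has_derivative_linear[OF smooth_on_has_derivative[OF smP that]]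
      linear_frechet_derivative_field[OF \<Omega>(1) that linP smooth_on_differentiable[OF smP that]]
    by blast
  obtain B2 where B2: "B2 \<ge> 0" "\<And>x u v. x \<in> cball x0 r \<Longrightarrow>
      norm (frechet_derivative (\<lambda>z. P z v) (at x) u) \<le> B2 * norm u * norm v"
    using bilinear_family_bound[OF compact_cball, of x0 r "\<lambda>x u v. frechet_derivative (\<lambda>z. P z v) (at x) u"]
      bilP' cont[OF smooth_on_frechet_derivative[OF smP]] r(2) by blast
  obtain B3 where B3: "B3 \<ge> 0" "\<And>x u v. x \<in> cball x0 r \<Longrightarrow> norm (\<Gamma> x u v) \<le> B3 * norm u * norm v"
    using bilinear_family_bound[OF compact_cball, of x0 r \<Gamma>] bil\<Gamma> cont[OF sm\<Gamma>] r(2) by blast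
  define B where "B = B1 + B2 + B3"
  have B: "B \<ge> 0" "B1 \<le> B" "B2 \<le> B" "B3 \<le> B" using B1(1) B2(1) B3(1) by (auto simp: B_def)
  have lin1: "linear (\<lambda>z. T (\<pi> z))" using linear_compose[OF lin\<pi> linT] by (simp add: o_def)
  have lin2: "linear (\<lambda>z. T (z - \<pi> z))"
    using linear_compose[OF linear_compose_sub[OF linear_id lin\<pi>] linT] by (simp add: o_def id_def)
  obtain N1 where N1: "N1 \<ge> 0" "\<And>z. norm (T (\<pi> z)) \<le> N1 * norm z"
    using linear_euclidean_bound[OF lin1] by blast
  obtain N2 where N2: "N2 \<ge> 0" "\<And>z. norm (T (z - \<pi> z)) \<le> N2 * norm z"
    using linear_euclidean_bound[OF lin2] by blast
  \<comment> \<open>Chosen so that \<eta>, \<open>B * \<eta>\<close> and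
    \<open>B * B * \<eta>\<close> add up to \<open>min (1/2) (r/2)\<close>; each smallness condition
    of the flow lemma can be read off from this sum.\<close>
  define D where "D = 1 + B + B * B"
  define \<eta> where "\<eta> = min (1/2) (r/2) / D"
  \<comment> \<open>The 1 keeps the denominator positive even if both operator bounds are 0.\<close>
  define \<epsilon> where "\<epsilon> = \<eta> / (1 + N1 + N2)"
  have D: "D \<ge> 1" using B(1) by (simp add: D_def)
  have \<eta>: "\<eta> > 0" "\<eta> * D = min (1/2) (r/2)" using D r(1) by (auto simp: \<eta>_def)
  have \<epsilon>: "\<epsilon> > 0" "\<epsilon> * (1 + N1 + N2) = \<eta>" using \<eta>(1) N1(1) N2(1) by (auto simp: \<epsilon>_def)
  have e: "\<eta> + B * \<eta> + B * B * \<eta> = min (1/2) (r/2)" using \<eta>(2) by (simp add: D_def algebra_simps)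
  have e': "0 \<le> B * \<eta>" "0 \<le> B * B * \<eta>" using B(1) \<eta>(1) by simp_all
  have \<epsilon>N: "\<epsilon> * N1 \<le> \<eta>" "\<epsilon> * N2 \<le> \<eta>"
    using \<epsilon>(1) N1(1) N2(1) unfolding \<epsilon>(2)[symmetric] by simp_all
  define \<sigma> where "\<sigma> z = \<epsilon> *\<^sub>R T (\<pi> z)" for z
  define \<kappa> where "\<kappa> z = \<epsilon> *\<^sub>R T (z - \<pi> z)" for z
  have \<sigma>le: "norm (\<sigma> z) \<le> \<eta> * norm z" for z
  proof -
    have "norm (\<sigma> z) \<le> \<epsilon> * (N1 * norm z)" using N1(2)[of z] \<epsilon>(1) by (simp add: \<sigma>_def)
    also have "\<dots> \<le> \<eta> * norm z" using mult_right_mono[OF \<epsilon>N(1), of "norm z"] by simp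
    finally show ?thesis .
  qed
  have \<kappa>le: "norm (\<kappa> z) \<le> \<eta> * norm z" for z
  proof -
    have "norm (\<kappa> z) \<le> \<epsilon> * (N2 * norm z)" using N2(2)[of z] \<epsilon>(1) by (simp add: \<kappa>_def)
    also have "\<dots> \<le> \<eta> * norm z" using mult_right_mono[OF \<epsilon>N(2), of "norm z"] by simp
    finally show ?thesis .
  qed
  have "\<exists>\<phi>. smooth_on (ball 0 1) \<phi> \<and> \<phi> ` ball 0 1 \<subseteq> \<Omega> \<and> \<phi> 0 = x0 \<and>
    (\<forall>w. frechet_derivative \<phi> (at 0) w = \<kappa> w + \<sigma> w) \<and>
    (\<forall>z\<in>ball 0 1. \<forall>w. \<kappa> w = 0 \<longrightarrow>
      P (\<phi> z) (frechet_derivative \<phi> (at z) w) = frechet_derivative \<phi> (at z) w)"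
  proof (rule parallel_projection_flow[OF \<Omega>(1) r(2,1) linP smP idem bil\<Gamma> sym\<Gamma> par, where B = B and \<eta> = \<eta>])
    show "norm (P x v) \<le> B * norm v" if "x \<in> cball x0 r" for x v
      using order_trans[OF B1(2)[OF that] mult_right_mono[OF B(2)]] by simp
    show "norm (frechet_derivative (\<lambda>z. P z v) (at x) u) \<le> B * norm u * norm v" if "x \<in> cball x0 r" for x u v
      using order_trans[OF B2(2)[OF that] mult_right_mono[OF mult_right_mono[OF B(3)]]] by simp
    show "norm (\<Gamma> x u v) \<le> B * norm u * norm v" if "x \<in> cball x0 r" for x u v
      using order_trans[OF B3(2)[OF that] mult_right_mono[OF mult_right_mono[OF B(4)]]] by simp
    show "linear \<sigma>" "linear \<kappa>"
      unfolding \<sigma>_def \<kappa>_def by (intro linear_compose_scale_right lin1 lin2)+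
    show "B * \<eta> \<le> 1/2" "B * B * \<eta> \<le> 1/2" "\<eta> + B * \<eta> < r" "\<eta> \<ge> 0" using e e' \<eta>(1) r(1) by linarith+
    show "P x0 (\<sigma> w) = \<sigma> w" for w
      by (simp add: \<sigma>_def linear_scale[OF linP[OF \<Omega>(2)]] P0)
  qed (assumption | fact \<sigma>le \<kappa>le B(1))+
  then obtain \<phi> where \<phi>: "smooth_on (ball 0 1) \<phi>" "\<phi> ` ball 0 1 \<subseteq> \<Omega>" "\<phi> 0 = x0"
    "\<And>w. frechet_derivative \<phi> (at 0) w = \<kappa> w + \<sigma> w"
    "\<And>z w. z \<in> ball 0 1 \<Longrightarrow> \<kappa> w = 0 \<Longrightarrow> P (\<phi> z) (frechet_derivative \<phi> (at z) w) = frechet_derivative \<phi> (at z) w"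
    by blast
  have "frechet_derivative \<phi> (at 0) = (\<lambda>w. \<epsilon> *\<^sub>R T w)"
    by (rule ext) (simp add: \<phi>(4) \<kappa>_def \<sigma>_def scaleR_add_right[symmetric] linear_diff[OF linT])
  moreover have "bij (\<lambda>w. \<epsilon> *\<^sub>R T w)"
  proof (rule o_bij)
    show "(\<lambda>w. \<epsilon> *\<^sub>R T w) \<circ> (\<lambda>v. inv T (inverse \<epsilon> *\<^sub>R v)) = id"
      using bijT \<epsilon>(1) by (auto simp: fun_eq_iff bij_is_surj surj_f_inv_f)
    show "(\<lambda>v. inv T (inverse \<epsilon> *\<^sub>R v)) \<circ> (\<lambda>w. \<epsilon> *\<^sub>R T w) = id"
      using bijT \<epsilon>(1) by (auto simp: fun_eq_iff bij_is_inj)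
  qed
  ultimately have "bij (frechet_derivative \<phi> (at 0))" by simp
  then obtain S V \<psi> where S: "open S" "S \<subseteq> ball 0 1" "0 \<in> S" "open V" "homeomorphism S V \<phi> \<psi>" "smooth_on V \<psi>"
    using smooth_inverse_function[OF open_ball \<phi>(1)] by (metis centre_in_ball zero_less_one)
  show ?thesis
  proof (rule that[OF S(1,3,4) _ \<phi>(3) S(5) smooth_on_subset[OF \<phi>(1) S(2)] S(6)])
    show "V \<subseteq> \<Omega>" using S(2,5) \<phi>(2) by (auto simp: homeomorphism_def)
    show "P (\<phi> z) (frechet_derivative \<phi> (at z) w) = frechet_derivative \<phi> (at z) w"
      if "z \<in> S" "\<pi> w = w" for z w
      using that S(2) linear_0[OF linT] by (intro \<phi>(5)) (auto simp: \<kappa>_def)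
  qed
qed

section \<open>Charts of a smooth atlas\<close>

lemma has_derivative_linear_field_at:
  fixes A :: "'b::euclidean_space \<Rightarrow> 'c::euclidean_space \<Rightarrow> 'd::euclidean_space"
  assumes "open S" "x \<in> S" "\<And>x. x \<in> S \<Longrightarrow> linear (A x)" "\<And>v. (\<lambda>x. A x v) differentiable (at x)"
    and "(w has_derivative w') (at x)"
  shows "((\<lambda>z. A z (w z)) has_derivative
    (\<lambda>h. frechet_derivative (\<lambda>z. A z (w x)) (at x) h + A x (w' h))) (at x)"
proof -
  have "((\<lambda>z. A z (w z)) has_derivative
      (\<lambda>h. frechet_derivative (\<lambda>z. A z (w x)) (at x) h + A x (w' h))) (at x within S)"
    by (rule has_derivative_linear_field[OF assms(1), where f = "\<lambda>x. x" and A = A and w = w])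
      (use assms in \<open>auto intro: has_derivative_at_withinI has_derivative_ident\<close>)
  then show ?thesis by (simp only: at_within_open[OF assms(2,1)])
qed

locale smooth_atlas =
  fixes M :: "'a::{t2_space,second_countable_topology} set" and A :: "'a chart set"
  assumes manifold: "smooth_4_manifold M A"
begin

lemma chart: "c \<in> A \<Longrightarrow> is_chart M c"
  using manifold[unfolded smooth_4_manifold_def, THEN conjunct1] by blast

lemma covers: "(\<Union>c\<in>A. chart_dom c) = M"
  using manifold[unfolded smooth_4_manifold_def, THEN conjunct2, THEN conjunct1] .

lemma compatible: "c \<in> A \<Longrightarrow> d \<in> A \<Longrightarrow> smoothly_compatible c d"
  using manifold[unfolded smooth_4_manifold_def, THEN conjunct2, THEN conjunct2, THEN conjunct1] by blast

lemma maximal: "is_chart M c \<Longrightarrow> \<forall>d\<in>A. smoothly_compatible c d \<Longrightarrow> c \<in> A"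
  using manifold[unfolded smooth_4_manifold_def, THEN conjunct2, THEN conjunct2, THEN conjunct2] by blast

lemma open_chart_dom: "c \<in> A \<Longrightarrow> open (chart_dom c)"
  and open_chart_image: "c \<in> A \<Longrightarrow> open (chart_image c)"
  and chart_dom_subset: "c \<in> A \<Longrightarrow> chart_dom c \<subseteq> M"
  and homeomorphism_chart: "c \<in> A \<Longrightarrow> homeomorphism (chart_dom c) (chart_image c) (coord c) (chart_inv c)"
  using chart by (simp_all only: is_chart_def)

lemma continuous_coord: "c \<in> A \<Longrightarrow> continuous_on (chart_dom c) (coord c)"
  and continuous_chart_inv: "c \<in> A \<Longrightarrow> continuous_on (chart_image c) (chart_inv c)"
  by (simp_all only: homeomorphism_cont1[OF homeomorphism_chart] homeomorphism_cont2[OF homeomorphism_chart])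

lemma chart_inv_coord: "c \<in> A \<Longrightarrow> p \<in> chart_dom c \<Longrightarrow> chart_inv c (coord c p) = p"
  by (rule homeomorphism_apply1[OF homeomorphism_chart])

lemma coord_chart_inv: "c \<in> A \<Longrightarrow> x \<in> chart_image c \<Longrightarrow> coord c (chart_inv c x) = x"
  by (rule homeomorphism_apply2[OF homeomorphism_chart])

lemma coord_in_image: "p \<in> chart_dom c \<Longrightarrow> coord c p \<in> chart_image c"
  unfolding chart_image_def by blast

lemma chart_inv_in_dom: "c \<in> A \<Longrightarrow> x \<in> chart_image c \<Longrightarrow> chart_inv c x \<in> chart_dom c"
  unfolding chart_inv_def chart_image_def by (rule inv_into_into)

lemma overlap_eq:
  assumes "c \<in> A"
  shows "overlap c d = {x \<in> chart_image c. chart_inv c x \<in> chart_dom d}"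
proof (intro equalityI subsetI)
  fix x assume "x \<in> overlap c d"
  then obtain p where "x = coord c p" "p \<in> chart_dom c" "p \<in> chart_dom d" by (auto simp: overlap_def)
  then show "x \<in> {x \<in> chart_image c. chart_inv c x \<in> chart_dom d}"
    using chart_inv_coord[OF assms] coord_in_image by simp
next
  fix x assume x: "x \<in> {x \<in> chart_image c. chart_inv c x \<in> chart_dom d}"
  then have "x = coord c (chart_inv c x)" "chart_inv c x \<in> chart_dom c \<inter> chart_dom d"
    using coord_chart_inv[OF assms] chart_inv_in_dom[OF assms] by simp_all
  then show "x \<in> overlap c d" unfolding overlap_def by (rule image_eqI)
qed

lemma coord_in_overlap: "p \<in> chart_dom c \<Longrightarrow> p \<in> chart_dom d \<Longrightarrow> coord c p \<in> overlap c d"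
  unfolding overlap_def by blast

lemma open_overlap:
  assumes "c \<in> A" "d \<in> A"
  shows "open (overlap c d)"
proof -
  have "open (chart_image c \<inter> chart_inv c -` chart_dom d)"
    by (rule continuous_open_preimage[OF continuous_chart_inv[OF assms(1)] open_chart_image[OF assms(1)]
          open_chart_dom[OF assms(2)]])
  also have "chart_image c \<inter> chart_inv c -` chart_dom d = overlap c d"
    using overlap_eq[OF assms(1)] by blast
  finally show ?thesis .
qed

lemma transition_coord: "c \<in> A \<Longrightarrow> p \<in> chart_dom c \<Longrightarrow> transition c d (coord c p) = coord d p"
  by (simp add: transition_def chart_inv_coord)

lemma overlapE:
  assumes "x \<in> overlap c d"
  obtains p where "x = coord c p" "p \<in> chart_dom c" "p \<in> chart_dom d"
  using assms unfolding overlap_def by blast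

lemma transition_in_overlap:
  assumes "c \<in> A" "x \<in> overlap c d"
  shows "transition c d x \<in> overlap d c"
  using assms(2) by (rule overlapE) (simp add: transition_coord[OF assms(1)] coord_in_overlap)

lemma transition_inverse:
  assumes "c \<in> A" "d \<in> A" "x \<in> overlap c d"
  shows "transition d c (transition c d x) = x"
  using assms(3) by (rule overlapE) (simp add: transition_coord assms(1,2))

lemma smooth_transition: "c \<in> A \<Longrightarrow> d \<in> A \<Longrightarrow> smooth_on (overlap c d) (transition c d)"
  using compatible unfolding smoothly_compatible_def by blast

lemma has_derivative_transition:
  "c \<in> A \<Longrightarrow> d \<in> A \<Longrightarrow> x \<in> overlap c d \<Longrightarrow> (transition c d has_derivative jacobian c d x) (at x)"
  unfolding jacobian_def by (rule smooth_on_has_derivative[OF smooth_transition])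

lemma linear_jacobian: "c \<in> A \<Longrightarrow> d \<in> A \<Longrightarrow> x \<in> overlap c d \<Longrightarrow> linear (jacobian c d x)"
  by (rule has_derivative_linear[OF has_derivative_transition])

lemma jacobian_inverse:
  assumes "c \<in> A" "d \<in> A" "x \<in> overlap c d"
  shows "jacobian d c (transition c d x) (jacobian c d x v) = v"
proof -
  have "((\<lambda>x. transition d c (transition c d x)) has_derivative
      (\<lambda>v. jacobian d c (transition c d x) (jacobian c d x v))) (at x)"
    by (rule has_derivative_compose[OF has_derivative_transition[OF assms]
          has_derivative_transition[OF assms(2,1) transition_in_overlap[OF assms(1,3)]]])
  then have "((\<lambda>x. x) has_derivative (\<lambda>v. jacobian d c (transition c d x) (jacobian c d x v))) (at x)"
    by (rule has_derivative_transform_within_open[OF _ open_overlap[OF assms(1,2)] assms(3)])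
      (rule transition_inverse[OF assms(1,2)])
  then have "(\<lambda>v. jacobian d c (transition c d x) (jacobian c d x v)) = (\<lambda>v. v)"
    by (rule has_derivative_unique[OF _ has_derivative_ident])
  then show ?thesis by metis
qed

lemma inj_jacobian:
  assumes "c \<in> A" "d \<in> A" "x \<in> overlap c d"
  shows "inj (jacobian c d x)"
  by (rule inj_on_inverseI[where g = "jacobian d c (transition c d x)"]) (rule jacobian_inverse[OF assms])

text \<open>Maximality admits the new chart once compatibility is checked, and its transitions are
  those of \<open>c\<close> composed with the given diffeomorphism or its inverse.\<close>

lemma recoordinatized_chart:
  assumes c: "c \<in> A" and S: "open S" "open V" "V \<subseteq> chart_image c" and hom: "homeomorphism S V \<phi> \<psi>"
    and sm: "smooth_on S \<phi>" "smooth_on V \<psi>"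
  defines "c' \<equiv> ({p \<in> chart_dom c. coord c p \<in> V}, \<psi> \<circ> coord c)"
  shows "c' \<in> A" "chart_image c' = S" "\<And>x. x \<in> S \<Longrightarrow> transition c' c x = \<phi> x"
proof -
  have hom': "continuous_on S \<phi>" "continuous_on V \<psi>" "\<phi> ` S = V" "\<psi> ` V = S"
    "\<And>x. x \<in> S \<Longrightarrow> \<psi> (\<phi> x) = x" "\<And>y. y \<in> V \<Longrightarrow> \<phi> (\<psi> y) = y"
    using homeomorphism_cont1[OF hom] homeomorphism_cont2[OF hom] homeomorphism_image1[OF hom]
      homeomorphism_image2[OF hom] homeomorphism_apply1[OF hom] homeomorphism_apply2[OF hom] by auto
  have \<phi>V: "\<phi> x \<in> V" if "x \<in> S" for x using hom'(3) that by blast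
  have \<psi>S: "\<psi> y \<in> S" if "y \<in> V" for y using hom'(4) that by blast
  have inV: "\<phi> x \<in> chart_image c" if "x \<in> S" for x using \<phi>V[OF that] S(3) by blast
  have dom: "chart_dom c' = {p \<in> chart_dom c. coord c p \<in> V}" and co: "coord c' p = \<psi> (coord c p)" for p
    by (simp_all add: c'_def)
  have inv_dom: "chart_inv c (\<phi> x) \<in> chart_dom c'" if "x \<in> S" for x
    using chart_inv_in_dom[OF c inV[OF that]] coord_chart_inv[OF c inV[OF that]] \<phi>V[OF that] by (simp add: dom)
  show img: "chart_image c' = S"
  proof (intro equalityI subsetI)
    fix x assume "x \<in> chart_image c'"
    then show "x \<in> S" using \<psi>S unfolding chart_image_def dom by (force simp: co)
  next
    fix x assume x: "x \<in> S"
    have "x = coord c' (chart_inv c (\<phi> x))"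
      using x by (simp add: co coord_chart_inv[OF c inV[OF x]] hom'(5))
    then show "x \<in> chart_image c'" unfolding chart_image_def using inv_dom[OF x] by blast
  qed
  have inj: "inj_on (coord c') (chart_dom c')"
  proof (rule inj_on_inverseI[where g = "\<lambda>x. chart_inv c (\<phi> x)"])
    show "chart_inv c (\<phi> (coord c' p)) = p" if "p \<in> chart_dom c'" for p
      using that by (simp add: dom co hom'(6) chart_inv_coord[OF c])
  qed
  \<comment> \<open>\<open>chart_inv\<close> is an inverse chosen on the domain, so its value for
    the new chart has to be identified by injectivity.\<close>
  have inv: "chart_inv c' x = chart_inv c (\<phi> x)" if "x \<in> S" for x
  proof -
    have "coord c' (chart_inv c (\<phi> x)) = x"
      using that by (simp add: co coord_chart_inv[OF c inV[OF that]] hom'(5))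
    then show ?thesis
      unfolding chart_inv_def[of c'] using inv_into_f_f[OF inj inv_dom[OF that]] by metis
  qed
  have tr: "transition c' d x = transition c d (\<phi> x)" if "x \<in> S" for d x
    using inv[OF that] by (simp add: transition_def)
  show "transition c' c x = \<phi> x" if "x \<in> S" for x
    using tr[OF that, of c] coord_chart_inv[OF c inV[OF that]] by (simp add: transition_def)
  have "open (chart_dom c \<inter> coord c -` V)"
    by (rule continuous_open_preimage[OF continuous_coord[OF c] open_chart_dom[OF c] S(2)])
  also have "chart_dom c \<inter> coord c -` V = chart_dom c'" using dom by blast
  finally have odom: "open (chart_dom c')" .
  have "is_chart M c'"
    unfolding is_chart_def homeomorphism_def
  proof (intro conjI ballI)
    show "chart_dom c' \<subseteq> M" using chart_dom_subset[OF c] dom by blast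
    show "open (chart_image c')" using S(1) img by simp
    have "continuous_on (chart_dom c') (coord c)"
      using continuous_on_subset[OF continuous_coord[OF c]] dom by blast
    then show "continuous_on (chart_dom c') (coord c')"
      unfolding c'_def snd_conv o_def
      by (rule continuous_on_compose2[OF hom'(2)]) (auto simp: dom)
    have "continuous_on S (\<lambda>x. chart_inv c (\<phi> x))"
      by (rule continuous_on_compose2[OF continuous_chart_inv[OF c] hom'(1)]) (use inV in blast)
    then have "continuous_on S (chart_inv c')" by (rule continuous_on_eq) (simp add: inv)
    then show "continuous_on (chart_image c') (chart_inv c')" by (simp add: img)
    show "chart_inv c' (coord c' p) = p" if "p \<in> chart_dom c'" for p
      unfolding chart_inv_def by (rule inv_into_f_f[OF inj that])
    show "coord c' (chart_inv c' x) = x" if "x \<in> chart_image c'" for x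
      using that unfolding chart_inv_def chart_image_def by (rule f_inv_into_f)
    show "chart_inv c' ` chart_image c' = chart_dom c'"
      unfolding chart_inv_def chart_image_def using inj by (rule inv_into_image_cancel) simp
  qed (use odom in \<open>simp_all add: chart_image_def\<close>)
  moreover have "smoothly_compatible c' d" if d: "d \<in> A" for d
    unfolding smoothly_compatible_def
  proof
    have ov: "overlap c' d = S \<inter> \<phi> -` overlap c d"
    proof (intro equalityI subsetI)
      fix x assume "x \<in> overlap c' d"
      then obtain p where p: "x = coord c' p" "p \<in> chart_dom c'" "p \<in> chart_dom d"
        by (auto simp: overlap_def)
      then have "\<phi> x = coord c p" "x \<in> S" using hom'(6) \<psi>S by (simp_all add: dom co)
      then show "x \<in> S \<inter> \<phi> -` overlap c d" using p by (simp add: dom coord_in_overlap)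
    next
      fix x assume x: "x \<in> S \<inter> \<phi> -` overlap c d"
      then have "chart_inv c (\<phi> x) \<in> chart_dom d" using overlap_eq[OF c] by auto
      moreover have "x = coord c' (chart_inv c (\<phi> x))"
        using x by (simp add: co coord_chart_inv[OF c inV] hom'(5))
      ultimately show "x \<in> overlap c' d" unfolding overlap_def using inv_dom x by blast
    qed
    have oov: "open (overlap c' d)"
      unfolding ov by (rule continuous_open_preimage[OF hom'(1) S(1) open_overlap[OF c d]])
    have "smooth_on (overlap c' d) (\<lambda>x. transition c d (\<phi> x))"
      by (rule smooth_on_compose[OF oov open_overlap[OF c d] _ smooth_transition[OF c d]
            smooth_on_subset[OF sm(1)]]) (auto simp: ov)
    then show "smooth_on (overlap c' d) (transition c' d)"
      by (rule smooth_on_cong[OF oov, rotated]) (simp add: ov tr)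
    have ov': "overlap d c' = overlap d c \<inter> transition d c -` V"
    proof (intro equalityI subsetI)
      fix x assume "x \<in> overlap d c'"
      then obtain p where p: "x = coord d p" "p \<in> chart_dom c'" "p \<in> chart_dom d"
        by (auto simp: overlap_def)
      then show "x \<in> overlap d c \<inter> transition d c -` V"
        by (simp add: dom coord_in_overlap transition_coord[OF d])
    next
      fix x assume x: "x \<in> overlap d c \<inter> transition d c -` V"
      then obtain p where p: "x = coord d p" "p \<in> chart_dom c" "p \<in> chart_dom d"
        by (auto simp: overlap_def)
      then have "p \<in> chart_dom c'" using x by (simp add: dom transition_coord[OF d])
      then show "x \<in> overlap d c'" using p coord_in_overlap by simp
    qed
    have oov': "open (overlap d c')"
      unfolding ov' by (rule continuous_open_preimage[OF smooth_on_continuous[OF smooth_transition[OF d c]]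
            open_overlap[OF d c] S(2)])
    have "smooth_on (overlap d c') (\<lambda>x. \<psi> (transition d c x))"
      by (rule smooth_on_compose[OF oov' S(2) _ sm(2) smooth_on_subset[OF smooth_transition[OF d c]]])
        (auto simp: ov')
    then show "smooth_on (overlap d c') (transition d c')"
      by (rule smooth_on_cong[OF oov', rotated]) (simp add: transition_def co)
  qed
  ultimately show "c' \<in> A" by (intro maximal ballI)
qed

end

section \<open>Plaques\<close>

lemma join_component [simp]:
  "join s y $ 1 = s $ 1" "join s y $ 2 = s $ 2" "join s y $ 3 = y $ 1" "join s y $ 4 = y $ 2"
  unfolding join_def vector_def by simp_all

lemma transverse_component [simp]: "transverse x $ 1 = x $ 3" "transverse x $ 2 = x $ 4"
  by (simp_all add: transverse_def)

lemma transverse_join [simp]: "transverse (join s y) = y"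
  by (simp add: vec_eq_iff forall_2)

lemma join_eq_iff [simp]: "join s y = join s' y' \<longleftrightarrow> s = s' \<and> y = y'"
  by (auto simp: vec_eq_iff forall_2 forall_4)

lemma join_split: "join s y = join s 0 + join 0 y"
  by (simp add: vec_eq_iff forall_4)

lemma join_surj: "\<exists>s. x = join s (transverse x)"
  by (rule exI[of _ "vector [x $ 1, x $ 2]"]) (simp add: vec_eq_iff forall_4)

lemma linear_join: "linear (\<lambda>b. join b 0)"
  by (simp add: linear_iff vec_eq_iff forall_4)

lemma linear_transverse: "linear transverse"
  by (simp add: linear_iff vec_eq_iff forall_2)

lemma has_derivative_join: "((\<lambda>s. join s y) has_derivative (\<lambda>b. join b 0)) (at s)"
proof -
  have "((\<lambda>s. join s 0 + join 0 y) has_derivative (\<lambda>b. join b 0 + 0)) (at s)"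
    by (intro has_derivative_add has_derivative_const bounded_linear_imp_has_derivative
        linear_conv_bounded_linear[THEN iffD1, OF linear_join])
  then show ?thesis by (simp add: join_split[of _ y, symmetric])
qed

lemma smooth_on_join:
  assumes "open W"
  shows "smooth_on W (\<lambda>s. join s y)"
proof -
  have "smooth_on W (\<lambda>s. join s 0 + join 0 y)"
    by (intro smooth_on_add smooth_on_const smooth_on_ident assms
        smooth_on_linear[OF _ linear_conv_bounded_linear[THEN iffD1, OF linear_join]])
  then show ?thesis by (simp add: join_split[of _ y, symmetric])
qed

text \<open>The tangent plane of every plaque, seen in its own foliated chart.\<close>

definition leaf_direction :: "(real^4) set" where
  "leaf_direction = range (\<lambda>b. join b 0)"

lemma leaf_direction_iff: "v \<in> leaf_direction \<longleftrightarrow> transverse v = 0"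
  unfolding leaf_direction_def using join_surj[of v] by auto

lemma subspace_leaf_direction: "subspace leaf_direction"
  unfolding leaf_direction_def by (intro linear_subspace_image linear_join subspace_UNIV)

lemma dim_leaf_direction: "dim leaf_direction = 2"
  unfolding leaf_direction_def
  by (subst dim_image_eq[OF linear_join]) (auto simp: inj_on_def)

context smooth_atlas
begin

lemma plaque_map_in_dom: "c \<in> A \<Longrightarrow> s \<in> plaque_dom c y \<Longrightarrow> plaque_map c y s \<in> chart_dom c"
  by (simp add: plaque_dom_def plaque_map_def chart_inv_in_dom)

lemma coord_plaque_map: "c \<in> A \<Longrightarrow> s \<in> plaque_dom c y \<Longrightarrow> coord c (plaque_map c y s) = join s y"
  by (simp add: plaque_dom_def plaque_map_def coord_chart_inv)

lemma plaque_map_in_plaque: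
  assumes "c \<in> A" "s \<in> plaque_dom c y"
  shows "plaque_map c y s \<in> plaque c y"
  using plaque_map_in_dom[OF assms] coord_plaque_map[OF assms] by (simp add: plaque_def)

lemma plaque_map_surj:
  assumes "c \<in> A" "p \<in> plaque c y"
  shows "\<exists>s\<in>plaque_dom c y. plaque_map c y s = p"
proof -
  have p: "p \<in> chart_dom c" "transverse (coord c p) = y" using assms(2) by (auto simp: plaque_def)
  obtain s where s: "coord c p = join s y" using join_surj[of "coord c p"] p(2) by blast
  have "s \<in> plaque_dom c y" using coord_in_image[OF p(1)] s by (simp add: plaque_dom_def)
  moreover have "plaque_map c y s = p" using chart_inv_coord[OF assms(1) p(1)] s by (simp add: plaque_map_def)
  ultimately show ?thesis by blast
qed

lemma coord_comp_plaque_map: "coord d \<circ> plaque_map c y = (\<lambda>s. transition c d (join s y))"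
  by (simp add: fun_eq_iff plaque_map_def transition_def)

text \<open>Derivatives of a plaque of \<open>c\<close> in the coordinates of \<open>d\<close> are
  taken on this set, which is open in the parameter plane.\<close>

definition plaque_overlap :: "'a chart \<Rightarrow> real^2 \<Rightarrow> 'a chart \<Rightarrow> (real^2) set" where
  "plaque_overlap c y d = {s. join s y \<in> overlap c d}"

lemma plaque_overlap_iff:
  "c \<in> A \<Longrightarrow> s \<in> plaque_overlap c y d \<longleftrightarrow> s \<in> plaque_dom c y \<and> plaque_map c y s \<in> chart_dom d"
  by (simp add: plaque_overlap_def plaque_dom_def plaque_map_def overlap_eq)

lemma open_plaque_overlap:
  assumes "c \<in> A" "d \<in> A"
  shows "open (plaque_overlap c y d)"
proof -
  have "continuous_on UNIV (\<lambda>s. join s y)"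
    using smooth_on_continuous[OF smooth_on_join[OF open_UNIV]] .
  then have "open ((\<lambda>s. join s y) -` overlap c d)"
    using open_overlap[OF assms] by (simp add: open_vimage)
  then show ?thesis by (simp add: plaque_overlap_def vimage_def)
qed

lemma smooth_on_plaque_map:
  assumes "c \<in> A" "d \<in> A"
  shows "smooth_on (plaque_overlap c y d) (coord d \<circ> plaque_map c y)"
  unfolding coord_comp_plaque_map
  by (rule smooth_on_compose[OF open_plaque_overlap[OF assms] open_overlap[OF assms] _
        smooth_transition[OF assms] smooth_on_join[OF open_plaque_overlap[OF assms]]])
    (auto simp: plaque_overlap_def)

lemma frechet_derivative_plaque_map:
  assumes "c \<in> A" "d \<in> A" "s \<in> plaque_overlap c y d"
  shows "frechet_derivative (coord d \<circ> plaque_map c y) (at s) = (\<lambda>b. jacobian c d (join s y) (join b 0))"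
proof (rule frechet_derivative_at[symmetric])
  show "(coord d \<circ> plaque_map c y has_derivative (\<lambda>b. jacobian c d (join s y) (join b 0))) (at s)"
    unfolding coord_comp_plaque_map
    by (rule has_derivative_compose[where f = "\<lambda>s. join s y" and g = "transition c d",
          OF has_derivative_join has_derivative_transition[OF assms(1,2)]])
      (use assms(3) in \<open>simp add: plaque_overlap_def\<close>)
qed

lemma tangent_plane_plaque:
  assumes "c \<in> A" "d \<in> A" "s \<in> plaque_overlap c y d"
  shows "tangent_plane d (plaque_map c y) s = jacobian c d (join s y) ` leaf_direction"
  unfolding tangent_plane_def frechet_derivative_plaque_map[OF assms] leaf_direction_def
  by (simp add: image_image)

lemma tangent_plane_plaque_dim:
  assumes "c \<in> A" "d \<in> A" "s \<in> plaque_overlap c y d"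
  shows "subspace (tangent_plane d (plaque_map c y) s)" "dim (tangent_plane d (plaque_map c y) s) = 2"
proof -
  have x: "join s y \<in> overlap c d" using assms(3) by (simp add: plaque_overlap_def)
  note lin = linear_jacobian[OF assms(1,2) x]
  show "subspace (tangent_plane d (plaque_map c y) s)"
    unfolding tangent_plane_plaque[OF assms] by (rule linear_subspace_image[OF lin subspace_leaf_direction])
  show "dim (tangent_plane d (plaque_map c y) s) = 2"
    unfolding tangent_plane_plaque[OF assms]
    by (subst dim_image_eq[OF lin])
      (auto simp: dim_leaf_direction intro: inj_on_subset[OF inj_jacobian[OF assms(1,2) x]])
qed

subsection \<open>Leaves\<close>

text \<open>A leaf is the image of a point under a transitive closure, so one more step inside a
  plaque stays in it.\<close>

lemma leaf_closed_plaque: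
  assumes "L \<in> leaves M F" "p \<in> L" "c \<in> F" "p \<in> plaque c y"
  shows "plaque c y \<subseteq> L"
proof
  fix q assume "q \<in> plaque c y"
  then have pq: "(p, q) \<in> same_plaque F" using assms by (auto simp: same_plaque_def)
  obtain x where L: "L = (same_plaque F)\<^sup>+ `` {x}" using assms(1) unfolding leaves_def by (rule quotientE)
  then have "(x, p) \<in> (same_plaque F)\<^sup>+" using assms(2) by simp
  then show "q \<in> L" unfolding L using pq by (simp add: trancl_into_trancl)
qed

text \<open>Every point shares a plaque with itself, which supplies the first step that the
  transitive closure demands.\<close>

lemma leaf_through:
  assumes "foliation M A F" "p \<in> M"
  obtains L c where "L \<in> leaves M F" "p \<in> L" "c \<in> F" "c \<in> A" "p \<in> chart_dom c"
proof -
  obtain c where c: "c \<in> F" "p \<in> chart_dom c" using assms unfolding foliation_def by blast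
  have "(p, p) \<in> same_plaque F" using c by (auto simp: same_plaque_def plaque_def)
  then have "p \<in> (same_plaque F)\<^sup>+ `` {p}" by blast
  moreover have "(same_plaque F)\<^sup>+ `` {p} \<in> leaves M F" unfolding leaves_def by (rule quotientI[OF assms(2)])
  ultimately show ?thesis using that c assms(1) unfolding foliation_def by blast
qed

lemma leaf_patch_through:
  assumes "F \<subseteq> A" "L \<in> leaves M F" "p \<in> L" "c \<in> F" "p \<in> chart_dom c"
  obtains y s where "(plaque_dom c y, plaque_map c y) \<in> leaf_patches F L" "s \<in> plaque_dom c y" "plaque_map c y s = p"
proof -
  define y where "y = transverse (coord c p)"
  have p: "p \<in> plaque c y" using assms(5) by (simp add: plaque_def y_def)
  obtain s where "s \<in> plaque_dom c y" "plaque_map c y s = p" using plaque_map_surj[OF _ p] assms(1,4) by blast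
  moreover have "(plaque_dom c y, plaque_map c y) \<in> leaf_patches F L"
    unfolding leaf_patches_def using assms(4) leaf_closed_plaque[OF assms(2,3,4) p] by blast
  ultimately show ?thesis using that by blast
qed

lemma leaf_covered:
  assumes "foliation M A F" "L \<in> leaves M F" "p \<in> L"
  shows "\<exists>c\<in>F. p \<in> chart_dom c"
proof -
  obtain x where "L = (same_plaque F)\<^sup>+ `` {x}" using assms(2) unfolding leaves_def by (rule quotientE)
  then have "(x, p) \<in> (same_plaque F)\<^sup>+" using assms(3) by simp
  then obtain x' where "(x', p) \<in> same_plaque F" by (meson tranclD2)
  then show ?thesis by (auto simp: same_plaque_def plaque_def)
qed

end

section \<open>Isometric almost paracomplex structures\<close>

locale paracomplex_manifold = smooth_atlas M A
  for M :: "'a::{t2_space,second_countable_topology} set" and A :: "'a chart set" +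
  fixes g :: "'a form_field" and \<Gamma> :: "'a connection" and j :: "'a endo_field"
  assumes metric: "pseudo_riemannian_metric A g"
    and levi_civita: "levi_civita A g \<Gamma>"
    and paracomplex: "almost_paracomplex A j"
    and isometric: "isometric A g j"
begin

lemma smooth_endo: "smooth_endo_field A j"
  using paracomplex[unfolded almost_paracomplex_def, THEN conjunct1] .

lemma linear_j: "c \<in> A \<Longrightarrow> x \<in> chart_image c \<Longrightarrow> linear (j c x)"
  and smooth_j: "c \<in> A \<Longrightarrow> smooth_on (chart_image c) (\<lambda>x. j c x v)"
  using smooth_endo[unfolded smooth_endo_field_def, THEN conjunct1] by blast+

lemma j_jacobian:
  "c \<in> A \<Longrightarrow> d \<in> A \<Longrightarrow> x \<in> overlap c d \<Longrightarrow>
    jacobian c d x (j c x v) = j d (transition c d x) (jacobian c d x v)"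
  using smooth_endo[unfolded smooth_endo_field_def, THEN conjunct2] by blast

lemma j_involutive:
  assumes "c \<in> A" "x \<in> chart_image c"
  shows "j c x (j c x v) = v"
proof -
  have "j c (coord c (chart_inv c x)) \<circ> j c (coord c (chart_inv c x)) = id"
    using paracomplex[unfolded almost_paracomplex_def, THEN conjunct2] chart_inv_in_dom[OF assms] assms(1) by blast
  then show ?thesis using coord_chart_inv[OF assms] by (simp add: fun_eq_iff)
qed

lemma dim_eigenplane:
  assumes "c \<in> A" "p \<in> chart_dom c"
  shows "dim (eigenplane j 1 c p) = 2" "dim (eigenplane j (-1) c p) = 2"
  using paracomplex[unfolded almost_paracomplex_def, THEN conjunct2] assms by blast+

lemma eigenplane_iff: "v \<in> eigenplane j 1 c p \<longleftrightarrow> j c (coord c p) v = v"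
  "v \<in> eigenplane j (-1) c p \<longleftrightarrow> j c (coord c p) v = - v"
  by (simp_all add: eigenplane_def)

lemma subspace_eigenplane: "c \<in> A \<Longrightarrow> p \<in> chart_dom c \<Longrightarrow> subspace (eigenplane j \<epsilon> c p)"
  using linear_j[of c "coord c p", OF _ coord_in_image]
  by (auto simp: subspace_def eigenplane_def linear_0 linear_add linear_scale scaleR_add_right)

text \<open>The transformation law of \<open>j\<close> carries eigenvectors to eigenvectors; since
  Jacobians are injective and both planes have dimension 2, the inclusion is an equality.\<close>

lemma jacobian_eigenplane:
  assumes "c \<in> A" "d \<in> A" "p \<in> chart_dom c" "p \<in> chart_dom d"
  shows "jacobian c d (coord c p) ` eigenplane j 1 c p = eigenplane j 1 d p"
proof -
  have x: "coord c p \<in> overlap c d" by (rule coord_in_overlap[OF assms(3,4)])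
  show ?thesis
  proof (rule subspace_dim_equal)
    show "subspace (jacobian c d (coord c p) ` eigenplane j 1 c p)"
      by (rule linear_subspace_image[OF linear_jacobian[OF assms(1,2) x] subspace_eigenplane[OF assms(1,3)]])
    show "subspace (eigenplane j 1 d p)" by (rule subspace_eigenplane[OF assms(2,4)])
    show "jacobian c d (coord c p) ` eigenplane j 1 c p \<subseteq> eigenplane j 1 d p"
    proof (rule image_subsetI)
      fix v assume "v \<in> eigenplane j 1 c p"
      then show "jacobian c d (coord c p) v \<in> eigenplane j 1 d p"
        using j_jacobian[OF assms(1,2) x, of v] by (simp add: eigenplane_iff transition_coord[OF assms(1,3)])
    qed
    have "dim (jacobian c d (coord c p) ` eigenplane j 1 c p) = dim (eigenplane j 1 c p)"
      by (rule dim_image_eq[OF linear_jacobian[OF assms(1,2) x] inj_on_subset[OF inj_jacobian[OF assms(1,2) x]]]) simp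
    then show "dim (eigenplane j 1 d p) \<le> dim (jacobian c d (coord c p) ` eigenplane j 1 c p)"
      by (simp add: dim_eigenplane assms)
  qed
qed

lemma connection: "affine_connection A \<Gamma>"
  using levi_civita[unfolded levi_civita_def, THEN conjunct1] .

lemma bilinear_\<Gamma>: "c \<in> A \<Longrightarrow> x \<in> chart_image c \<Longrightarrow> bilinear (\<Gamma> c x)"
  and smooth_\<Gamma>: "c \<in> A \<Longrightarrow> smooth_on (chart_image c) (\<lambda>x. \<Gamma> c x u v)"
  using connection[unfolded affine_connection_def, THEN conjunct1] by blast+

lemma \<Gamma>_sym: "c \<in> A \<Longrightarrow> x \<in> chart_image c \<Longrightarrow> \<Gamma> c x u v = \<Gamma> c x v u"
  using levi_civita[unfolded levi_civita_def, THEN conjunct2, THEN conjunct1] by blast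

lemma \<Gamma>_metric: "c \<in> A \<Longrightarrow> x \<in> chart_image c \<Longrightarrow>
    frechet_derivative (\<lambda>z. g c z v w) (at x) u = g c x (\<Gamma> c x u v) w + g c x v (\<Gamma> c x u w)"
  using levi_civita[unfolded levi_civita_def, THEN conjunct2, THEN conjunct2] by blast

lemma smooth_form: "smooth_form_field A g"
  using metric[unfolded pseudo_riemannian_metric_def, THEN conjunct1] .

lemma bilinear_g: "c \<in> A \<Longrightarrow> x \<in> chart_image c \<Longrightarrow> bilinear (g c x)"
  and smooth_g: "c \<in> A \<Longrightarrow> smooth_on (chart_image c) (\<lambda>x. g c x u v)"
  using smooth_form[unfolded smooth_form_field_def, THEN conjunct1] by blast+

lemma g_sym: "c \<in> A \<Longrightarrow> x \<in> chart_image c \<Longrightarrow> g c x u v = g c x v u"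
  and g_nondegenerate: "c \<in> A \<Longrightarrow> x \<in> chart_image c \<Longrightarrow> (\<And>v. g c x u v = 0) \<Longrightarrow> u = 0"
  using metric[unfolded pseudo_riemannian_metric_def, THEN conjunct2] by blast+

lemma g_j_j: "c \<in> A \<Longrightarrow> x \<in> chart_image c \<Longrightarrow> g c x (j c x u) (j c x v) = g c x u v"
  using isometric unfolding isometric_def by blast

text \<open>Apply the isometry property to \<open>u\<close> and \<open>j v\<close> and cancel the
  square of \<open>j\<close>.\<close>

lemma g_j_left: "c \<in> A \<Longrightarrow> x \<in> chart_image c \<Longrightarrow> g c x (j c x u) v = g c x u (j c x v)"
  using g_j_j[of c x u "j c x v"] by (simp add: j_involutive)

end

section \<open>The covariant derivative of an isometric involution\<close>

context paracomplex_manifold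
begin

lemma has_derivative_j_apply:
  assumes "c \<in> A" "x \<in> chart_image c" "(w has_derivative w') (at x)"
  shows "((\<lambda>z. j c z (w z)) has_derivative
    (\<lambda>h. frechet_derivative (\<lambda>z. j c z (w x)) (at x) h + j c x (w' h))) (at x)"
  by (rule has_derivative_linear_field_at[OF open_chart_image[OF assms(1)] assms(2) linear_j[OF assms(1)]
        smooth_on_differentiable[OF smooth_j[OF assms(1)] assms(2)] assms(3)])

lemma has_derivative_j:
  "c \<in> A \<Longrightarrow> x \<in> chart_image c \<Longrightarrow>
    ((\<lambda>z. j c z v) has_derivative frechet_derivative (\<lambda>z. j c z v) (at x)) (at x)"
  by (rule smooth_on_has_derivative[OF smooth_j])

lemma bilinear_nabla_endo:
  assumes "c \<in> A" "x \<in> chart_image c"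
  shows "bilinear (nabla_endo \<Gamma> j c x)"
proof -
  note [simp] = linear_add[OF linear_j[OF assms]] linear_scale[OF linear_j[OF assms]]
    bilinear_ladd[OF bilinear_\<Gamma>[OF assms]] bilinear_radd[OF bilinear_\<Gamma>[OF assms]]
    bilinear_lmul[OF bilinear_\<Gamma>[OF assms]] bilinear_rmul[OF bilinear_\<Gamma>[OF assms]]
  note D1 = has_derivative_linear[OF has_derivative_j[OF assms]]
  note D2 = linear_frechet_derivative_field[OF open_chart_image[OF assms(1)] assms(2) linear_j[OF assms(1)]
      smooth_on_differentiable[OF smooth_j[OF assms(1)] assms(2)]]
  show ?thesis
    unfolding bilinear_def
    by (intro conjI allI linearI)
      (simp_all add: nabla_endo_def linear_add[OF D1] linear_scale[OF D1] linear_add[OF D2] linear_scale[OF D2]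
         scaleR_add_right scaleR_diff_right)
qed

text \<open>Differentiate \<open>j (j v) = v\<close> for constant \<open>v\<close>; the connection
  terms match because \<open>j\<close> squares to the identity. It follows that the derivative of
  \<open>j\<close> exchanges the eigenplanes.\<close>

lemma nabla_endo_anticommute:
  assumes "c \<in> A" "x \<in> chart_image c"
  shows "j c x (nabla_endo \<Gamma> j c x u v) = - nabla_endo \<Gamma> j c x u (j c x v)"
proof -
  define D where "D v u = frechet_derivative (\<lambda>z. j c z v) (at x) u" for u v
  have "((\<lambda>z. j c z (j c z v)) has_derivative (\<lambda>h. D (j c x v) h + j c x (D v h))) (at x)"
    unfolding D_def by (rule has_derivative_j_apply[OF assms has_derivative_j[OF assms]])
  then have "((\<lambda>z. v) has_derivative (\<lambda>h. D (j c x v) h + j c x (D v h))) (at x)"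
    by (rule has_derivative_transform_within_open[OF _ open_chart_image[OF assms(1)] assms(2)])
      (rule j_involutive[OF assms(1)])
  then have "(\<lambda>h. D (j c x v) h + j c x (D v h)) = (\<lambda>h. 0)"
    by (rule has_derivative_unique[OF _ has_derivative_const])
  then have "D (j c x v) u + j c x (D v u) = 0" by metis
  then have "j c x (D v u) = - D (j c x v) u" by (simp add: eq_neg_iff_add_eq_0 add.commute)
  then show ?thesis
    unfolding nabla_endo_def D_def[symmetric]
    by (simp add: linear_add[OF linear_j[OF assms]] linear_diff[OF linear_j[OF assms]] j_involutive[OF assms])
qed

text \<open>Differentiate \<open>g (j v) w = g v (j w)\<close> for constant \<open>v\<close> and
  \<open>w\<close>. Metric compatibility replaces derivatives of \<open>g\<close> by connection
  terms, and these assemble into covariant derivatives of \<open>j\<close> on both sides.\<close>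

lemma nabla_endo_self_adjoint:
  assumes "c \<in> A" "x \<in> chart_image c"
  shows "g c x (nabla_endo \<Gamma> j c x u v) w = g c x v (nabla_endo \<Gamma> j c x u w)"
proof -
  define D where "D v u = frechet_derivative (\<lambda>z. j c z v) (at x) u" for u v
  define G where "G a b u = frechet_derivative (\<lambda>z. g c z a b) (at x) u" for a b u
  note lin_g = bilinear_g[OF assms(1), unfolded bilinear_def]
  have "((\<lambda>z. g c z (j c z v) w) has_derivative (\<lambda>h. G (j c x v) w h + g c x (D v h) w)) (at x)"
    unfolding G_def D_def
    by (rule has_derivative_linear_field_at[where A = "\<lambda>z a. g c z a w", OF open_chart_image[OF assms(1)] assms(2)
          _ smooth_on_differentiable[OF smooth_g[OF assms(1)] assms(2)] has_derivative_j[OF assms]])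
      (use lin_g in blast)
  then have "((\<lambda>z. g c z v (j c z w)) has_derivative (\<lambda>h. G (j c x v) w h + g c x (D v h) w)) (at x)"
    by (rule has_derivative_transform_within_open[OF _ open_chart_image[OF assms(1)] assms(2)])
      (rule g_j_left[OF assms(1)])
  moreover have "((\<lambda>z. g c z v (j c z w)) has_derivative (\<lambda>h. G v (j c x w) h + g c x v (D w h))) (at x)"
    unfolding G_def D_def
    by (rule has_derivative_linear_field_at[where A = "\<lambda>z a. g c z v a", OF open_chart_image[OF assms(1)] assms(2)
          _ smooth_on_differentiable[OF smooth_g[OF assms(1)] assms(2)] has_derivative_j[OF assms]])
      (use lin_g in blast)
  ultimately have "(\<lambda>h. G (j c x v) w h + g c x (D v h) w) = (\<lambda>h. G v (j c x w) h + g c x v (D w h))"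
    by (rule has_derivative_unique)
  then have "G (j c x v) w u + g c x (D v u) w = G v (j c x w) u + g c x v (D w u)" by metis
  then have *: "g c x (\<Gamma> c x u (j c x v)) w + g c x v (j c x (\<Gamma> c x u w)) + g c x (D v u) w =
      g c x (j c x (\<Gamma> c x u v)) w + g c x v (\<Gamma> c x u (j c x w)) + g c x v (D w u)"
    unfolding G_def \<Gamma>_metric[OF assms] by (simp add: g_j_left[OF assms])
  note gb = bilinear_g[OF assms]
  show ?thesis
    unfolding nabla_endo_def D_def[symmetric] bilinear_ladd[OF gb] bilinear_radd[OF gb] bilinear_lsub[OF gb]
      bilinear_rsub[OF gb]
    using * by linarith
qed

lemma eigenvectors_orthogonal:
  assumes "c \<in> A" "x \<in> chart_image c" "j c x u = u" "j c x v = - v"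
  shows "g c x u v = 0"
  using g_j_j[OF assms(1,2), of u v] bilinear_rneg[OF bilinear_g[OF assms(1,2)], of u v] assms(3,4) by simp

text \<open>The covariant derivative of \<open>j\<close> is self-adjoint and exchanges the two eigenplanes, which are
  orthogonal. Hence its mixed components are determined by the pure ones.\<close>

lemma nabla_endo_eq_0:
  assumes cx: "c \<in> A" "x \<in> chart_image c"
    and plus: "\<And>u v. j c x u = u \<Longrightarrow> j c x v = v \<Longrightarrow> nabla_endo \<Gamma> j c x u v = 0"
    and minus: "\<And>u v. j c x u = - u \<Longrightarrow> j c x v = - v \<Longrightarrow> nabla_endo \<Gamma> j c x u v = 0"
  shows "nabla_endo \<Gamma> j c x u v = 0"
proof -
  define N where "N = nabla_endo \<Gamma> j c x"
  define J where "J = j c x"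
  have linJ: "linear J" using linear_j[OF cx] by (simp add: J_def)
  have JJ: "J (J v) = v" for v using j_involutive[OF cx] by (simp add: J_def)
  have NJ: "J (N u v) = - N u (J v)" for u v using nabla_endo_anticommute[OF cx] by (simp add: N_def J_def)
  have gN: "g c x (N u v) w = g c x v (N u w)" for u v w
    using nabla_endo_self_adjoint[OF cx] by (simp add: N_def)
  have orth: "g c x u v = 0" if "J u = u" "J v = - v" for u v
    using eigenvectors_orthogonal[OF cx] that by (simp add: J_def)
  have orth': "g c x u v = 0" if "J u = - u" "J v = v" for u v
    using orth[OF that(2,1)] g_sym[OF cx, of u v] by simp
  note bN = bilinear_nabla_endo[OF cx, folded N_def]
  note bg = bilinear_g[OF cx]
  define pr mr where "pr v = (1/2) *\<^sub>R (v + J v)" and "mr v = (1/2) *\<^sub>R (v - J v)" for v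
  have split: "v = pr v + mr v" for v
    by (simp add: pr_def mr_def scaleR_add_right[symmetric] scaleR_2[symmetric])
  have Jpr: "J (pr v) = pr v" for v
    by (simp add: pr_def linear_scale[OF linJ] linear_add[OF linJ] JJ add.commute)
  have Jmr: "J (mr v) = - mr v" for v
    by (simp add: mr_def linear_scale[OF linJ] linear_diff[OF linJ] JJ scaleR_minus_right[symmetric] del: scaleR_minus_right)
  have pp: "N u v = 0" if "J u = u" "J v = v" for u v using plus that by (simp add: N_def J_def)
  have mm: "N u v = 0" if "J u = - u" "J v = - v" for u v using minus that by (simp add: N_def J_def)
  \<comment> \<open>Here \<open>N u v\<close> lies in the +1 eigenplane, hence is orthogonal to the
    -1 part of \<open>w\<close>. Against the +1 part, self-adjointness moves \<open>N u\<close> onto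
    that part, where a pure component appears and vanishes.\<close>
  have pm: "N u v = 0" if "J u = u" "J v = - v" for u v
  proof (rule g_nondegenerate[OF cx])
    fix w
    have "J (N u v) = N u v" using NJ[of u v] that bilinear_rneg[OF bN] by simp
    then have "g c x (N u v) (mr w) = 0" by (rule orth) (rule Jmr)
    moreover have "g c x (N u v) (pr w) = 0"
      unfolding gN pp[OF that(1) Jpr] by (rule bilinear_rzero[OF bg])
    ultimately show "g c x (N u v) w = 0"
      by (subst split) (simp add: bilinear_radd[OF bg])
  qed
  have mp: "N u v = 0" if "J u = - u" "J v = v" for u v
  proof (rule g_nondegenerate[OF cx])
    fix w
    have "J (N u v) = - N u v" using NJ[of u v] that by simp
    then have "g c x (N u v) (pr w) = 0" by (rule orth') (rule Jpr)
    moreover have "g c x (N u v) (mr w) = 0"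
      unfolding gN mm[OF that(1) Jmr] by (rule bilinear_rzero[OF bg])
    ultimately show "g c x (N u v) w = 0"
      by (subst split) (simp add: bilinear_radd[OF bg])
  qed
  have "N (pr u + mr u) (pr v + mr v) = 0"
    by (simp add: bilinear_radd[OF bN] bilinear_ladd[OF bN] pp mm pm mp Jpr Jmr)
  then show ?thesis unfolding split[symmetric] by (simp add: N_def)
qed

text \<open>Differentiation takes place along the surface, so the eigenfield equation is used on an
  open set of parameters. The connection terms match because \<open>j\<close> fixes the
  differentiated field.\<close>

lemma nabla_along_eigenfield:
  assumes W: "open W" "s \<in> W" and d: "d \<in> A" and dom: "\<And>t. t \<in> W \<Longrightarrow> f t \<in> chart_dom d"
    and sm: "smooth_on W (coord d \<circ> f)"
    and tan: "\<And>t b. t \<in> W \<Longrightarrow> j d (coord d (f t)) (frechet_derivative (coord d \<circ> f) (at t) b) =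
      frechet_derivative (coord d \<circ> f) (at t) b"
  shows "nabla_along \<Gamma> d f s a b - j d (coord d (f s)) (nabla_along \<Gamma> d f s a b) =
    nabla_endo \<Gamma> j d (coord d (f s)) (frechet_derivative (coord d \<circ> f) (at s) a)
      (frechet_derivative (coord d \<circ> f) (at s) b)"
proof -
  define F where "F = coord d \<circ> f"
  define G where "G = (\<lambda>t. frechet_derivative F (at t) b)"
  define D where "D v u = frechet_derivative (\<lambda>z. j d z v) (at (F s)) u" for u v
  have Fs: "F s \<in> chart_image d" using dom[OF W(2)] coord_in_image by (simp add: F_def)
  have derF: "(F has_derivative frechet_derivative F (at s)) (at s within W)"
    using smooth_on_has_derivative[OF sm W(2)] by (simp add: F_def has_derivative_at_withinI)
  have smG: "smooth_on W G" unfolding G_def F_def by (rule smooth_on_frechet_derivative[OF sm])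
  have derG: "(G has_derivative frechet_derivative G (at s)) (at s within W)"
    using smooth_on_has_derivative[OF smG W(2)] by (rule has_derivative_at_withinI)
  have "((\<lambda>t. j d (F t) (G t)) has_derivative
      (\<lambda>h. D (G s) (frechet_derivative F (at s) h) + j d (F s) (frechet_derivative G (at s) h))) (at s within W)"
    unfolding D_def
  proof (rule has_derivative_linear_field[OF open_chart_image[OF d] _ W(2) linear_j[OF d] _ derF derG])
    show "F ` W \<subseteq> chart_image d" 
      unfolding F_def o_def by (rule image_subsetI[OF coord_in_image[OF dom]])
    show "(\<lambda>x. j d x v) differentiable (at (F s))" for v
      by (rule smooth_on_differentiable[OF smooth_j[OF d] Fs])
  qed
  then have "(G has_derivative
      (\<lambda>h. D (G s) (frechet_derivative F (at s) h) + j d (F s) (frechet_derivative G (at s) h))) (at s within W)"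
    by (rule has_derivative_transform[OF W(2), rotated]) (simp add: G_def F_def tan)
  then have "(G has_derivative
      (\<lambda>h. D (G s) (frechet_derivative F (at s) h) + j d (F s) (frechet_derivative G (at s) h))) (at s)"
    by (simp only: at_within_open[OF W(2,1)])
  from fun_cong[OF frechet_derivative_at[OF this], of a]
  have eq: "frechet_derivative G (at s) a =
      D (G s) (frechet_derivative F (at s) a) + j d (F s) (frechet_derivative G (at s) a)"
    by (rule sym)
  have along: "nabla_along \<Gamma> d f s a b = frechet_derivative G (at s) a + \<Gamma> d (F s) (frechet_derivative F (at s) a) (G s)"
    by (simp add: nabla_along_def Let_def F_def G_def)
  have jG: "j d (F s) (G s) = G s" using tan[OF W(2), of b] by (simp add: G_def F_def)
  have "nabla_endo \<Gamma> j d (F s) (frechet_derivative F (at s) a) (G s) =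
      D (G s) (frechet_derivative F (at s) a) + \<Gamma> d (F s) (frechet_derivative F (at s) a) (G s)
      - j d (F s) (\<Gamma> d (F s) (frechet_derivative F (at s) a) (G s))"
    by (simp add: nabla_endo_def D_def jG)
  also have "\<dots> = nabla_along \<Gamma> d f s a b - j d (F s) (nabla_along \<Gamma> d f s a b)"
    unfolding along linear_add[OF linear_j[OF d Fs]] using eq by (simp add: algebra_simps)
  finally show ?thesis by (simp add: F_def G_def)
qed

end

context paracomplex_manifold
begin

section \<open>Foliations by totally geodesic leaves\<close>

lemma nabla_along_plaque:
  assumes c: "c \<in> A" and d: "d \<in> A" and s: "s \<in> plaque_overlap c y d"
    and sub: "\<And>t. t \<in> plaque_overlap c y d \<Longrightarrow>
      tangent_plane d (plaque_map c y) t \<subseteq> eigenplane j 1 d (plaque_map c y t)"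
  defines "f \<equiv> plaque_map c y"
  shows "nabla_along \<Gamma> d f s a b - j d (coord d (f s)) (nabla_along \<Gamma> d f s a b) =
    nabla_endo \<Gamma> j d (coord d (f s)) (frechet_derivative (coord d \<circ> f) (at s) a)
      (frechet_derivative (coord d \<circ> f) (at s) b)"
  unfolding f_def
proof (rule nabla_along_eigenfield[OF open_plaque_overlap[OF c d] s d _ smooth_on_plaque_map[OF c d]])
  fix t b assume t: "t \<in> plaque_overlap c y d"
  show "plaque_map c y t \<in> chart_dom d" using t by (simp add: plaque_overlap_iff[OF c])
  have "frechet_derivative (coord d \<circ> plaque_map c y) (at t) b \<in> eigenplane j 1 d (plaque_map c y t)"
    using sub[OF t] unfolding tangent_plane_def by blast
  then show "j d (coord d (plaque_map c y t)) (frechet_derivative (coord d \<circ> plaque_map c y) (at t) b) =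
      frechet_derivative (coord d \<circ> plaque_map c y) (at t) b"
    unfolding eigenplane_iff .
qed

text \<open>\<open>leaf_tangent\<close> is a union over all patches and all preimages of
  \<open>p\<close>. It is identified by showing that every member of the union is \<open>E\<close>
  and that at least one member exists.\<close>

lemma leaf_tangent_eqI:
  assumes F: "F \<subseteq> A" and L: "L \<in> leaves M F" "p \<in> L" and c: "c \<in> F" "p \<in> chart_dom c"
    and tan: "\<And>c y s. c \<in> F \<Longrightarrow> s \<in> plaque_dom c y \<Longrightarrow> plaque_map c y s = p \<Longrightarrow>
      tangent_plane d (plaque_map c y) s = E"
  shows "leaf_tangent F L d p = E"
proof (intro equalityI subsetI)
  fix v assume "v \<in> leaf_tangent F L d p"
  then obtain W f s where "(W, f) \<in> leaf_patches F L" "s \<in> W" "f s = p" "v \<in> tangent_plane d f s"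
    unfolding leaf_tangent_def by blast
  then show "v \<in> E" unfolding leaf_patches_def using tan by blast
next
  fix v assume v: "v \<in> E"
  obtain y s where ys: "(plaque_dom c y, plaque_map c y) \<in> leaf_patches F L" "s \<in> plaque_dom c y" "plaque_map c y s = p"
    by (rule leaf_patch_through[OF F L c])
  have "v \<in> tangent_plane d (plaque_map c y) s" using tan[OF c(1) ys(2,3)] v by simp
  then show "v \<in> leaf_tangent F L d p" unfolding leaf_tangent_def using ys by blast
qed

lemma tangent_plane_subset_leaf_tangent:
  assumes "(W, f) \<in> leaf_patches F L" "s \<in> W"
  shows "tangent_plane d f s \<subseteq> leaf_tangent F L d (f s)"
  unfolding leaf_tangent_def using assms by blast

lemma leaf_patch_subset:
  assumes "F \<subseteq> A" "(W, f) \<in> leaf_patches F L" "s \<in> W"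
  shows "f s \<in> L"
  using assms plaque_map_in_plaque unfolding leaf_patches_def by blast

lemma totally_geodesic_imp_nabla_endo_eq_0:
  assumes F: "foliation M A F" and tan: "tangent_to_foliation M A (eigenplane j 1) F"
    and geo: "\<forall>L\<in>leaves M F. totally_geodesic_leaf A \<Gamma> F L"
    and d: "d \<in> A" "x \<in> chart_image d" and u: "j d x u = u" and v: "j d x v = v"
  shows "nabla_endo \<Gamma> j d x u v = 0"
proof -
  have FA: "F \<subseteq> A" using F unfolding foliation_def by blast
  define p where "p = chart_inv d x"
  have p: "p \<in> chart_dom d" "coord d p = x" using chart_inv_in_dom[OF d] coord_chart_inv[OF d] by (simp_all add: p_def)
  have "p \<in> M" using p(1) chart_dom_subset[OF d(1)] by blast
  then obtain L c where L: "L \<in> leaves M F" "p \<in> L" and c: "c \<in> F" "c \<in> A" "p \<in> chart_dom c"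
    by (rule leaf_through[OF F])
  obtain y s where ys: "(plaque_dom c y, plaque_map c y) \<in> leaf_patches F L" "s \<in> plaque_dom c y" "plaque_map c y s = p"
    by (rule leaf_patch_through[OF FA L c(1,3)])
  define f where "f = plaque_map c y"
  have fs: "f s = p" using ys by (simp add: f_def)
  have sW: "s \<in> plaque_overlap c y d" using ys p by (simp add: plaque_overlap_iff[OF c(2)])
  \<comment> \<open>Tangency must hold along the whole plaque piece and not just at
    \<open>s\<close>, because the field is differentiated there.\<close>
  have sub: "tangent_plane d f t \<subseteq> eigenplane j 1 d (f t)" if "t \<in> plaque_overlap c y d" for t
  proof -
    have t: "t \<in> plaque_dom c y" "f t \<in> chart_dom d"
      using that by (simp_all add: f_def plaque_overlap_iff[OF c(2)])
    have "f t \<in> L" using leaf_patch_subset[OF FA ys(1) t(1)] by (simp add: f_def)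
    then have "eigenplane j 1 d (f t) = leaf_tangent F L d (f t)"
      using tan L(1) d(1) t(2) unfolding tangent_to_foliation_def by blast
    then show ?thesis using tangent_plane_subset_leaf_tangent[OF ys(1) t(1), of d] by (simp add: f_def)
  qed
  \<comment> \<open>Equal dimensions make the inclusion an equality, so the given eigenvectors are
    velocities of the plaque.\<close>
  have eq: "tangent_plane d f s = eigenplane j 1 d p"
  proof (rule subspace_dim_equal)
    show "subspace (tangent_plane d f s)"
      using tangent_plane_plaque_dim(1)[OF c(2) d(1)] sW by (simp add: f_def)
    show "subspace (eigenplane j 1 d p)" by (rule subspace_eigenplane[OF d(1) p(1)])
    show "tangent_plane d f s \<subseteq> eigenplane j 1 d p" using sub[OF sW] fs by simp
    show "dim (eigenplane j 1 d p) \<le> dim (tangent_plane d f s)"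
      using tangent_plane_plaque_dim(2)[OF c(2) d(1)] sW dim_eigenplane(1)[OF d(1) p(1)]
      by (simp add: f_def)
  qed
  have "u \<in> tangent_plane d f s" "v \<in> tangent_plane d f s"
    using u v p(2) unfolding eq eigenplane_iff by simp_all
  then obtain a b where ab: "u = frechet_derivative (coord d \<circ> f) (at s) a" "v = frechet_derivative (coord d \<circ> f) (at s) b"
    unfolding tangent_plane_def by blast
  have "nabla_along \<Gamma> d f s a b \<in> tangent_plane d f s"
  proof -
    have "totally_geodesic_patch A \<Gamma> (plaque_dom c y) f"
      using geo L(1) ys(1) unfolding totally_geodesic_leaf_def f_def by blast
    then show ?thesis using ys(2) d(1) p(1) fs unfolding totally_geodesic_patch_def by blast
  qed
  then have "j d x (nabla_along \<Gamma> d f s a b) = nabla_along \<Gamma> d f s a b"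
    unfolding eq eigenplane_iff p(2) .
  moreover have "nabla_along \<Gamma> d f s a b - j d (coord d (f s)) (nabla_along \<Gamma> d f s a b) =
    nabla_endo \<Gamma> j d (coord d (f s)) u v"
    unfolding ab f_def by (rule nabla_along_plaque[OF c(2) d(1) sW sub[unfolded f_def]])
  ultimately show ?thesis by (simp add: fs p(2))
qed

text \<open>All charts that straighten the distribution are taken at once, so no atlas has to be
  chosen; any two of them turn out to be coherent. The box condition is the one that
  \<open>foliation\<close> imposes on its charts.\<close>

definition adapted_charts :: "'a chart set" where
  "adapted_charts = {c \<in> A. (\<exists>a b. chart_image c = box a b) \<and>
     (\<forall>p\<in>chart_dom c. eigenplane j 1 c p = leaf_direction)}"

lemma adapted_subset: "adapted_charts \<subseteq> A"
  unfolding adapted_charts_def by blast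

lemma tangent_plane_adapted:
  assumes "c \<in> adapted_charts" "d \<in> A" "s \<in> plaque_dom c y" "plaque_map c y s \<in> chart_dom d"
  shows "tangent_plane d (plaque_map c y) s = eigenplane j 1 d (plaque_map c y s)"
proof -
  have c: "c \<in> A" using assms(1) adapted_subset by blast
  have s: "s \<in> plaque_overlap c y d" using assms(3,4) by (simp add: plaque_overlap_iff[OF c])
  have p: "plaque_map c y s \<in> chart_dom c" by (rule plaque_map_in_dom[OF c assms(3)])
  have "eigenplane j 1 c (plaque_map c y s) = leaf_direction"
    using assms(1) p unfolding adapted_charts_def by blast
  then show ?thesis
    using tangent_plane_plaque[OF c assms(2) s] jacobian_eigenplane[OF c assms(2) p assms(4)]
    by (simp add: coord_plaque_map[OF c assms(3)])
qed

lemma tangent_to_adapted: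
  "tangent_to_foliation M A (eigenplane j 1) adapted_charts" if F: "foliation M A adapted_charts"
  unfolding tangent_to_foliation_def
proof (intro ballI)
  fix L d p assume L: "L \<in> leaves M adapted_charts" and d: "d \<in> A" and p: "p \<in> L \<inter> chart_dom d"
  obtain c where c: "c \<in> adapted_charts" "p \<in> chart_dom c" using leaf_covered[OF F L] p by blast
  have "leaf_tangent adapted_charts L d p = eigenplane j 1 d p"
  proof (rule leaf_tangent_eqI[OF adapted_subset L _ c])
    show "tangent_plane d (plaque_map c y) s = eigenplane j 1 d p"
      if "c \<in> adapted_charts" "s \<in> plaque_dom c y" "plaque_map c y s = p" for c y s
      using tangent_plane_adapted[OF that(1) d that(2)] that(3) p by simp
  qed (use p in blast)
  then show "eigenplane j 1 d p = leaf_tangent adapted_charts L d p" by simp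
qed

text \<open>In a coordinate ball inside the overlap, two points with equal transverse coordinates
  are joined by a segment in a leaf direction. The Jacobian preserves leaf directions, which are the
  eigenplane in both charts, so the transverse coordinates of \<open>d\<close> have zero derivative
  along the segment.\<close>

lemma coherent_adapted:
  assumes c: "c \<in> adapted_charts" and d: "d \<in> adapted_charts"
  shows "coherent c d"
  unfolding coherent_def
proof
  fix p assume p: "p \<in> chart_dom c \<inter> chart_dom d"
  have cA: "c \<in> A" and dA: "d \<in> A" using c d adapted_subset by blast+
  have "coord c p \<in> overlap c d" using p by (simp add: coord_in_overlap)
  then obtain r where r: "r > 0" "ball (coord c p) r \<subseteq> overlap c d"
    using open_overlap[OF cA dA] openE by blast
  define B where "B = ball (coord c p) r"
  define N where "N = chart_dom c \<inter> coord c -` B"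
  have BN: "B \<subseteq> overlap c d" using r(2) by (simp add: B_def)
  have oN: "open N"
    unfolding N_def B_def
    by (rule continuous_open_preimage[OF continuous_coord[OF cA] open_chart_dom[OF cA] open_ball])
  have Nd: "q \<in> chart_dom d" if "q \<in> N" for q
  proof -
    have "coord c q \<in> overlap c d" using that BN by (auto simp: N_def)
    then show ?thesis using overlap_eq[OF cA] chart_inv_coord[OF cA] that by (simp add: N_def)
  qed
  have zero: "transverse (jacobian c d x h) = 0" if x: "x \<in> overlap c d" and h: "transverse h = 0" for x h
  proof -
    obtain q where q: "x = coord c q" "q \<in> chart_dom c" "q \<in> chart_dom d" using x by (rule overlapE)
    have "h \<in> eigenplane j 1 c q"
      using c q(2) h leaf_direction_iff[of h] unfolding adapted_charts_def by blast
    then have "jacobian c d x h \<in> eigenplane j 1 d q"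
      using jacobian_eigenplane[OF cA dA q(2,3)] unfolding q(1) by blast
    then have "jacobian c d x h \<in> leaf_direction" using d q(3) unfolding adapted_charts_def by blast
    then show ?thesis by (simp add: leaf_direction_iff)
  qed
  have const: "transverse (coord d q) = transverse (coord d q')"
    if q: "q \<in> N" "q' \<in> N" and eq: "transverse (coord c q) = transverse (coord c q')" for q q'
  proof -
    define h where "h = coord c q' - coord c q"
    have h: "transverse h = 0" by (simp add: h_def linear_diff[OF linear_transverse] eq)
    define \<gamma> where "\<gamma> t = coord c q + t *\<^sub>R h" for t :: real
    have \<gamma>B: "\<gamma> t \<in> B" if "t \<in> {0..1}" for t
    proof -
      have "(1 - t) *\<^sub>R coord c q + t *\<^sub>R coord c q' \<in> B"
        using convexD[OF convex_ball, of "coord c q" "coord c p" r "coord c q'" "1 - t" t] q that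
        by (simp add: B_def N_def)
      then show ?thesis by (simp add: \<gamma>_def h_def algebra_simps)
    qed
    have "\<exists>k. \<forall>t\<in>{0..1}. transverse (transition c d (\<gamma> t)) = k"
    proof (rule has_derivative_zero_constant)
      fix t :: real assume t: "t \<in> {0..1}"
      have x: "\<gamma> t \<in> overlap c d" using \<gamma>B[OF t] BN by blast
      have "(\<gamma> has_derivative (\<lambda>\<tau>. \<tau> *\<^sub>R h)) (at t within {0..1})"
        unfolding \<gamma>_def by (auto intro!: derivative_eq_intros)
      from has_derivative_compose[OF this has_derivative_transition[OF cA dA x]]
      have "((\<lambda>t. transverse (transition c d (\<gamma> t))) has_derivative
          (\<lambda>\<tau>. transverse (jacobian c d (\<gamma> t) (\<tau> *\<^sub>R h)))) (at t within {0..1})"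
        by (rule bounded_linear.has_derivative[OF linear_conv_bounded_linear[THEN iffD1, OF linear_transverse]])
      then show "((\<lambda>t. transverse (transition c d (\<gamma> t))) has_derivative (\<lambda>\<tau>. 0)) (at t within {0..1})"
        using zero[OF x] by (simp add: linear_scale[OF linear_transverse] h)
    qed simp
    then obtain k where k: "\<And>t. t \<in> {0..1} \<Longrightarrow> transverse (transition c d (\<gamma> t)) = k" by blast
    have "transverse (transition c d (\<gamma> 0)) = transverse (transition c d (\<gamma> 1))" using k[of 0] k[of 1] by simp
    moreover have "\<gamma> 0 = coord c q" "\<gamma> 1 = coord c q'" by (simp_all add: \<gamma>_def h_def)
    ultimately show ?thesis using q transition_coord[OF cA] by (simp add: N_def)
  qed
  have "p \<in> N" using p r(1) by (simp add: N_def B_def)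
  moreover have "N \<subseteq> chart_dom c \<inter> chart_dom d" using Nd by (auto simp: N_def)
  ultimately show "\<exists>N. open N \<and> p \<in> N \<and> N \<subseteq> chart_dom c \<inter> chart_dom d \<and>
      (\<forall>q\<in>N. \<forall>r\<in>N. transverse (coord c q) = transverse (coord c r) \<longrightarrow>
        transverse (coord d q) = transverse (coord d r))"
    using oN const by blast
qed

end

section \<open>Adapted charts around every point for a parallel structure\<close>

context paracomplex_manifold
begin

text \<open>The two eigenplanes meet only in 0 and both have dimension 2, so bases of them together
  form a frame; it is ordered so that the leaf coordinates go to the +1 eigenplane.\<close>

lemma eigenplane_frame:
  assumes "c \<in> A" "p \<in> chart_dom c"
  shows "\<exists>T :: real^4 \<Rightarrow> real^4. linear T \<and> bij T \<and> (\<forall>s. T (join s 0) \<in> eigenplane j 1 c p)"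
proof -
  note sub = subspace_eigenplane[OF assms]
  have d2: "dim (UNIV :: (real^2) set) = 2" by simp
  obtain h1 :: "real^2 \<Rightarrow> real^4" where h1: "linear h1" "h1 ` UNIV = eigenplane j 1 c p" "inj_on h1 UNIV"
    using subspace_isomorphism[OF subspace_UNIV sub[of 1]] dim_eigenplane(1)[OF assms] d2 by metis
  obtain h2 :: "real^2 \<Rightarrow> real^4" where h2: "linear h2" "h2 ` UNIV = eigenplane j (-1) c p" "inj_on h2 UNIV"
    using subspace_isomorphism[OF subspace_UNIV sub[of "-1"]] dim_eigenplane(2)[OF assms] d2 by metis
  define hor :: "real^4 \<Rightarrow> real^2" where "hor v = vector [v $ 1, v $ 2]" for v
  have hor: "linear hor" by (simp add: linear_iff hor_def vec_eq_iff forall_2)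
  have v: "v = join (hor v) (transverse v)" for v
    by (simp add: hor_def vec_eq_iff forall_4)
  define T where "T v = h1 (hor v) + h2 (transverse v)" for v
  have T: "linear T"
    unfolding T_def
    using linear_compose_add[OF linear_compose[OF hor h1(1)] linear_compose[OF linear_transverse h2(1)]]
    by (simp add: o_def)
  have "inj T"
    unfolding linear_injective_0[OF T]
  proof (intro allI impI)
    fix v assume "T v = 0"
    then have eq: "h1 (hor v) = - h2 (transverse v)" by (simp add: T_def eq_neg_iff_add_eq_0)
    have "h1 (hor v) \<in> eigenplane j 1 c p" "h2 (transverse v) \<in> eigenplane j (-1) c p"
      using h1(2) h2(2) by blast+
    then have "j c (coord c p) (h1 (hor v)) = h1 (hor v)" "j c (coord c p) (h2 (transverse v)) = - h2 (transverse v)"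
      by (simp_all add: eigenplane_iff)
    \<comment> \<open>A vector in both eigenplanes equals its own negative.\<close>
    then have "h2 (transverse v) = - h2 (transverse v)"
      using linear_neg[OF linear_j[OF assms(1) coord_in_image[OF assms(2)]]] unfolding eq by simp
    then have "h2 (transverse v) = 0" by (simp add: eq_neg_iff_add_eq_0 scaleR_2[symmetric])
    moreover from this have "h1 (hor v) = 0" using eq by simp
    ultimately have "hor v = 0" "transverse v = 0"
      using h1(3) h2(3) linear_injective_0[OF h1(1)] linear_injective_0[OF h2(1)] by blast+
    then have "v = join 0 0" using v[of v] by simp
    then show "v = 0" using linear_0[OF linear_join] by simp
  qed
  then have "bij T" using linear_injective_imp_surjective[OF T] by (simp add: bij_def)
  moreover have "T (join s 0) \<in> eigenplane j 1 c p" for s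
  proof -
    have "T (join s 0) = h1 (hor (join s 0))" by (simp add: T_def linear_0[OF h2(1)])
    then show ?thesis using h1(2) by blast
  qed
  ultimately show ?thesis using T by blast
qed

text \<open>The flow straightens the distribution inside one coordinate image, and
  \<open>recoordinatized_chart\<close> turns the result into a chart of the atlas. Tangency gives
  one inclusion of planes; dimension gives the other.\<close>

lemma adapted_chart_exists:
  assumes par: "parallel A \<Gamma> j" and "p \<in> M"
  shows "\<exists>c\<in>adapted_charts. p \<in> chart_dom c"
proof -
  obtain c where c: "c \<in> A" "p \<in> chart_dom c" using covers assms(2) by blast
  define \<Omega> where "\<Omega> = chart_image c"
  define x0 where "x0 = coord c p"
  have \<Omega>: "open \<Omega>" "x0 \<in> \<Omega>" using open_chart_image[OF c(1)] coord_in_image[OF c(2)] by (simp_all add: \<Omega>_def x0_def)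
  obtain T where T: "linear T" "bij T" "\<And>s. T (join s 0) \<in> eigenplane j 1 c p"
    using eigenplane_frame[OF c] by blast
  define P where "P x v = (1/2) *\<^sub>R (v + j c x v)" for x v
  define \<pi> where "\<pi> v = join (vector [v $ 1, v $ 2]) 0" for v :: "real^4"
  have lin\<pi>: "linear \<pi>" by (simp add: linear_iff \<pi>_def vec_eq_iff forall_4)
  have Pid: "P x v = v \<longleftrightarrow> j c x v = v" for x v
  proof -
    have "P x v = v \<longleftrightarrow> 2 *\<^sub>R P x v = 2 *\<^sub>R v" by simp
    also have "2 *\<^sub>R P x v = v + j c x v" by (simp add: P_def)
    finally show ?thesis by (simp add: scaleR_2)
  qed
  have lj: "linear (j c x)" and jj: "j c x (j c x v) = v" if "x \<in> \<Omega>" for x v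
    using linear_j[OF c(1)] j_involutive[OF c(1)] that by (simp_all add: \<Omega>_def)
  obtain S V \<phi> \<psi> where SV: "open S" "0 \<in> S" "open V" "V \<subseteq> \<Omega>" "\<phi> 0 = x0" "homeomorphism S V \<phi> \<psi>"
    "smooth_on S \<phi>" "smooth_on V \<psi>"
    and tan: "\<And>z w. z \<in> S \<Longrightarrow> \<pi> w = w \<Longrightarrow> P (\<phi> z) (frechet_derivative \<phi> (at z) w) = frechet_derivative \<phi> (at z) w"
  proof (rule parallel_projection_chart[OF \<Omega>, of P "\<Gamma> c" T \<pi>])
    show "linear (P x)" if "x \<in> \<Omega>" for x
      by (simp add: linear_iff P_def linear_add[OF lj[OF that]] linear_scale[OF lj[OF that]] algebra_simps)
    show "smooth_on \<Omega> (\<lambda>x. P x v)" for v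
      unfolding P_def using smooth_j[OF c(1), of v] \<Omega>(1)
      by (intro smooth_on_linear[OF _ bounded_linear_scaleR_right] smooth_on_add smooth_on_const) (simp_all add: \<Omega>_def)
    show "P x (P x v) = P x v" if "x \<in> \<Omega>" for x v
      unfolding Pid by (simp add: P_def linear_add[OF lj[OF that]] linear_scale[OF lj[OF that]] jj[OF that] add.commute)
    \<comment> \<open>The identity part of \<open>P\<close> contributes the same connection term to
      both sides, so this is half of the equation for \<open>j\<close>.\<close>
    show "frechet_derivative (\<lambda>z. P z v) (at x) u + \<Gamma> c x u (P x v) = P x (\<Gamma> c x u v)" if x: "x \<in> \<Omega>" for x u v
    proof -
      note x' = x[unfolded \<Omega>_def]
      note b = bilinear_\<Gamma>[OF c(1) x']
      have "((\<lambda>z. P z v) has_derivative (\<lambda>u. (1/2) *\<^sub>R (0 + frechet_derivative (\<lambda>z. j c z v) (at x) u))) (at x)"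
        unfolding P_def
        by (intro has_derivative_scaleR_right has_derivative_add has_derivative_const has_derivative_j[OF c(1) x'])
      from fun_cong[OF frechet_derivative_at[OF this], of u]
      have "frechet_derivative (\<lambda>z. P z v) (at x) u = (1/2) *\<^sub>R frechet_derivative (\<lambda>z. j c z v) (at x) u" by simp
      moreover have "nabla_endo \<Gamma> j c x u v = 0" using par c(1) x' unfolding parallel_def by blast
      then have "frechet_derivative (\<lambda>z. j c z v) (at x) u = j c x (\<Gamma> c x u v) - \<Gamma> c x u (j c x v)"
        by (simp add: nabla_endo_def algebra_simps)
      ultimately show ?thesis
        by (simp add: P_def bilinear_rmul[OF b] bilinear_radd[OF b] scaleR_add_right scaleR_diff_right)
    qed
    show "P x0 (T (\<pi> w)) = T (\<pi> w)" for w
      unfolding Pid using T(3)[of "vector [w $ 1, w $ 2]"] by (simp add: \<pi>_def eigenplane_iff x0_def)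
  qed (use T(1,2) lin\<pi> bilinear_\<Gamma>[OF c(1)] \<Gamma>_sym[OF c(1)] smooth_\<Gamma>[OF c(1)] in \<open>simp_all add: \<Omega>_def\<close>)
  \<comment> \<open>Foliated charts must have box images, so the coordinate domain is shrunk to a
    box around 0.\<close>
  obtain a b where ab: "0 \<in> box a b" "box a b \<subseteq> S"
  proof -
    obtain e where "e > 0" "ball 0 e \<subseteq> S" using SV(1,2) by (rule openE)
    then show ?thesis using rational_boxes[of e "0 :: real^4"] that by blast
  qed
  define V' where "V' = \<phi> ` box a b"
  have hom: "homeomorphism (box a b) V' \<phi> \<psi>"
    unfolding V'_def by (rule homeomorphism_of_subsets[OF SV(6) ab(2) subset_refl refl])
  have V'V: "V' \<subseteq> V" using homeomorphism_image1[OF SV(6)] ab(2) by (auto simp: V'_def)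
  have oV': "open V'"
  proof -
    have "V' = V \<inter> \<psi> -` box a b"
      using V'V homeomorphism_apply1[OF SV(6)] homeomorphism_apply2[OF SV(6)] ab(2)
      by (force simp: V'_def)
    then show ?thesis
      using continuous_open_preimage[OF homeomorphism_cont2[OF SV(6)] SV(3) open_box] by simp
  qed
  have V'im: "V' \<subseteq> chart_image c" using V'V SV(4) by (auto simp: \<Omega>_def)
  define c' where "c' = ({p \<in> chart_dom c. coord c p \<in> V'}, \<psi> \<circ> coord c)"
  note c' = recoordinatized_chart[OF c(1) open_box oV' V'im hom smooth_on_subset[OF SV(7) ab(2)]
      smooth_on_subset[OF SV(8) V'V], folded c'_def]
  have "p \<in> chart_dom c'" using c(2) SV(5) ab(1) by (force simp: c'_def V'_def x0_def)
  moreover have "eigenplane j 1 c' q = leaf_direction" if q: "q \<in> chart_dom c'" for q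
  proof -
    define x where "x = coord c' q"
    have qc: "q \<in> chart_dom c" using q by (simp add: c'_def)
    have x: "x \<in> box a b" using coord_in_image[OF q] c'(2) by (simp add: x_def)
    have xo: "x \<in> overlap c' c" unfolding x_def by (rule coord_in_overlap[OF q qc])
    have \<phi>x: "\<phi> x = coord c q"
      using c'(3)[OF x] transition_coord[OF c'(1) q] by (simp add: x_def)
    have jac: "jacobian c' c x = frechet_derivative \<phi> (at x)"
      unfolding jacobian_def by (rule frechet_derivative_cong_open[OF open_box x c'(3)])
    have sub: "leaf_direction \<subseteq> eigenplane j 1 c' q"
    proof
      fix v assume "v \<in> leaf_direction"
      then have "\<pi> v = v" by (auto simp: leaf_direction_def \<pi>_def vec_eq_iff forall_4)
      then have "P (\<phi> x) (frechet_derivative \<phi> (at x) v) = frechet_derivative \<phi> (at x) v"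
        using tan x ab(2) by blast
      then have "jacobian c' c x v \<in> eigenplane j 1 c q" unfolding Pid jac eigenplane_iff \<phi>x .
      \<comment> \<open>The Jacobian maps the eigenplane of \<open>c'\<close> injectively onto that
        of \<open>c\<close>, so membership can be pulled back.\<close>
      then show "v \<in> eigenplane j 1 c' q"
        using jacobian_eigenplane[OF c'(1) c(1) q qc] inj_jacobian[OF c'(1) c(1) xo]
        unfolding x_def by (metis inj_image_mem_iff)
    qed
    then show ?thesis
      using subspace_dim_equal[OF subspace_leaf_direction subspace_eigenplane[OF c'(1) q] sub]
        dim_eigenplane(1)[OF c'(1) q] dim_leaf_direction by simp
  qed
  ultimately show ?thesis using c'(1,2) unfolding adapted_charts_def by blast
qed

lemma parallel_imp_foliation:
  assumes "parallel A \<Gamma> j"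
  shows "foliation M A adapted_charts"
  unfolding foliation_def
proof (intro conjI ballI)
  show "(\<Union>c\<in>adapted_charts. chart_dom c) = M"
    using adapted_chart_exists[OF assms] adapted_subset chart_dom_subset by blast
  show "\<exists>a b. chart_image c = box a b" if "c \<in> adapted_charts" for c
    using that unfolding adapted_charts_def by blast
qed (use adapted_subset coherent_adapted in blast)+

lemma parallel_imp_totally_geodesic:
  assumes par: "parallel A \<Gamma> j"
  shows "totally_geodesic_leaf A \<Gamma> adapted_charts L"
proof -
  have "nabla_along \<Gamma> d (plaque_map c y) s a b \<in> tangent_plane d (plaque_map c y) s"
    if c: "c \<in> adapted_charts" and s: "s \<in> plaque_dom c y" and d: "d \<in> A" "plaque_map c y s \<in> chart_dom d"
    for c y s d a b
  proof -
    have cA: "c \<in> A" using c adapted_subset by blast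
    define f where "f = plaque_map c y"
    have sW: "s \<in> plaque_overlap c y d" using s d by (simp add: plaque_overlap_iff[OF cA])
    have tan: "tangent_plane d f t = eigenplane j 1 d (f t)" if "t \<in> plaque_overlap c y d" for t
      using tangent_plane_adapted[OF c d(1)] that by (simp add: f_def plaque_overlap_iff[OF cA])
    have "nabla_along \<Gamma> d f s a b - j d (coord d (f s)) (nabla_along \<Gamma> d f s a b) =
        nabla_endo \<Gamma> j d (coord d (f s)) (frechet_derivative (coord d \<circ> f) (at s) a)
          (frechet_derivative (coord d \<circ> f) (at s) b)"
      unfolding f_def by (rule nabla_along_plaque[OF cA d(1) sW]) (use tan f_def in simp)
    also have "\<dots> = 0" using par d(1) coord_in_image[OF d(2)] unfolding parallel_def f_def by blast
    finally have "nabla_along \<Gamma> d f s a b \<in> eigenplane j 1 d (f s)" by (simp add: eigenplane_iff)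
    then show ?thesis using tan[OF sW] by (simp add: f_def)
  qed
  then show ?thesis
    unfolding totally_geodesic_leaf_def totally_geodesic_patch_def leaf_patches_def by blast
qed

text \<open>Eigenvectors of an isometry for the eigenvalues 1 and -1 are orthogonal, so tangency to
  the eigenplanes decides the matter.\<close>

lemma orthogonal_eigenfoliations:
  assumes "tangent_to_foliation M A (eigenplane j 1) F" "tangent_to_foliation M A (eigenplane j (-1)) G"
  shows "orthogonal_foliations M A g F G"
  unfolding orthogonal_foliations_def
proof (intro ballI)
  fix L K d p u v
  assume *: "L \<in> leaves M F" "K \<in> leaves M G" "d \<in> A" "p \<in> L \<inter> K \<inter> chart_dom d"
    "u \<in> leaf_tangent F L d p" "v \<in> leaf_tangent G K d p"
  then have "u \<in> eigenplane j 1 d p" "v \<in> eigenplane j (-1) d p"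
    using assms unfolding tangent_to_foliation_def by blast+
  then show "g d (coord d p) u v = 0"
    using * by (intro eigenvectors_orthogonal[OF _ coord_in_image]) (auto simp: eigenplane_iff)
qed

section \<open>Exchanging the two eigenplanes by a change of sign\<close>

abbreviation neg_j :: "'a endo_field" where
  "neg_j \<equiv> \<lambda>c x v. - j c x v"

lemma eigenplane_neg: "eigenplane neg_j 1 = eigenplane j (-1)" "eigenplane neg_j (-1) = eigenplane j 1"
  by (auto simp: eigenplane_def fun_eq_iff minus_equation_iff)

lemma nabla_endo_neg:
  assumes "c \<in> A" "x \<in> chart_image c"
  shows "nabla_endo \<Gamma> neg_j c x u v = - nabla_endo \<Gamma> j c x u v"
proof -
  have "((\<lambda>z. - j c z v) has_derivative (\<lambda>u. - frechet_derivative (\<lambda>z. j c z v) (at x) u)) (at x)"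
    by (rule has_derivative_minus[OF has_derivative_j[OF assms]])
  from fun_cong[OF frechet_derivative_at[OF this], of u] show ?thesis
    by (simp add: nabla_endo_def bilinear_rneg[OF bilinear_\<Gamma>[OF assms]])
qed

lemma parallel_neg: "parallel A \<Gamma> neg_j \<longleftrightarrow> parallel A \<Gamma> j"
  unfolding parallel_def using nabla_endo_neg by auto

lemma paracomplex_manifold_neg: "paracomplex_manifold M A g \<Gamma> neg_j"
proof unfold_locales
  show "almost_paracomplex A neg_j"
    unfolding almost_paracomplex_def
  proof (intro conjI ballI)
    show "smooth_endo_field A neg_j"
      unfolding smooth_endo_field_def
    proof (intro conjI ballI allI)
      show "linear (\<lambda>v. - j c x v)" if "c \<in> A" "x \<in> chart_image c" for c x
        by (rule linear_compose_neg[OF linear_j[OF that]])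
      show "smooth_on (chart_image c) (\<lambda>x. - j c x v)" if "c \<in> A" for c v
        by (rule smooth_on_linear[OF open_chart_image[OF that] bounded_linear_minus[OF bounded_linear_ident] smooth_j[OF that]])
      show "jacobian c d x (- j c x v) = - j d (transition c d x) (jacobian c d x v)"
        if "c \<in> A" "d \<in> A" "x \<in> overlap c d" for c d x v
        using j_jacobian[OF that] linear_neg[OF linear_jacobian[OF that]] by simp
    qed
    fix d p assume d: "d \<in> A" "p \<in> chart_dom d"
    note x = coord_in_image[OF d(2)]
    show "neg_j d (coord d p) \<circ> neg_j d (coord d p) = id"
      using j_involutive[OF d(1) x] linear_neg[OF linear_j[OF d(1) x]] by (simp add: fun_eq_iff)
    show "dim (eigenplane neg_j 1 d p) = 2" "dim (eigenplane neg_j (-1) d p) = 2"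
      unfolding eigenplane_neg by (rule dim_eigenplane[OF d])+
    \<comment> \<open>Otherwise the -1 eigenplane of \<open>j\<close> would be the whole space, of
      dimension 4.\<close>
    show "neg_j d (coord d p) \<noteq> id"
    proof
      assume "neg_j d (coord d p) = id"
      then have "- j d (coord d p) v = v" for v by (simp add: fun_eq_iff)
      then have "eigenplane j (-1) d p = UNIV"
        by (auto simp: eigenplane_def minus_equation_iff)
      then show False using dim_eigenplane(2)[OF d] by simp
    qed
  qed
  show "isometric A g neg_j"
    unfolding isometric_def
    using g_j_j bilinear_lneg[OF bilinear_g] bilinear_rneg[OF bilinear_g] by simp
qed (fact metric levi_civita)+

end

theorem theorem3:
  fixes M :: "'a::{t2_space,second_countable_topology} set"
    and A :: "'a chart set" and g :: "'a form_field"
    and \<Gamma> :: "'a connection" and j :: "'a endo_field"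
  assumes "smooth_4_manifold M A"
    and "pseudo_riemannian_metric A g"
    and "levi_civita A g \<Gamma>"
    and "almost_paracomplex A j"
    and "isometric A g j"
  shows "parallel A \<Gamma> j \<longleftrightarrow>
    (\<exists>F G. foliation M A F \<and> foliation M A G \<and>
       tangent_to_foliation M A (eigenplane j 1) F \<and>
       tangent_to_foliation M A (eigenplane j (-1)) G \<and>
       orthogonal_foliations M A g F G \<and>
       (\<forall>L\<in>leaves M F. totally_geodesic_leaf A \<Gamma> F L) \<and>
       (\<forall>L\<in>leaves M G. totally_geodesic_leaf A \<Gamma> G L))"
proof -
  interpret plus: paracomplex_manifold M A g \<Gamma> j
    by unfold_locales (fact assms)+
  \<comment> \<open>Metric and connection are unchanged here, so the geodesic condition for
    \<open>neg_j\<close> is the one for \<open>j\<close>.\<close>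
  interpret minus: paracomplex_manifold M A g \<Gamma> plus.neg_j
    by (rule plus.paracomplex_manifold_neg)
  show ?thesis
  proof (rule iffI, goal_cases)
    case par: 1
    then have par': "parallel A \<Gamma> plus.neg_j" by (simp add: plus.parallel_neg)
    define F G where "F = plus.adapted_charts" and "G = minus.adapted_charts"
    have F: "foliation M A F" unfolding F_def by (rule plus.parallel_imp_foliation[OF par])
    have G: "foliation M A G" unfolding G_def by (rule minus.parallel_imp_foliation[OF par'])
    have tF: "tangent_to_foliation M A (eigenplane j 1) F"
      using plus.tangent_to_adapted F unfolding F_def by blast
    have tG: "tangent_to_foliation M A (eigenplane j (-1)) G"
      using minus.tangent_to_adapted G unfolding G_def plus.eigenplane_neg by blast
    have gF: "totally_geodesic_leaf A \<Gamma> F L" for L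
      unfolding F_def by (rule plus.parallel_imp_totally_geodesic[OF par])
    have gG: "totally_geodesic_leaf A \<Gamma> G L" for L
      unfolding G_def by (rule minus.parallel_imp_totally_geodesic[OF par'])
    show ?case
      using F G tF tG gF gG plus.orthogonal_eigenfoliations[OF tF tG] by blast
  next
    case 2
    then obtain F G where F: "foliation M A F" "tangent_to_foliation M A (eigenplane j 1) F"
        "\<forall>L\<in>leaves M F. totally_geodesic_leaf A \<Gamma> F L"
      and G: "foliation M A G" "tangent_to_foliation M A (eigenplane j (-1)) G"
        "\<forall>L\<in>leaves M G. totally_geodesic_leaf A \<Gamma> G L"
      by blast
    show "parallel A \<Gamma> j"
      unfolding parallel_def
    proof (intro ballI allI)
      fix c x u v assume c: "c \<in> A" "x \<in> chart_image c"
      show "nabla_endo \<Gamma> j c x u v = 0"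
      proof (rule plus.nabla_endo_eq_0[OF c])
        show "nabla_endo \<Gamma> j c x u v = 0" if "j c x u = u" "j c x v = v" for u v
          by (rule plus.totally_geodesic_imp_nabla_endo_eq_0[OF F c that])
        \<comment> \<open>The -1 eigenvectors of \<open>j\<close> are fixed by \<open>neg_j\<close>,
          so the vanishing is obtained for its derivative, and the sign is then undone.\<close>
        show "nabla_endo \<Gamma> j c x u v = 0" if "j c x u = - u" "j c x v = - v" for u v
        proof -
          have "nabla_endo \<Gamma> plus.neg_j c x u v = 0"
            by (rule minus.totally_geodesic_imp_nabla_endo_eq_0[OF G(1) _ G(3) c])
              (simp_all add: plus.eigenplane_neg G(2) that)
          then show ?thesis by (simp add: plus.nabla_endo_neg[OF c])
        qed
      qed
    qed
  qed
qed

end
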